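(* Let $T$ be a polygonal transformation in $\mathbb{P}^d$ admitting a linear scaling symmetry. Let $P$ be a closed $n$-gon. Then, for any integer $k\geq1$, the $k$-th infinitesimal monodromy is $$M^{(k)}(1)=\sum_{1\leq i_1<\dots<i_k\leq n} S_{i_1}\cdots S_{i_k},$$ where $S_i$ is the linear operator $$S_i: p\mapsto \sum_{j=0}^{d} \frac{c_{i,j+1}'(1)}{c_{i,j+1}(1)}\, \frac{\det(p_{i},\dots,p_{i+j-1},p,p_{i+j+1},\dots,p_{i+d})}{\det(p_{i},\dots,p_{i+d})}\,p_{i+j}.$$ Moreover, $M^{(k)}(1)$ is invariant under the dynamic.
   Context: Let $F$ be a field, $\mathbb{P}^d=\mathbb{P}^d(F)$, $\mathrm{PGL}_{d+1}=\mathrm{GL}_{d+1}(F)/F^*$, $\mathbb{G}_m=F^*$ (as algebraic group). A (twisted) $n$-gon in $\mathbb{P}^d$ is $P=((p_i)_{i\in\mathbb{Z}},M)$ with $p_i\in\mathbb{P}^d$, monodromy $M\in\mathrm{PGL}_{d+1}$, $p_{i+n}=Mp_i$, such that $(p_i,\dots,p_{i+d+1})$ is a projective frame for every $i$; it is closed if $M=\mathrm{Id}$. $\mathrm{PGL}_{d+1}$ acts on the space $\tilde{\mathcal T}_n$ of $n$-gons by $A\cdot P=((Ap_i),AMA^{-1})$, with quotient (moduli space) $\mathcal T_n$ and class $[P]$. A polygonal transformation is a birational map $T:\tilde{\mathcal T}_n\dashrightarrow\tilde{\mathcal T}_n$ commuting with this action; it induces a birational map of $\mathcal T_n$, also denoted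 $T$. Cross-ratio coordinates: for a projective frame $(q_0,\dots,q_{d+1})$ let $C_{q_0,\dots,q_{d+1}}$ be the unique projective transformation mapping it to $([1:\dots:1],[1:0:\dots:0],\dots,[0:\dots:0:1])$; put $c_i=[c_{i,1}:\dots:c_{i,d+1}]:=C_{p_{i-1},p_i,\dots,p_{i+d}}(p_{i+d+1})$, normalized by $c_{i,d+1}=1$. They determine $[P]$. A scaling symmetry is a non-trivial action $\rho:\mathbb{G}_m\times\mathcal T_n\to\mathcal T_n$, $(t,[P])\mapsto[P]_t$, of the algebraic group $\mathbb{G}_m$ (rational in $t$ and in the coordinates, undefined where the deformed polygon degenerates) commuting with $T$; $c_{i,j}(t)$ denotes the coordinates of $[P]_t$. It is linear if $c_{i,j}(t)=c_{i,j}(1)+c_{i,j}'(1)(t-1)$ for $1\le j\le d$ and $c_{i,d+1}(t)=1$. The deformation is lifted to the family $(P_t)$ with $P_1=P$, $[P_t]=[P]_t$ and $(p_0(t),\dots,p_{d+1}(t))$ constant. When this constant frame is the standard one, the monodromy $M(t)$ of $P_t$ is represented by the matrix $L_1(t)\cdots L_n(t)$, where $L_i(t)$ has last column $(c_{i,1}(t),\dots,c_{i,d+1}(t))^T$, entries $-c_{i,j+1}(t)$ at position $(j+1,j)$ for $1\leq j\leq d$, and zeros elsewhere; in general by its conjugate. It is rescaled by a constant so that $M(1)=\mathrm{Id}$ (possible since $P$ is closed). $M^{(k)}$ is the $k$-th derivative in $t$. Determinants and sums in $S_i$ are computed with any lifts of the $p_i$ to $F^{d+1}\setminus\{0\}$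 (the result does not depend on them), and $p\in F^{d+1}$.
   Formalization: The sum is M^{(k)}(1)/k!, not M^{(k)}(1). Invariance assumes T preserves the monodromy; it holds for M(t) along T(P_t), and for M^{(k)}(1) in its own constant frame only modulo scalars and if the lower M^{(l)}(1)/l!, 1≤l<k, are scalar. *)

theory Defs
  imports
    "HOL-Library.Poly_Mapping"
    "HOL-Computational_Algebra.Computational_Algebra"
    "Jordan_Normal_Form.Determinant"
    "Jordan_Normal_Form.Gauss_Jordan_Elimination"
begin

section \<open>Projective space and polygons\<close>

text \<open>
  Points of projective \<open>d\<close>-space are represented by their lifts, nonzero vectors of dimension
  \<open>d + 1\<close>, and elements of \<open>PGL\<close> by invertible matrices. Equality of points and of elements of
  \<open>PGL\<close> is proportionality.
\<close>

definition proj_eq :: "'k::field vec \<Rightarrow> 'k vec \<Rightarrow> bool" where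
  "proj_eq u v \<longleftrightarrow> (\<exists>s. s \<noteq> 0 \<and> u = s \<cdot>\<^sub>v v)"

definition proj_eq_mat :: "'k::field mat \<Rightarrow> 'k mat \<Rightarrow> bool" where
  "proj_eq_mat A B \<longleftrightarrow> (\<exists>s. s \<noteq> 0 \<and> A = s \<cdot>\<^sub>m B)"

definition proj_frame :: "nat \<Rightarrow> (nat \<Rightarrow> 'k::field vec) \<Rightarrow> bool" where
  "proj_frame d q \<longleftrightarrow>
     (\<forall>m\<le>d + 1. q m \<in> carrier_vec (d + 1)) \<and>
     (\<forall>m\<le>d + 1. det (mat_of_cols (d + 1) (map q (filter (\<lambda>l. l \<noteq> m) [0..<d + 2]))) \<noteq> 0)"

datatype 'k polygon = Polygon (vertex: "int \<Rightarrow> 'k vec") (monodromy: "'k mat")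

definition ngon :: "nat \<Rightarrow> nat \<Rightarrow> 'k::field polygon \<Rightarrow> bool" where
  "ngon d n P \<longleftrightarrow>
     monodromy P \<in> carrier_mat (d + 1) (d + 1) \<and> det (monodromy P) \<noteq> 0 \<and>
     (\<forall>i. proj_eq (vertex P (i + int n)) (monodromy P *\<^sub>v vertex P i)) \<and>
     (\<forall>i. proj_frame d (\<lambda>m. vertex P (i + int m)))"

definition closed_polygon :: "nat \<Rightarrow> 'k::field polygon \<Rightarrow> bool" where
  "closed_polygon d P \<longleftrightarrow> proj_eq_mat (monodromy P) (1\<^sub>m (d + 1))"

definition same_polygon :: "'k::field polygon \<Rightarrow> 'k polygon \<Rightarrow> bool" where
  "same_polygon P Q \<longleftrightarrow>
     (\<forall>i. proj_eq (vertex P i) (vertex Q i)) \<and> proj_eq_mat (monodromy P) (monodromy Q)"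

definition minv :: "'k::field mat \<Rightarrow> 'k mat" where
  "minv A = the (mat_inverse A)"

definition pgl_act :: "'k::field mat \<Rightarrow> 'k polygon \<Rightarrow> 'k polygon" where
  "pgl_act A P = Polygon (\<lambda>i. A *\<^sub>v vertex P i) (A * monodromy P * minv A)"


section \<open>Cross-ratio coordinates\<close>

definition frame_map :: "nat \<Rightarrow> (nat \<Rightarrow> 'k::field vec) \<Rightarrow> 'k mat \<Rightarrow> bool" where
  "frame_map d q A \<longleftrightarrow>
     A \<in> carrier_mat (d + 1) (d + 1) \<and> det A \<noteq> 0 \<and>
     proj_eq (A *\<^sub>v q 0) (vec (d + 1) (\<lambda>_. 1)) \<and>
     (\<forall>j<d + 1. proj_eq (A *\<^sub>v q (Suc j)) (unit_vec (d + 1) j))"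

text \<open>The choice is unique up to a scalar when \<open>q\<close> is a projective frame.\<close>

definition frame_transform :: "nat \<Rightarrow> (nat \<Rightarrow> 'k::field vec) \<Rightarrow> 'k mat" where
  "frame_transform d q = (SOME A. frame_map d q A)"

text \<open>
  The coordinate \<open>cr d P i j\<close>, for \<open>1 \<le> j \<le> d + 1\<close>, is the ratio of the \<open>j\<close>-th to the last
  homogeneous coordinate of the image of \<open>p\<^sub>i\<^sub>+\<^sub>d\<^sub>+\<^sub>1\<close> (indices of \<open>vec\<close> start at 0).
\<close>

definition cr :: "nat \<Rightarrow> 'k::field polygon \<Rightarrow> int \<Rightarrow> nat \<Rightarrow> 'k" where
  "cr d P i j =
     (let v = frame_transform d (\<lambda>m. vertex P (i - 1 + int m)) *\<^sub>v vertex P (i + int d + 1)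
      in v $ (j - 1) / v $ d)"

text \<open>
  The moduli space is the set of all families \<open>c i j\<close> (\<open>1 \<le> i \<le> n\<close>, \<open>1 \<le> j \<le> d\<close>) of nonzero
  coordinates: a vanishing \<open>c i j\<close> means that \<open>(p\<^sub>i, \<dots>, p\<^sub>i\<^sub>+\<^sub>d\<^sub>+\<^sub>1)\<close> is not a frame. Values of
  \<open>c\<close> outside the index range are irrelevant.
\<close>

definition moduli_point :: "nat \<Rightarrow> nat \<Rightarrow> (int \<Rightarrow> nat \<Rightarrow> 'k::field) \<Rightarrow> bool" where
  "moduli_point d n c \<longleftrightarrow> (\<forall>i\<in>{1..int n}. \<forall>j\<in>{1..d}. c i j \<noteq> 0)"

definition moduli_eq :: "nat \<Rightarrow> nat \<Rightarrow> (int \<Rightarrow> nat \<Rightarrow> 'k::field) \<Rightarrow> (int \<Rightarrow> nat \<Rightarrow> 'k) \<Rightarrow> bool" where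
  "moduli_eq d n c c' \<longleftrightarrow> (\<forall>i\<in>{1..int n}. \<forall>j\<in>{1..d}. c i j = c' i j)"


section \<open>Polynomials and points over the field of rational functions\<close>

text \<open>
  Rational maps of varieties over the ground field \<open>F = 'a\<close> are given by polynomials over \<open>F\<close>, and
  their properties are expressed on points over \<open>K = F(t) = 'a poly fract\<close>. Since \<open>K\<close> is infinite,
  its points are Zariski dense in all the (rational) varieties involved, so that an identity of
  rational maps is the same as equality at all \<open>K\<close>-points where both sides are defined. Points over
  \<open>F\<close> alone do not suffice when \<open>F\<close> is finite. The field \<open>K\<close> also contains the generic value \<open>t\<close> of
  the deformation parameter, so a deformation of a polygon over \<open>F\<close> is a polygon over \<open>K\<close>.
\<close>

type_synonym ('v, 'a) mpoly = "('v \<Rightarrow>\<^sub>0 nat) \<Rightarrow>\<^sub>0 'a"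

definition mpoly_vars :: "('v, 'a::zero) mpoly \<Rightarrow> 'v set" where
  "mpoly_vars f = (\<Union>m\<in>Poly_Mapping.keys f. Poly_Mapping.keys m)"

definition mpoly_eval ::
  "('a::zero \<Rightarrow> 'r::comm_semiring_1) \<Rightarrow> ('v \<Rightarrow> 'r) \<Rightarrow> ('v, 'a) mpoly \<Rightarrow> 'r" where
  "mpoly_eval h x f =
     (\<Sum>m\<in>Poly_Mapping.keys f. h (Poly_Mapping.lookup f m) *
        (\<Prod>v\<in>Poly_Mapping.keys m. x v ^ Poly_Mapping.lookup m v))"

definition const :: "'a::field \<Rightarrow> 'a poly fract" where
  "const a = to_fract [:a:]"

definition generic_t :: "'a::field poly fract" where
  "generic_t = to_fract [:0, 1:]"

definition const_polygon :: "'a::field polygon \<Rightarrow> 'a poly fract polygon" where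
  "const_polygon P =
     Polygon (\<lambda>i. map_vec const (vertex P i)) (map_mat const (monodromy P))"


section \<open>Polygonal transformations\<close>

text \<open>
  An \<open>n\<close>-gon is determined by \<open>(p\<^sub>0, \<dots>, p\<^sub>n\<^sub>-\<^sub>1, M)\<close>, so the space of \<open>n\<close>-gons is an open subset of a
  product of projective spaces. A rational self-map is given by tuples of multihomogeneous
  polynomials in the coordinates \<open>VertexCoord i a\<close> of the lifts of the \<open>p\<^sub>i\<close> and the entries
  \<open>MonodromyEntry a b\<close> of \<open>M\<close>. It is defined where these tuples are nonzero and form an \<open>n\<close>-gon;
  taking the polynomials of each tuple coprime gives the largest domain.
\<close>

datatype polygon_var = VertexCoord nat nat | MonodromyEntry nat nat

type_synonym 'a polygon_map =
  "(nat \<Rightarrow> nat \<Rightarrow> (polygon_var, 'a) mpoly) \<times> (nat \<Rightarrow> nat \<Rightarrow> (polygon_var, 'a) mpoly)"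

abbreviation vertex_poly ::
  "'a::zero polygon_map \<Rightarrow> nat \<Rightarrow> nat \<Rightarrow> (polygon_var, 'a) mpoly" where
  "vertex_poly \<equiv> fst"

abbreviation monodromy_poly ::
  "'a::zero polygon_map \<Rightarrow> nat \<Rightarrow> nat \<Rightarrow> (polygon_var, 'a) mpoly" where
  "monodromy_poly \<equiv> snd"

definition polygon_vars :: "nat \<Rightarrow> nat \<Rightarrow> polygon_var set" where
  "polygon_vars d n =
     {VertexCoord i a | i a. i < n \<and> a \<le> d} \<union> {MonodromyEntry a b | a b. a \<le> d \<and> b \<le> d}"

fun var_block :: "polygon_var \<Rightarrow> nat option" where
  "var_block (VertexCoord i a) = Some i"
| "var_block (MonodromyEntry a b) = None"

definition block_degree :: "nat option \<Rightarrow> (polygon_var \<Rightarrow>\<^sub>0 nat) \<Rightarrow> nat" where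
  "block_degree b m =
     (\<Sum>v\<in>{v \<in> Poly_Mapping.keys m. var_block v = b}. Poly_Mapping.lookup m v)"

definition multihomogeneous :: "(nat option \<Rightarrow> nat) \<Rightarrow> (polygon_var, 'a::zero) mpoly \<Rightarrow> bool" where
  "multihomogeneous e f \<longleftrightarrow> (\<forall>m\<in>Poly_Mapping.keys f. \<forall>b. block_degree b m = e b)"

definition wf_polygon_map :: "nat \<Rightarrow> nat \<Rightarrow> 'a::field polygon_map \<Rightarrow> bool" where
  "wf_polygon_map d n T \<longleftrightarrow>
     (\<forall>i<n. \<exists>e. \<forall>a\<le>d. mpoly_vars (vertex_poly T i a) \<subseteq> polygon_vars d n \<and>
        multihomogeneous e (vertex_poly T i a)) \<and>
     (\<exists>e. \<forall>a\<le>d. \<forall>b\<le>d. mpoly_vars (monodromy_poly T a b) \<subseteq> polygon_vars d n \<and>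
        multihomogeneous e (monodromy_poly T a b))"

fun polygon_coords :: "'k polygon \<Rightarrow> polygon_var \<Rightarrow> 'k" where
  "polygon_coords P (VertexCoord i a) = vertex P (int i) $ a"
| "polygon_coords P (MonodromyEntry a b) = monodromy P $$ (a, b)"

text \<open>\<open>maps_to d n T P Q\<close>: the map \<open>T\<close> is defined at the \<open>n\<close>-gon \<open>P\<close> and \<open>Q\<close> is a lift of its value.\<close>

definition maps_to ::
  "nat \<Rightarrow> nat \<Rightarrow> 'a::field polygon_map \<Rightarrow> 'a poly fract polygon \<Rightarrow> 'a poly fract polygon \<Rightarrow> bool"
where
  "maps_to d n T P Q \<longleftrightarrow>
     ngon d n P \<and> ngon d n Q \<and>
     (\<forall>i<n. proj_eq (vertex Q (int i))
        (vec (d + 1) (\<lambda>a. mpoly_eval const (polygon_coords P) (vertex_poly T i a)))) \<and>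
     proj_eq_mat (monodromy Q)
       (mat (d + 1) (d + 1)
          (\<lambda>(a, b). mpoly_eval const (polygon_coords P) (monodromy_poly T a b)))"

text \<open>The composition \<open>S \<circ> T\<close> is somewhere defined and is the identity as a rational map.\<close>

definition left_inverse_map :: "nat \<Rightarrow> nat \<Rightarrow> 'a::field polygon_map \<Rightarrow> 'a polygon_map \<Rightarrow> bool" where
  "left_inverse_map d n S T \<longleftrightarrow>
     (\<exists>P Q R. maps_to d n T P Q \<and> maps_to d n S Q R) \<and>
     (\<forall>P Q R. maps_to d n T P Q \<and> maps_to d n S Q R \<longrightarrow> same_polygon R P)"

definition birational_map :: "nat \<Rightarrow> nat \<Rightarrow> 'a::field polygon_map \<Rightarrow> bool" where
  "birational_map d n T \<longleftrightarrow>
     wf_polygon_map d n T \<and>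
     (\<exists>S. wf_polygon_map d n S \<and> left_inverse_map d n S T \<and> left_inverse_map d n T S)"

definition polygonal_transformation :: "nat \<Rightarrow> nat \<Rightarrow> 'a::field polygon_map \<Rightarrow> bool" where
  "polygonal_transformation d n T \<longleftrightarrow>
     birational_map d n T \<and>
     (\<forall>A P Q R. A \<in> carrier_mat (d + 1) (d + 1) \<and> det A \<noteq> 0 \<and>
        maps_to d n T P Q \<and> maps_to d n T (pgl_act A P) R \<longrightarrow> same_polygon R (pgl_act A Q))"

definition preserves_monodromy :: "nat \<Rightarrow> nat \<Rightarrow> 'a::field polygon_map \<Rightarrow> bool" where
  "preserves_monodromy d n T \<longleftrightarrow>
     (\<forall>P Q. maps_to d n T P Q \<longrightarrow> proj_eq_mat (monodromy Q) (monodromy P))"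


section \<open>Scaling symmetries\<close>

text \<open>
  A rational map from the product of the multiplicative group and the moduli space to the moduli
  space is given by a numerator and a denominator for each coordinate, polynomials in the group
  parameter \<open>Time\<close> and the coordinates \<open>Coord i j\<close>.
\<close>

datatype scaling_var = Time | Coord int nat

type_synonym 'a scaling = "int \<Rightarrow> nat \<Rightarrow> (scaling_var, 'a) mpoly \<times> (scaling_var, 'a) mpoly"

definition wf_scaling :: "nat \<Rightarrow> nat \<Rightarrow> 'a::field scaling \<Rightarrow> bool" where
  "wf_scaling d n \<rho> \<longleftrightarrow>
     (\<forall>i\<in>{1..int n}. \<forall>j\<in>{1..d}. mpoly_vars (fst (\<rho> i j)) \<union> mpoly_vars (snd (\<rho> i j))
        \<subseteq> {Time} \<union> {Coord i j | i j. i \<in> {1..int n} \<and> j \<in> {1..d}})"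

text \<open>
  At a fixed point \<open>c\<close> of the moduli space the numerator and the denominator of the deformed
  coordinate \<open>c\<^sub>i\<^sub>,\<^sub>j(t)\<close> become polynomials in the parameter. The point may have coordinates in an
  extension of the ground field, given by the embedding \<open>h\<close> (either \<open>id\<close> or \<open>const\<close> below).
\<close>

definition scaling_curve ::
  "('a::field \<Rightarrow> 'k::field) \<Rightarrow> (int \<Rightarrow> nat \<Rightarrow> 'k) \<Rightarrow> (scaling_var, 'a) mpoly \<Rightarrow> 'k poly" where
  "scaling_curve h c f =
     mpoly_eval (\<lambda>a. [:h a:]) (\<lambda>v. case v of Time \<Rightarrow> [:0, 1:] | Coord i j \<Rightarrow> [:c i j:]) f"

abbreviation numer ::
  "('a::field \<Rightarrow> 'k::field) \<Rightarrow> 'a scaling \<Rightarrow> (int \<Rightarrow> nat \<Rightarrow> 'k) \<Rightarrow> int \<Rightarrow> nat \<Rightarrow> 'k poly" where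
  "numer h \<rho> c i j \<equiv> scaling_curve h c (fst (\<rho> i j))"

abbreviation denom ::
  "('a::field \<Rightarrow> 'k::field) \<Rightarrow> 'a scaling \<Rightarrow> (int \<Rightarrow> nat \<Rightarrow> 'k) \<Rightarrow> int \<Rightarrow> nat \<Rightarrow> 'k poly" where
  "denom h \<rho> c i j \<equiv> scaling_curve h c (snd (\<rho> i j))"

definition scaled ::
  "('a::field \<Rightarrow> 'k::field) \<Rightarrow> 'a scaling \<Rightarrow> 'k \<Rightarrow> (int \<Rightarrow> nat \<Rightarrow> 'k) \<Rightarrow> int \<Rightarrow> nat \<Rightarrow> 'k" where
  "scaled h \<rho> t c i j = poly (numer h \<rho> c i j) t / poly (denom h \<rho> c i j) t"

definition scaling_defined ::
  "nat \<Rightarrow> nat \<Rightarrow> ('a::field \<Rightarrow> 'k::field) \<Rightarrow> 'a scaling \<Rightarrow> 'k \<Rightarrow> (int \<Rightarrow> nat \<Rightarrow> 'k) \<Rightarrow> bool" where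
  "scaling_defined d n h \<rho> t c \<longleftrightarrow>
     (\<forall>i\<in>{1..int n}. \<forall>j\<in>{1..d}. poly (denom h \<rho> c i j) t \<noteq> 0 \<and> scaled h \<rho> t c i j \<noteq> 0)"

text \<open>The derivative \<open>c\<^sub>i\<^sub>,\<^sub>j'(1)\<close> of the rational function \<open>c\<^sub>i\<^sub>,\<^sub>j(t)\<close>, by the quotient rule.\<close>

definition scaling_velocity ::
  "('a::field \<Rightarrow> 'k::field) \<Rightarrow> 'a scaling \<Rightarrow> (int \<Rightarrow> nat \<Rightarrow> 'k) \<Rightarrow> int \<Rightarrow> nat \<Rightarrow> 'k" where
  "scaling_velocity h \<rho> c i j =
     (poly (pderiv (numer h \<rho> c i j)) 1 * poly (denom h \<rho> c i j) 1
      - poly (numer h \<rho> c i j) 1 * poly (pderiv (denom h \<rho> c i j)) 1)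
     / (poly (denom h \<rho> c i j) 1)\<^sup>2"

definition scaling_symmetry ::
  "nat \<Rightarrow> nat \<Rightarrow> 'a::field polygon_map \<Rightarrow> 'a scaling \<Rightarrow> bool" where
  "scaling_symmetry d n T \<rho> \<longleftrightarrow>
     wf_scaling d n \<rho> \<and>
     \<comment> \<open>action of the multiplicative group\<close>
     (\<exists>c. moduli_point d n c \<and> scaling_defined d n const \<rho> 1 c) \<and>
     (\<forall>c. moduli_point d n c \<and> scaling_defined d n const \<rho> 1 c \<longrightarrow>
        moduli_eq d n (scaled const \<rho> 1 c) c) \<and>
     (\<forall>s t c. s \<noteq> 0 \<and> t \<noteq> 0 \<and> moduli_point d n c \<and> scaling_defined d n const \<rho> t c \<and>
        scaling_defined d n const \<rho> s (scaled const \<rho> t c) \<and> scaling_defined d n const \<rho> (s * t) c \<longrightarrow>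
        moduli_eq d n (scaled const \<rho> s (scaled const \<rho> t c)) (scaled const \<rho> (s * t) c)) \<and>
     \<comment> \<open>non-trivial\<close>
     (\<exists>t c. t \<noteq> 0 \<and> moduli_point d n c \<and> scaling_defined d n const \<rho> t c \<and>
        \<not> moduli_eq d n (scaled const \<rho> t c) c) \<and>
     \<comment> \<open>commutes with \<open>T\<close>\<close>
     (\<forall>t P Q P' Q'. t \<noteq> 0 \<and> maps_to d n T P Q \<and> maps_to d n T P' Q' \<and>
        scaling_defined d n const \<rho> t (cr d P) \<and> moduli_eq d n (cr d P') (scaled const \<rho> t (cr d P)) \<and>
        scaling_defined d n const \<rho> t (cr d Q) \<longrightarrow>
        moduli_eq d n (cr d Q') (scaled const \<rho> t (cr d Q)))"

text \<open>\<open>c\<^sub>i\<^sub>,\<^sub>j(t) = c\<^sub>i\<^sub>,\<^sub>j(1) + c\<^sub>i\<^sub>,\<^sub>j'(1) (t - 1)\<close> as rational functions of \<open>t\<close>.\<close>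

definition linear_scaling :: "nat \<Rightarrow> nat \<Rightarrow> 'a::field scaling \<Rightarrow> bool" where
  "linear_scaling d n \<rho> \<longleftrightarrow>
     (\<forall>c::int \<Rightarrow> nat \<Rightarrow> 'a poly fract. moduli_point d n c \<and> scaling_defined d n const \<rho> 1 c \<longrightarrow>
        (\<forall>i\<in>{1..int n}. \<forall>j\<in>{1..d}.
           Fract (numer const \<rho> c i j) (denom const \<rho> c i j) =
           to_fract ([:scaled const \<rho> 1 c i j:]
             + Polynomial.smult (scaling_velocity const \<rho> c i j) [:-1, 1:])))"


section \<open>Deformations and their monodromy\<close>

text \<open>
  \<open>specializes d Pt P\<close>: the value at \<open>t = 1\<close> of the polygon \<open>Pt\<close> over \<open>F(t)\<close> is \<open>P\<close>, that is,
  \<open>Pt\<close> has lifts that are polynomial in \<open>t\<close> and whose values at \<open>t = 1\<close> are lifts of \<open>P\<close>.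
\<close>

definition specializes :: "nat \<Rightarrow> 'a::field poly fract polygon \<Rightarrow> 'a polygon \<Rightarrow> bool" where
  "specializes d Pt P \<longleftrightarrow>
     (\<forall>i. \<exists>w\<in>carrier_vec (d + 1). proj_eq (vertex Pt i) (map_vec to_fract w) \<and>
        proj_eq (vertex P i) (map_vec (\<lambda>f. poly f 1) w)) \<and>
     (\<exists>W\<in>carrier_mat (d + 1) (d + 1). proj_eq_mat (monodromy Pt) (map_mat to_fract W) \<and>
        proj_eq_mat (monodromy P) (map_mat (\<lambda>f. poly f 1) W))"

definition lifted_deformation ::
  "nat \<Rightarrow> nat \<Rightarrow> 'a::field scaling \<Rightarrow> 'a polygon \<Rightarrow> 'a poly fract polygon \<Rightarrow> bool" where
  "lifted_deformation d n \<rho> P Pt \<longleftrightarrow>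
     ngon d n Pt \<and> specializes d Pt P \<and>
     moduli_eq d n (cr d Pt) (scaled const \<rho> generic_t (\<lambda>i j. const (cr d P i j)))"

definition framed_deformation ::
  "nat \<Rightarrow> nat \<Rightarrow> 'a::field scaling \<Rightarrow> 'a polygon \<Rightarrow> 'a poly fract polygon \<Rightarrow> bool" where
  "framed_deformation d n \<rho> P Pt \<longleftrightarrow>
     lifted_deformation d n \<rho> P Pt \<and>
     (\<forall>m\<le>d + 1. proj_eq (vertex Pt (int m)) (map_vec const (vertex P (int m))))"

text \<open>
  The derivative \<open>c\<^sub>i\<^sub>,\<^sub>j'(1)\<close> and the polynomial \<open>c\<^sub>i\<^sub>,\<^sub>j(t)\<close> of the deformation of \<open>P\<close> under a linear
  scaling symmetry, for \<open>1 \<le> j \<le> d + 1\<close>; the last coordinate is constantly 1.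
\<close>

definition cr_deriv :: "nat \<Rightarrow> 'a::field scaling \<Rightarrow> 'a polygon \<Rightarrow> int \<Rightarrow> nat \<Rightarrow> 'a" where
  "cr_deriv d \<rho> P i j = (if j = d + 1 then 0 else scaling_velocity id \<rho> (cr d P) i j)"

definition cr_poly :: "nat \<Rightarrow> 'a::field scaling \<Rightarrow> 'a polygon \<Rightarrow> int \<Rightarrow> nat \<Rightarrow> 'a poly" where
  "cr_poly d \<rho> P i j = [:cr d P i j:] + Polynomial.smult (cr_deriv d \<rho> P i j) [:-1, 1:]"

definition L_mat :: "nat \<Rightarrow> 'a::field scaling \<Rightarrow> 'a polygon \<Rightarrow> int \<Rightarrow> 'a poly mat" where
  "L_mat d \<rho> P i =
     mat (d + 1) (d + 1)
       (\<lambda>(r, s). if s = d then cr_poly d \<rho> P i (r + 1)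
                 else if r = s + 1 then - cr_poly d \<rho> P i (r + 1) else 0)"

text \<open>
  The matrix \<open>M(t)\<close> before rescaling: the product \<open>L\<^sub>1(t) \<cdots> L\<^sub>n(t)\<close>, conjugated by the map that
  sends the constant frame \<open>(p\<^sub>0, \<dots>, p\<^sub>d\<^sub>+\<^sub>1)\<close> to the standard one.
\<close>

definition raw_monodromy_family :: "nat \<Rightarrow> nat \<Rightarrow> 'a::field scaling \<Rightarrow> 'a polygon \<Rightarrow> 'a poly mat"
where
  "raw_monodromy_family d n \<rho> P =
     (let A = frame_transform d (\<lambda>m. vertex P (int m))
      in map_mat (\<lambda>a. [:a:]) (minv A) *
         foldr (\<lambda>i X. L_mat d \<rho> P i * X) [1..int n] (1\<^sub>m (d + 1)) *
         map_mat (\<lambda>a. [:a:]) A)"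

text \<open>
  For closed \<open>P\<close> the value of the unscaled family at \<open>t = 1\<close> is a scalar matrix, so dividing by its
  upper left entry gives \<open>M(1) = Id\<close>.
\<close>

definition monodromy_family :: "nat \<Rightarrow> nat \<Rightarrow> 'a::field scaling \<Rightarrow> 'a polygon \<Rightarrow> 'a poly mat" where
  "monodromy_family d n \<rho> P =
     (let W = raw_monodromy_family d n \<rho> P
      in [:inverse (poly (W $$ (0, 0)) 1):] \<cdot>\<^sub>m W)"

definition deriv_at_one :: "nat \<Rightarrow> 'a::field poly mat \<Rightarrow> 'a mat" where
  "deriv_at_one k W = map_mat (\<lambda>f. poly ((pderiv ^^ k) f) 1) W"

text \<open>
  The coefficient of \<open>(t - 1)\<^sup>k\<close>: the \<open>k\<close>-th derivative divided by \<open>k!\<close>, which makes sense in every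
  characteristic (Hasse derivative).
\<close>

definition taylor_at_one :: "nat \<Rightarrow> 'a::field poly mat \<Rightarrow> 'a mat" where
  "taylor_at_one k W = map_mat (\<lambda>f. Polynomial.coeff (pcompose f [:1, 1:]) k) W"

definition scalar_matrix :: "nat \<Rightarrow> 'a::field mat \<Rightarrow> bool" where
  "scalar_matrix d X \<longleftrightarrow> (\<exists>s. X = s \<cdot>\<^sub>m 1\<^sub>m (d + 1))"


section \<open>The operators $S_i$\<close>

definition S_op ::
  "nat \<Rightarrow> 'a::field scaling \<Rightarrow> 'a polygon \<Rightarrow> int \<Rightarrow> 'a vec \<Rightarrow> 'a vec" where
  "S_op d \<rho> P i v =
     (let q = map (\<lambda>l. vertex P (i + int l)) [0..<d + 1]
      in finsum_vec TYPE('a) (d + 1)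
           (\<lambda>j. (cr_deriv d \<rho> P i (j + 1) / cr d P i (j + 1)
                  * (det (mat_of_cols (d + 1) (q[j := v])) / det (mat_of_cols (d + 1) q)))
                \<cdot>\<^sub>v vertex P (i + int j))
           {0..d})"

definition S_sum ::
  "nat \<Rightarrow> nat \<Rightarrow> 'a::field scaling \<Rightarrow> 'a polygon \<Rightarrow> nat \<Rightarrow> 'a vec \<Rightarrow> 'a vec" where
  "S_sum d n \<rho> P k v =
     finsum_vec TYPE('a) (d + 1)
       (\<lambda>is. foldr (\<lambda>i f. S_op d \<rho> P i \<circ> f) is id v)
       {is. length is = k \<and> sorted_wrt (<) is \<and> set is \<subseteq> {1..int n}}"

end

theory Submission
  imports Defs
begin

text \<open>
  The proof follows the polygon in moving frames. Call an invertible matrix \<open>B\<close> a basis of the frame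
  \<open>(p\<^sub>i\<^sub>-\<^sub>1, p\<^sub>i, \<dots>, p\<^sub>i\<^sub>+\<^sub>d)\<close> if its columns are lifts of \<open>p\<^sub>i, \<dots>, p\<^sub>i\<^sub>+\<^sub>d\<close> and their sum is a lift of
  \<open>p\<^sub>i\<^sub>-\<^sub>1\<close>. Such a \<open>B\<close> exists and is unique up to a scalar, and the cross-ratio coordinates \<open>c\<^sub>i\<close> are the
  coordinates of \<open>p\<^sub>i\<^sub>+\<^sub>d\<^sub>+\<^sub>1\<close> in it. Hence \<open>B L\<^sub>i\<close> is a basis of the next frame (\<open>ngon_frame_step\<close>), and
  after a full turn \<open>M B\<close> and \<open>B L\<^sub>1 \<cdots> L\<^sub>n\<close> are bases of the same frame
  (\<open>monodromy_companion_prod\<close>). This is true over every field. Applied over \<open>F(t)\<close> it identifies the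
  monodromy of any deformation (\<open>lifted_monodromy\<close>), and the recursion \<open>B\<^sub>i\<^sub>+\<^sub>1 = B\<^sub>i L\<^sub>i(t)\<close>, run in both
  directions from the constant initial frame, constructs one (\<open>framed_deformation_exists\<close>).

  The formula rests on the shape of \<open>L\<^sub>i\<close>: each of its rows is a multiple of a single coordinate. If
  the coordinates are linear in \<open>t\<close>, then \<open>L\<^sub>i(t) = (1 + (t - 1) \<Delta>\<^sub>i) L\<^sub>i(1)\<close> with the diagonal matrix
  \<open>\<Delta>\<^sub>i\<close> of the quotients \<open>c\<^sub>i\<^sub>,\<^sub>j' / c\<^sub>i\<^sub>,\<^sub>j\<close>. By Cramer's rule \<open>S\<^sub>i\<close> is the conjugate of \<open>\<Delta>\<^sub>i\<close> by a basis
  of the \<open>i\<close>-th frame (\<open>S_mat_eq\<close>). Moving the bases through the product \<open>L\<^sub>1(t) \<cdots> L\<^sub>n(t)\<close> from left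
  to right turns it into \<open>(1 + (t - 1) S\<^sub>1) \<cdots> (1 + (t - 1) S\<^sub>n)\<close> times its value at \<open>t = 1\<close>, which is
  scalar because the polygon is closed (\<open>family_eq_factors\<close>). The coefficient of \<open>(t - 1)\<^sup>k\<close> is
  the sum of the products \<open>S\<^sub>i\<^sub>1 \<cdots> S\<^sub>i\<^sub>k\<close> over increasing indices.

  For the invariance, choose lifts of the deformation \<open>P\<^sub>t\<close> that are polynomial in \<open>t\<close>. The
  transformation \<open>T\<close> is given by multihomogeneous polynomials, so \<open>T(P\<^sub>t)\<close> has polynomial lifts as
  well, and their values at \<open>t = 1\<close> are lifts of \<open>T(P)\<close>. A determinant that does not vanish at
  \<open>t = 1\<close> is not the zero polynomial, so \<open>T(P\<^sub>t)\<close> is an \<open>n\<close>-gon (\<open>transformation_defined\<close>); it is a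
  lifted deformation of \<open>T(P)\<close> because \<open>T\<close> commutes with the scaling, and it has the monodromy of
  \<open>P\<^sub>t\<close>. It need not have a constant initial frame. Correcting this conjugates the monodromy by a
  matrix \<open>H(t)\<close> with \<open>H(1)\<close> scalar, and such a conjugation preserves, modulo scalars, the first Taylor
  coefficient that is not scalar (\<open>taylor_conjugate\<close>).
\<close>

(* The infix is shared by formal power series and vectors; below it denotes components of vectors. *)
no_notation fps_nth (infixl \<open>$\<close> 75)

section \<open>Matrices up to scalars\<close>

lemma smult_mat_smult: "a \<cdot>\<^sub>m (b \<cdot>\<^sub>m A) = (a * b :: 'k::comm_ring_1) \<cdot>\<^sub>m A"
  by (rule eq_matI) (auto simp: ac_simps)

lemma one_smult_mat: "(1 :: 'k::comm_ring_1) \<cdot>\<^sub>m A = A"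
  by (rule eq_matI) auto

text \<open>
  The next rules have equations between dimensions as premises, in place of memberships in carriers
  with unknown dimensions. These the simplifier can decide for nested products.
\<close>

lemma mult_mat_vec_smult:
  fixes A :: "'k::comm_ring_1 mat"
  shows "dim_col A = dim_vec v \<Longrightarrow> A *\<^sub>v (a \<cdot>\<^sub>v v) = a \<cdot>\<^sub>v (A *\<^sub>v v)"
  by (rule eq_vecI) (auto simp: scalar_prod_def sum_distrib_left ac_simps)

lemma smult_mat_mult_vec:
  fixes A :: "'k::comm_ring_1 mat"
  shows "dim_col A = dim_vec v \<Longrightarrow> (a \<cdot>\<^sub>m A) *\<^sub>v v = a \<cdot>\<^sub>v (A *\<^sub>v v)"
  by (rule eq_vecI) (auto simp: scalar_prod_def sum_distrib_left ac_simps)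

lemma mult_mat_assoc_dim:
  "dim_col A = dim_row B \<Longrightarrow> dim_col B = dim_row C \<Longrightarrow> A * B * C = A * (B * (C :: 'k::comm_ring_1 mat))"
  by (rule assoc_mult_mat[of A "dim_row A" "dim_row B" B "dim_row C" C "dim_col C"]) auto

lemma mult_mat_vec_assoc_dim:
  "dim_col A = dim_row B \<Longrightarrow> dim_col B = dim_vec v \<Longrightarrow> A * B *\<^sub>v v = A *\<^sub>v (B *\<^sub>v (v :: 'k::comm_ring_1 vec))"
  by (rule assoc_mult_mat_vec[of A "dim_row A" "dim_row B" B "dim_vec v" v]) auto

lemma mult_mat_smult_dim:
  "dim_col A = dim_row B \<Longrightarrow> A * (a \<cdot>\<^sub>m B) = (a :: 'k::comm_ring_1) \<cdot>\<^sub>m (A * B)"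
  by (rule mult_smult_distrib[of A "dim_row A" "dim_row B" B "dim_col B"]) auto

lemma smult_mat_mult_dim:
  "dim_col A = dim_row B \<Longrightarrow> (a \<cdot>\<^sub>m A) * B = (a :: 'k::comm_ring_1) \<cdot>\<^sub>m (A * B)"
  by (rule mult_smult_assoc_mat[of A "dim_row A" "dim_row B" B "dim_col B"]) auto

lemma smult_vec_smult: "a \<cdot>\<^sub>v (b \<cdot>\<^sub>v v) = (a * b :: 'k::comm_ring_1) \<cdot>\<^sub>v v"
  by (rule smult_smult_assoc)

lemmas mat_scalars =
  smult_mat_smult one_smult_mat mult_mat_vec_smult smult_mat_mult_vec mult_mat_smult_dim
  smult_mat_mult_dim smult_vec_smult

lemma mult_unit_vec_eq_col:
  "j < dim_col A \<Longrightarrow> A *\<^sub>v unit_vec (dim_col A) j = col (A :: 'k::comm_ring_1 mat) j"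
  by (rule eq_vecI) (auto simp: scalar_prod_right_unit)

lemma eq_mat_unit_vecI:
  fixes A B :: "'k::comm_ring_1 mat"
  assumes "A \<in> carrier_mat m n" and "B \<in> carrier_mat m n"
    and "\<And>j. j < n \<Longrightarrow> A *\<^sub>v unit_vec n j = B *\<^sub>v unit_vec n j"
  shows "A = B"
proof (rule mat_col_eqI)
  have dims: "dim_col A = n" "dim_col B = n" using assms(1,2) by auto
  fix j assume "j < dim_col B"
  then have j: "j < n" using dims by simp
  have "col A j = A *\<^sub>v unit_vec n j" using j mult_unit_vec_eq_col[of j A] unfolding dims by metis
  also have "\<dots> = B *\<^sub>v unit_vec n j" using j by (rule assms(3))
  also have "\<dots> = col B j" using j mult_unit_vec_eq_col[of j B] unfolding dims by metis
  finally show "col A j = col B j" .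
qed (use assms(1,2) in auto)

lemma proj_eq_refl [simp]: "proj_eq u u"
  unfolding proj_eq_def by (rule exI[of _ 1]) simp

lemma proj_eq_sym: "proj_eq u v \<Longrightarrow> proj_eq v u"
  unfolding proj_eq_def
  by (metis inverse_nonzero_iff_nonzero left_inverse one_smult_vec smult_smult_assoc)

lemma proj_eq_trans [trans]: "proj_eq u v \<Longrightarrow> proj_eq v w \<Longrightarrow> proj_eq u w"
  unfolding proj_eq_def by (metis no_zero_divisors smult_smult_assoc)

lemma proj_eq_carrier: "proj_eq u v \<Longrightarrow> u \<in> carrier_vec n \<longleftrightarrow> v \<in> carrier_vec n"
  unfolding proj_eq_def by auto

lemma proj_eq_smult: "s \<noteq> 0 \<Longrightarrow> proj_eq (s \<cdot>\<^sub>v u) u"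
  unfolding proj_eq_def by auto

lemma proj_eq_mult_mat: "proj_eq u v \<Longrightarrow> dim_col A = dim_vec v \<Longrightarrow> proj_eq (A *\<^sub>v u) (A *\<^sub>v v)"
  unfolding proj_eq_def by (auto simp: mult_mat_vec_smult)

lemma proj_eq_mat_refl [simp]: "proj_eq_mat A A"
  unfolding proj_eq_mat_def by (rule exI[of _ 1]) (simp add: one_smult_mat)

lemma proj_eq_mat_sym: "proj_eq_mat A B \<Longrightarrow> proj_eq_mat B A"
  unfolding proj_eq_mat_def
  by (metis inverse_nonzero_iff_nonzero left_inverse one_smult_mat smult_mat_smult)

lemma proj_eq_mat_trans [trans]: "proj_eq_mat A B \<Longrightarrow> proj_eq_mat B C \<Longrightarrow> proj_eq_mat A C"
  unfolding proj_eq_mat_def by (metis no_zero_divisors smult_mat_smult)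

lemma proj_eq_mat_smult: "s \<noteq> 0 \<Longrightarrow> proj_eq_mat (s \<cdot>\<^sub>m A) A"
  unfolding proj_eq_mat_def by auto

lemma proj_eq_mat_mult_vec: "proj_eq_mat A B \<Longrightarrow> dim_col B = dim_vec v \<Longrightarrow> proj_eq (A *\<^sub>v v) (B *\<^sub>v v)"
  unfolding proj_eq_def proj_eq_mat_def by (auto simp: mat_scalars)

lemma proj_eq_mat_mult_left: "proj_eq_mat A B \<Longrightarrow> dim_col C = dim_row B \<Longrightarrow> proj_eq_mat (C * A) (C * B)"
  unfolding proj_eq_mat_def by (auto simp: mat_scalars)

lemma proj_eq_mat_mult_right: "proj_eq_mat A B \<Longrightarrow> dim_col B = dim_row C \<Longrightarrow> proj_eq_mat (A * C) (B * C)"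
  unfolding proj_eq_mat_def by (auto simp: mat_scalars)

lemma det_nonzero_minv:
  assumes "A \<in> carrier_mat n n" and "det A \<noteq> 0"
  shows "minv A \<in> carrier_mat n n" "A * minv A = 1\<^sub>m n" "minv A * A = 1\<^sub>m n" "det (minv A) \<noteq> 0"
proof -
  have "mat_inverse A \<noteq> None"
    using mat_inverse(1)[OF assms(1), of "()"] det_non_zero_imp_unit[OF assms, of "()"] by auto
  then have inv: "A * minv A = 1\<^sub>m n \<and> minv A * A = 1\<^sub>m n \<and> minv A \<in> carrier_mat n n"
    unfolding minv_def using mat_inverse(2)[OF assms(1)] by auto
  then show "minv A \<in> carrier_mat n n" "A * minv A = 1\<^sub>m n" "minv A * A = 1\<^sub>m n" by auto
  have "det A * det (minv A) = 1"
    using inv assms det_mult[of A n "minv A"] by simp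
  then show "det (minv A) \<noteq> 0" by auto
qed

section \<open>Projective frames\<close>

abbreviation square_mats :: "nat \<Rightarrow> 'k mat set" where
  "square_mats d \<equiv> carrier_mat (d + 1) (d + 1)"

abbreviation ones :: "nat \<Rightarrow> 'k::one vec" where
  "ones n \<equiv> vec n (\<lambda>_. 1)"

text \<open>
  The columns of \<open>B\<close> are lifts of all points of the frame but the first, normalized so that their sum
  is a lift of the first one. Thus \<open>B\<close> maps the standard frame to \<open>q\<close>, and it is the inverse of the
  transformation that defines the cross-ratio coordinates. In terms of \<open>B\<close> the passage from one
  frame of a polygon to the next is a multiplication from the right, without inverses.
\<close>

definition frame_basis :: "nat \<Rightarrow> (nat \<Rightarrow> 'k::field vec) \<Rightarrow> 'k mat \<Rightarrow> bool" where
  "frame_basis d q B \<longleftrightarrow>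
     B \<in> square_mats d \<and> det B \<noteq> 0 \<and>
     proj_eq (q 0) (B *\<^sub>v ones (d + 1)) \<and>
     (\<forall>j<d + 1. proj_eq (q (Suc j)) (B *\<^sub>v unit_vec (d + 1) j))"

lemma frame_basisD:
  assumes "frame_basis d q B"
  shows "B \<in> square_mats d" "det B \<noteq> 0" "proj_eq (q 0) (B *\<^sub>v ones (d + 1))"
    "j < d + 1 \<Longrightarrow> proj_eq (q (Suc j)) (B *\<^sub>v unit_vec (d + 1) j)"
  using assms unfolding frame_basis_def by auto

lemma frame_basis_cong:
  assumes "frame_basis d q B" "\<And>m. m \<le> d + 1 \<Longrightarrow> proj_eq (q' m) (q m)"
  shows "frame_basis d q' B"
  unfolding frame_basis_def
proof (intro conjI allI impI)
  note b = frame_basisD[OF assms(1)]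
  show "B \<in> square_mats d" "det B \<noteq> 0" by (rule b)+
  show "proj_eq (q' 0) (B *\<^sub>v ones (d + 1))" by (rule proj_eq_trans[OF assms(2) b(3)]) simp
  fix j assume "j < d + 1"
  then show "proj_eq (q' (Suc j)) (B *\<^sub>v unit_vec (d + 1) j)"
    by (intro proj_eq_trans[OF assms(2) b(4)]) simp_all
qed

lemma frame_map_minv_iff:
  assumes B: "B \<in> square_mats d" "det B \<noteq> 0"
    and q: "\<And>m. m \<le> d + 1 \<Longrightarrow> q m \<in> carrier_vec (d + 1)"
  shows "frame_map d q (minv B) \<longleftrightarrow> frame_basis d q B"
proof -
  note inv = det_nonzero_minv[OF B]
  have "proj_eq (minv B *\<^sub>v u) w \<longleftrightarrow> proj_eq u (B *\<^sub>v w)"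
    if u: "u \<in> carrier_vec (d + 1)" and w: "w \<in> carrier_vec (d + 1)" for u w :: "'a vec"
  proof
    assume "proj_eq (minv B *\<^sub>v u) w"
    then have "proj_eq (B *\<^sub>v (minv B *\<^sub>v u)) (B *\<^sub>v w)"
      using B w by (intro proj_eq_mult_mat) auto
    also have "B *\<^sub>v (minv B *\<^sub>v u) = u"
      using B u inv by (simp flip: mult_mat_vec_assoc_dim)
    finally show "proj_eq u (B *\<^sub>v w)" .
  next
    assume "proj_eq u (B *\<^sub>v w)"
    then have "proj_eq (minv B *\<^sub>v u) (minv B *\<^sub>v (B *\<^sub>v w))"
      using B inv(1) w by (intro proj_eq_mult_mat) auto
    also have "minv B *\<^sub>v (B *\<^sub>v w) = w"
      using B w inv by (simp flip: mult_mat_vec_assoc_dim)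
    finally show "proj_eq (minv B *\<^sub>v u) w" .
  qed
  then show ?thesis
    using B inv q unfolding frame_map_def frame_basis_def by auto
qed

lemma frame_map_imp_frame_basis:
  assumes A: "frame_map d q A" and q: "\<And>m. m \<le> d + 1 \<Longrightarrow> q m \<in> carrier_vec (d + 1)"
  shows "frame_basis d q (minv A)"
proof -
  have c: "A \<in> square_mats d" "det A \<noteq> 0" using A by (auto simp: frame_map_def)
  note inv = det_nonzero_minv[OF c]
  note inv2 = det_nonzero_minv[OF inv(1,4)]
  have "minv (minv A) = minv (minv A) * (minv A * A)"
    using inv inv2(1) by simp
  also have "\<dots> = A"
    using c inv(1) inv2(1,3) by (simp flip: mult_mat_assoc_dim)
  finally show ?thesis
    using frame_map_minv_iff[OF inv(1,4) q] A by simp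
qed

text \<open>
  The quotient of two bases fixes the coordinate points, so it is diagonal, and it fixes
  \<open>[1 : \<dots> : 1]\<close>, so its diagonal entries agree.
\<close>

lemma frame_basis_unique:
  assumes B: "frame_basis d q B" and B': "frame_basis d q' B'"
    and q: "\<And>m. m \<le> d + 1 \<Longrightarrow> proj_eq (q m) (q' m)"
  shows "proj_eq_mat B B'"
proof -
  let ?N = "d + 1"
  note b = frame_basisD[OF B] and b' = frame_basisD[OF B']
  note inv = det_nonzero_minv[OF b'(1,2)]
  define C where "C = minv B' * B"
  have C: "C \<in> square_mats d" using b(1) inv(1) by (auto simp: C_def)
  have BC: "B = B' * C"
    using b(1) b'(1) inv unfolding C_def by (simp flip: mult_mat_assoc_dim)
  have *: "proj_eq (C *\<^sub>v w) w"
    if w: "w \<in> carrier_vec ?N" and e: "proj_eq (B *\<^sub>v w) (B' *\<^sub>v w)" for w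
  proof -
    have "proj_eq (minv B' *\<^sub>v (B *\<^sub>v w)) (minv B' *\<^sub>v (B' *\<^sub>v w))"
      using e inv(1) b'(1) by (intro proj_eq_mult_mat) auto
    also have "minv B' *\<^sub>v (B' *\<^sub>v w) = w"
      using b'(1) w inv by (simp flip: mult_mat_vec_assoc_dim)
    finally show ?thesis
      using b(1) w inv(1) unfolding C_def by (simp add: mult_mat_vec_assoc_dim)
  qed
  have "proj_eq (B *\<^sub>v ones ?N) (B' *\<^sub>v ones ?N)"
    using b(3) b'(3) q[of 0] by (meson le0 proj_eq_sym proj_eq_trans)
  from *[OF _ this] obtain s where s: "s \<noteq> 0" "C *\<^sub>v ones ?N = s \<cdot>\<^sub>v ones ?N"
    by (auto simp: proj_eq_def)
  have "\<exists>c. C *\<^sub>v unit_vec ?N j = c \<cdot>\<^sub>v unit_vec ?N j" if j: "j < ?N" for j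
  proof -
    have "proj_eq (B *\<^sub>v unit_vec ?N j) (B' *\<^sub>v unit_vec ?N j)"
      using b(4)[OF j] b'(4)[OF j] q[of "Suc j"] j
      by (meson Suc_leI proj_eq_sym proj_eq_trans)
    from *[OF _ this] show ?thesis by (auto simp: proj_eq_def)
  qed
  then obtain c where c: "\<And>j. j < ?N \<Longrightarrow> C *\<^sub>v unit_vec ?N j = c j \<cdot>\<^sub>v unit_vec ?N j" by metis
  have entry: "C $$ (i, j) = (if i = j then c j else 0)" if "i < ?N" "j < ?N" for i j
  proof -
    have "C $$ (i, j) = (C *\<^sub>v unit_vec ?N j) $ i"
      using C that mult_unit_vec_eq_col[of j C] by simp
    then show ?thesis using c[of j] that by auto
  qed
  have cs: "c i = s" if i: "i < ?N" for i
  proof -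
    have "s = (C *\<^sub>v ones ?N) $ i" using s i by simp
    also have "\<dots> = (\<Sum>j = 0..<?N. C $$ (i, j))" using C i by (simp add: scalar_prod_def)
    also have "\<dots> = (\<Sum>j = 0..<?N. if i = j then c j else 0)" using entry[OF i] by (intro sum.cong) auto
    also have "\<dots> = c i" using i by simp
    finally show ?thesis by simp
  qed
  have "C = s \<cdot>\<^sub>m 1\<^sub>m ?N"
    by (rule eq_matI) (use C entry cs in auto)
  then have "B = s \<cdot>\<^sub>m B'" using BC b'(1) by (simp add: mat_scalars)
  then show ?thesis using s by (auto simp: proj_eq_mat_def)
qed

lemma det_nonzero_iff_left_kernel:
  fixes C :: "'k::field mat"
  assumes C: "C \<in> carrier_mat n n"
  shows "det C \<noteq> 0 \<longleftrightarrow> (\<forall>y\<in>carrier_vec n. (\<forall>j<n. y \<bullet> col C j = 0) \<longrightarrow> y = 0\<^sub>v n)"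
proof -
  have "C\<^sup>T *\<^sub>v y = 0\<^sub>v n \<longleftrightarrow> (\<forall>j<n. y \<bullet> col C j = 0)" if "y \<in> carrier_vec n" for y
    using C that by (auto simp: vec_eq_iff comm_scalar_prod[of y n])
  then show ?thesis
    using det_transpose[OF C] det_0_iff_vec_prod_zero[of "C\<^sup>T" n] C by auto
qed

text \<open>
  The dual form of the frame condition: a linear form that vanishes at all points but one is zero.
  In this form it is visibly independent of the order of the points and of the choice of lifts.
\<close>

lemma proj_frame_iff_annihilator:
  "proj_frame d q \<longleftrightarrow>
     (\<forall>m\<le>d + 1. q m \<in> carrier_vec (d + 1)) \<and>
     (\<forall>m\<le>d + 1. \<forall>y\<in>carrier_vec (d + 1). (\<forall>l\<le>d + 1. l \<noteq> m \<longrightarrow> y \<bullet> q l = 0) \<longrightarrow> y = 0\<^sub>v (d + 1))"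
proof -
  have "det (mat_of_cols (d + 1) (map q (filter (\<lambda>l. l \<noteq> m) [0..<d + 2]))) \<noteq> 0 \<longleftrightarrow>
      (\<forall>y\<in>carrier_vec (d + 1). (\<forall>l\<le>d + 1. l \<noteq> m \<longrightarrow> y \<bullet> q l = 0) \<longrightarrow> y = 0\<^sub>v (d + 1))"
    if m: "m \<le> d + 1" and q: "\<forall>m\<le>d + 1. q m \<in> carrier_vec (d + 1)" for m
  proof -
    define xs where "xs = filter (\<lambda>l. l \<noteq> m) [0..<d + 2]"
    let ?C = "mat_of_cols (d + 1) (map q xs)"
    have set: "set xs = {l. l \<le> d + 1 \<and> l \<noteq> m}" by (auto simp: xs_def)
    have "card (set xs) = length xs" by (intro distinct_card) (auto simp: xs_def)
    moreover have "set xs = {..d + 1} - {m}" by (auto simp: set)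
    ultimately have len: "length xs = d + 1" using m by simp
    have C: "?C \<in> square_mats d" using len mat_of_cols_carrier(1)[of "d + 1" "map q xs"] by simp
    have col: "col ?C j = q (xs ! j)" if "j < d + 1" for j
    proof -
      have "xs ! j \<in> set xs" using that len by (intro nth_mem) simp
      then have "q (xs ! j) \<in> carrier_vec (d + 1)" using q set by auto
      then show ?thesis using that len col_mat_of_cols[of j "map q xs" "d + 1"] by simp
    qed
    have "(\<forall>j<d + 1. y \<bullet> col ?C j = 0) \<longleftrightarrow> (\<forall>l\<in>set xs. y \<bullet> q l = 0)" for y
      by (simp add: all_set_conv_all_nth len col del: One_nat_def add_Suc_right col_mat_of_cols)
    then have *: "(\<forall>j<d + 1. y \<bullet> col ?C j = 0) \<longleftrightarrow> (\<forall>l\<le>d + 1. l \<noteq> m \<longrightarrow> y \<bullet> q l = 0)" for y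
      unfolding set by blast
    show ?thesis
      unfolding xs_def[symmetric] det_nonzero_iff_left_kernel[OF C] * ..
  qed
  note eq = this
  have cong: "(\<And>m. m \<le> k \<Longrightarrow> Z \<Longrightarrow> X m \<longleftrightarrow> Y m) \<Longrightarrow> Z \<and> (\<forall>m\<le>k. X m) \<longleftrightarrow> Z \<and> (\<forall>m\<le>k. Y m)"
    for X Y :: "nat \<Rightarrow> bool" and Z k by blast
  show ?thesis unfolding proj_frame_def by (rule cong, rule eq)
qed

lemma proj_frame_carrier: "proj_frame d q \<Longrightarrow> m \<le> d + 1 \<Longrightarrow> q m \<in> carrier_vec (d + 1)"
  by (auto simp: proj_frame_def)

lemma proj_frame_cong:
  assumes "\<And>m. m \<le> d + 1 \<Longrightarrow> proj_eq (q m) (q' m)"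
  shows "proj_frame d q \<longleftrightarrow> proj_frame d q'"
proof -
  have c: "q m \<in> carrier_vec (d + 1) \<longleftrightarrow> q' m \<in> carrier_vec (d + 1)" if "m \<le> d + 1" for m
    using proj_eq_carrier[OF assms[OF that]] .
  have "y \<bullet> q l = 0 \<longleftrightarrow> y \<bullet> q' l = 0"
    if "l \<le> d + 1" "y \<in> carrier_vec (d + 1)" "q' l \<in> carrier_vec (d + 1)" for l y
    using assms[OF that(1)] that(2,3) by (auto simp: proj_eq_def)
  then have ann: "(\<forall>l\<le>d + 1. l \<noteq> m \<longrightarrow> y \<bullet> q l = 0) \<longleftrightarrow> (\<forall>l\<le>d + 1. l \<noteq> m \<longrightarrow> y \<bullet> q' l = 0)"
    if "\<forall>m\<le>d + 1. q' m \<in> carrier_vec (d + 1)" "y \<in> carrier_vec (d + 1)" for m y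
    using that by blast
  show ?thesis
  proof (cases "\<forall>m\<le>d + 1. q' m \<in> carrier_vec (d + 1)")
    case True
    then have "\<forall>m\<le>d + 1. q m \<in> carrier_vec (d + 1)" using c by blast
    then show ?thesis
      unfolding proj_frame_iff_annihilator using ann[OF True] True by blast
  next
    case False
    then show ?thesis unfolding proj_frame_iff_annihilator using c by blast
  qed
qed

lemma proj_frame_det:
  fixes y :: "nat \<Rightarrow> 'k::field vec"
  assumes fr: "proj_frame d y"
    and Y: "Y = mat (d + 1) (d + 1) (\<lambda>(r, c). y (Suc c) $ r)"
  shows "det Y \<noteq> 0"
proof -
  have carr: "y m \<in> carrier_vec (d + 1)" if "m \<le> d + 1" for m using proj_frame_carrier[OF fr that] .
  have YN: "Y \<in> square_mats d" using Y by simp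
  have colY: "col Y j = y (Suc j)" if "j < d + 1" for j
    using that carr[of "Suc j"] by (intro eq_vecI) (auto simp: Y)
  show ?thesis
    unfolding det_nonzero_iff_left_kernel[OF YN]
  proof (intro ballI impI)
    fix z :: "'k vec" assume z: "z \<in> carrier_vec (d + 1)" and 0: "\<forall>j<d + 1. z \<bullet> col Y j = 0"
    have "z \<bullet> y l = 0" if "l \<le> d + 1" "l \<noteq> 0" for l
      using that 0[rule_format, of "l - 1"] colY[of "l - 1"] by (cases l) auto
    then show "z = 0\<^sub>v (d + 1)" using fr z unfolding proj_frame_iff_annihilator by blast
  qed
qed

text \<open>
  A linear relation between the points of a frame has no vanishing coefficient, so it rescales the
  points to the columns of a basis. The factor \<open>\<delta>\<close> leaves room for a relation with polynomial
  coefficients, such as the one given by the adjugate.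
\<close>

lemma frame_basis_of_relation:
  fixes y :: "nat \<Rightarrow> 'k::field vec"
  assumes fr: "proj_frame d y"
    and Y: "Y = mat (d + 1) (d + 1) (\<lambda>(r, c). y (Suc c) $ r)"
    and x: "x \<in> carrier_vec (d + 1)" and rel: "Y *\<^sub>v x = \<delta> \<cdot>\<^sub>v y 0" and \<delta>: "\<delta> \<noteq> 0"
  shows "frame_basis d y (mat (d + 1) (d + 1) (\<lambda>(r, c). y (Suc c) $ r * x $ c))" (is "frame_basis d y ?B")
proof -
  let ?N = "d + 1"
  have carr: "y m \<in> carrier_vec ?N" if "m \<le> ?N" for m using proj_frame_carrier[OF fr that] .
  have ann: "z = 0\<^sub>v ?N" if "m \<le> ?N" "z \<in> carrier_vec ?N" "\<And>l. l \<le> ?N \<Longrightarrow> l \<noteq> m \<Longrightarrow> z \<bullet> y l = 0" for m z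
    using fr that unfolding proj_frame_iff_annihilator by blast
  have YN: "Y \<in> square_mats d" using Y by simp
  have colY: "col Y j = y (Suc j)" if "j < ?N" for j
    using that carr[of "Suc j"] by (intro eq_vecI) (auto simp: Y)
  have Ye: "Y *\<^sub>v unit_vec ?N j = y (Suc j)" if "j < ?N" for j
    using mult_unit_vec_eq_col[of j Y] YN colY[OF that] that by simp
  have detY: "det Y \<noteq> 0" by (rule proj_frame_det[OF fr Y])
  note inv = det_nonzero_minv[OF YN detY]
  have x0: "x $ j \<noteq> 0" if j: "j < ?N" for j
  proof
    assume xj: "x $ j = 0"
    \<comment> \<open>the linear form dual to the \<open>j\<close>-th column would vanish at all points but \<open>y (Suc j)\<close>\<close>
    define z where "z = row (minv Y) j"
    have z: "z \<in> carrier_vec ?N" using inv(1) j by (auto simp: z_def)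
    have zY: "z \<bullet> (Y *\<^sub>v w) = w $ j" if w: "w \<in> carrier_vec ?N" for w
    proof -
      have "z \<bullet> (Y *\<^sub>v w) = (minv Y *\<^sub>v (Y *\<^sub>v w)) $ j" using inv(1) j by (simp add: z_def)
      also have "minv Y *\<^sub>v (Y *\<^sub>v w) = w"
        using YN w inv by (simp flip: mult_mat_vec_assoc_dim)
      finally show ?thesis .
    qed
    have "z \<bullet> y l = 0" if l: "l \<le> ?N" "l \<noteq> Suc j" for l
    proof (cases l)
      case 0
      have "\<delta> * (z \<bullet> y 0) = z \<bullet> (Y *\<^sub>v x)"
        unfolding rel using z carr[of 0] by simp
      also have "\<dots> = 0" using zY[OF x] xj by simp
      finally show ?thesis using \<delta> 0 by simp
    next
      case (Suc i)
      then have i: "i < ?N" "i \<noteq> j" using l by auto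
      have "z \<bullet> (Y *\<^sub>v unit_vec ?N i) = unit_vec ?N i $ j" by (intro zY) simp
      then show ?thesis using i j Suc unfolding Ye[OF i(1)] by simp
    qed
    then have "z = 0\<^sub>v ?N" using ann[of "Suc j" z] z j by auto
    then have "z \<bullet> (Y *\<^sub>v unit_vec ?N j) = 0" using YN by simp
    then show False using zY[of "unit_vec ?N j"] j by simp
  qed
  have B: "?B \<in> square_mats d" by simp
  have Bw: "?B *\<^sub>v w = Y *\<^sub>v vec ?N (\<lambda>c. x $ c * w $ c)" if "w \<in> carrier_vec ?N" for w
    using that by (intro eq_vecI) (auto simp: scalar_prod_def Y ac_simps)
  have "?B *\<^sub>v ones ?N = Y *\<^sub>v x"
    unfolding Bw[OF vec_carrier] by (rule arg_cong[of _ _ "\<lambda>v. Y *\<^sub>v v"]) (use x in auto)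
  then have "proj_eq (y 0) (?B *\<^sub>v ones ?N)"
    using rel proj_eq_sym[OF proj_eq_smult[OF \<delta>, of "y 0"]] by simp
  moreover have Be: "?B *\<^sub>v unit_vec ?N j = x $ j \<cdot>\<^sub>v y (Suc j)" if j: "j < ?N" for j
  proof -
    have "vec ?N (\<lambda>c. x $ c * unit_vec ?N j $ c) = x $ j \<cdot>\<^sub>v unit_vec ?N j"
      using j by (intro eq_vecI) auto
    then show ?thesis
      unfolding Bw[OF unit_vec_carrier] Ye[OF j, symmetric] using YN by (simp add: mult_mat_vec_smult)
  qed
  then have "proj_eq (y (Suc j)) (?B *\<^sub>v unit_vec ?N j)" if "j < ?N" for j
    using that proj_eq_sym[OF proj_eq_smult[OF x0[OF that], of "y (Suc j)"]] by simp
  moreover have "det ?B \<noteq> 0"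
    unfolding det_nonzero_iff_left_kernel[OF B]
  proof (intro ballI impI)
    fix z :: "'k vec" assume z: "z \<in> carrier_vec ?N" and 0: "\<forall>j<?N. z \<bullet> col ?B j = 0"
    have "z \<bullet> y l = 0" if l: "l \<le> ?N" "l \<noteq> 0" for l
    proof -
      obtain j where j: "l = Suc j" "j < ?N" using l by (cases l) auto
      have "col ?B j = x $ j \<cdot>\<^sub>v y (Suc j)"
        using Be[OF j(2)] mult_unit_vec_eq_col[of j ?B] j(2) by simp
      moreover have "z \<bullet> col ?B j = 0" using 0 j(2) by blast
      ultimately have "x $ j * (z \<bullet> y (Suc j)) = 0" using j(2) z carr[of "Suc j"] by simp
      then show ?thesis using x0[OF j(2)] j(1) by simp
    qed
    then show "z = 0\<^sub>v ?N" using ann[of 0 z] z by blast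
  qed
  ultimately show ?thesis using B unfolding frame_basis_def by blast
qed

lemma proj_frame_has_basis:
  fixes q :: "nat \<Rightarrow> 'k::field vec"
  assumes fr: "proj_frame d q"
  shows "\<exists>B. frame_basis d q B"
proof -
  define Y where "Y = mat (d + 1) (d + 1) (\<lambda>(r, c). q (Suc c) $ r)"
  have carr: "q m \<in> carrier_vec (d + 1)" if "m \<le> d + 1" for m using proj_frame_carrier[OF fr that] .
  have YN: "Y \<in> square_mats d" using Y_def by simp
  note inv = det_nonzero_minv[OF YN proj_frame_det[OF fr Y_def]]
  have "Y *\<^sub>v (minv Y *\<^sub>v q 0) = 1 \<cdot>\<^sub>v q 0"
    using YN carr[of 0] inv by (simp flip: mult_mat_vec_assoc_dim)
  moreover have "minv Y *\<^sub>v q 0 \<in> carrier_vec (d + 1)" using inv(1) carr[of 0] by simp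
  ultimately show ?thesis
    using frame_basis_of_relation[OF fr Y_def, of "minv Y *\<^sub>v q 0" 1] by auto
qed

lemma frame_basis_imp_proj_frame:
  fixes q :: "nat \<Rightarrow> 'k::field vec"
  assumes B: "frame_basis d q B"
  shows "proj_frame d q"
proof -
  let ?N = "d + 1"
  note b = frame_basisD[OF B]
  have carr: "q m \<in> carrier_vec ?N" if "m \<le> ?N" for m
  proof (cases m)
    case 0
    then show ?thesis using proj_eq_carrier[OF b(3), of ?N] b(1) by auto
  next
    case (Suc j)
    then show ?thesis using proj_eq_carrier[OF b(4)[of j], of ?N] that b(1) by auto
  qed
  moreover have "y = 0\<^sub>v ?N" if m: "m \<le> ?N" and y: "y \<in> carrier_vec ?N"
    and 0: "\<And>l. l \<le> ?N \<Longrightarrow> l \<noteq> m \<Longrightarrow> y \<bullet> q l = 0" for m and y :: "'k vec"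
  proof -
    define z where "z = B\<^sup>T *\<^sub>v y"
    have z: "z \<in> carrier_vec ?N" using b(1) y by (simp add: z_def)
    have zw: "z \<bullet> w = y \<bullet> (B *\<^sub>v w)" if "w \<in> carrier_vec ?N" for w
      unfolding z_def using transpose_vec_mult_scalar[OF b(1) that y] .
    have kill: "z \<bullet> w = 0" if w: "w \<in> carrier_vec ?N" and e: "proj_eq u (B *\<^sub>v w)" and u: "y \<bullet> u = 0" for u w
    proof -
      obtain s where s: "s \<noteq> 0" "u = s \<cdot>\<^sub>v (B *\<^sub>v w)" using e by (auto simp: proj_eq_def)
      then have "s * (y \<bullet> (B *\<^sub>v w)) = 0" using u y b(1) by simp
      then show ?thesis using s(1) zw[OF w] by simp
    qed
    have zj: "z $ j = 0" if j: "j < ?N" "Suc j \<noteq> m" for j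
      using kill[OF unit_vec_carrier b(4)[OF j(1)]] 0[of "Suc j"] j z by simp
    have "z $ k = 0" if k: "k < ?N" for k
    proof (cases "Suc k = m")
      case False
      then show ?thesis using zj k by blast
    next
      case True
      have "z \<bullet> ones ?N = 0" using kill[OF vec_carrier b(3)] 0[of 0] True by auto
      moreover have "z \<bullet> ones ?N = (\<Sum>j = 0..<?N. z $ j)" by (simp add: scalar_prod_def)
      moreover have "(\<Sum>j = 0..<?N. z $ j) = (\<Sum>j = 0..<?N. if j = k then z $ k else 0)"
        using zj True by (intro sum.cong) auto
      ultimately show ?thesis using k by (cases "k = d") auto
    qed
    then have "B\<^sup>T *\<^sub>v y = 0\<^sub>v ?N" using z b(1) unfolding z_def by (intro eq_vecI) auto
    then show ?thesis
      using det_0_iff_vec_prod_zero[of "B\<^sup>T" ?N] b(1,2) y det_transpose[OF b(1)] by auto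
  qed
  ultimately show ?thesis unfolding proj_frame_iff_annihilator by blast
qed

section \<open>Companion matrices and cross-ratio coordinates\<close>

text \<open>
  This is the matrix \<open>L\<^sub>i\<close> of one step along the polygon, as a function of the coordinates \<open>c = c\<^sub>i\<close>.
\<close>

definition companion :: "nat \<Rightarrow> (nat \<Rightarrow> 'k::comm_ring_1) \<Rightarrow> 'k mat" where
  "companion d c =
     mat (d + 1) (d + 1)
       (\<lambda>(r, s). if s = d then c (r + 1) else if r = s + 1 then - c (r + 1) else 0)"

lemma companion_carrier [simp]: "companion d c \<in> square_mats d"
  by (simp add: companion_def)

lemma companion_dims [simp]: "dim_row (companion d c) = d + 1" "dim_col (companion d c) = d + 1"
  by (simp_all add: companion_def)

lemma companion_cong:
  "(\<And>j. 1 \<le> j \<Longrightarrow> j \<le> d + 1 \<Longrightarrow> c j = c' j) \<Longrightarrow> companion d c = companion d c'"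
  unfolding companion_def by (rule eq_matI) auto

lemma companion_mult_vec:
  fixes c :: "nat \<Rightarrow> 'k::comm_ring_1"
  assumes x: "x \<in> carrier_vec (d + 1)" and r: "r < d + 1"
  shows "(companion d c *\<^sub>v x) $ r = c (r + 1) * (x $ d - (if r = 0 then 0 else x $ (r - 1)))"
proof -
  have "(companion d c *\<^sub>v x) $ r =
      (\<Sum>s = 0..<Suc d. (if s = d then c (r + 1) else if r = s + 1 then - c (r + 1) else 0) * x $ s)"
    using x r by (auto simp: companion_def scalar_prod_def intro!: sum.cong)
  also have "\<dots> = (\<Sum>s = 0..<d. (if r = s + 1 then - c (r + 1) else 0) * x $ s) + c (r + 1) * x $ d"
    by simp
  also have "(\<Sum>s = 0..<d. (if r = s + 1 then - c (r + 1) else 0) * x $ s)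
      = - c (r + 1) * (if r = 0 then 0 else x $ (r - 1))"
  proof (cases r)
    case (Suc k)
    then have "(\<Sum>s = 0..<d. (if r = s + 1 then - c (r + 1) else 0) * x $ s)
        = (\<Sum>s = 0..<d. if s = k then - c (r + 1) * x $ k else 0)"
      by (intro sum.cong) auto
    then show ?thesis using Suc r by simp
  qed simp
  finally show ?thesis by (simp add: algebra_simps)
qed

lemma companion_mult_ones:
  fixes c :: "nat \<Rightarrow> 'k::comm_ring_1"
  shows "companion d c *\<^sub>v ones (d + 1) = c 1 \<cdot>\<^sub>v unit_vec (d + 1) 0"
  by (rule eq_vecI) (auto simp: companion_mult_vec simp del: index_mult_mat_vec)

lemma companion_mult_unit:
  fixes c :: "nat \<Rightarrow> 'k::comm_ring_1"
  assumes "j < d"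
  shows "companion d c *\<^sub>v unit_vec (d + 1) j = (- c (j + 2)) \<cdot>\<^sub>v unit_vec (d + 1) (j + 1)"
  by (rule eq_vecI) (use assms in \<open>auto simp: companion_mult_vec simp del: index_mult_mat_vec\<close>)

lemma companion_mult_last:
  fixes c :: "nat \<Rightarrow> 'k::comm_ring_1"
  shows "companion d c *\<^sub>v unit_vec (d + 1) d = vec (d + 1) (\<lambda>r. c (r + 1))"
  by (rule eq_vecI) (auto simp: companion_mult_vec simp del: index_mult_mat_vec)

lemma det_companion_nonzero:
  fixes c :: "nat \<Rightarrow> 'k::field"
  assumes c: "\<And>j. 1 \<le> j \<Longrightarrow> j \<le> d + 1 \<Longrightarrow> c j \<noteq> 0"
  shows "det (companion d c) \<noteq> 0"
proof
  assume "det (companion d c) = 0"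
  then obtain x where x: "x \<in> carrier_vec (d + 1)" "x \<noteq> 0\<^sub>v (d + 1)" "companion d c *\<^sub>v x = 0\<^sub>v (d + 1)"
    using det_0_iff_vec_prod_zero[OF companion_carrier] by auto
  have e: "x $ d = (if r = 0 then 0 else x $ (r - 1))" if "r < d + 1" for r
    using companion_mult_vec[OF x(1) that, of c] x(3) c[of "r + 1"] that by simp
  have d0: "x $ d = 0" using e[of 0] by simp
  have "x $ r = 0" if "r < d + 1" for r
  proof (cases "r = d")
    case False
    then show ?thesis using e[of "r + 1"] d0 that by simp
  qed (use d0 in simp)
  then show False using x(1,2) by (auto simp: vec_eq_iff)
qed

text \<open>
  Up to scalars, the companion matrix sends \<open>(1, \<dots>, 1)\<close> to the first unit vector, each unit vector
  but the last to the next one, and the last one to \<open>c\<close>. So it shifts the frame by one point.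
\<close>

lemma frame_basis_step:
  fixes q :: "nat \<Rightarrow> 'k::field vec"
  assumes B: "frame_basis d q B"
    and q': "\<And>j. j \<le> d \<Longrightarrow> proj_eq (q' j) (q (Suc j))"
    and last: "proj_eq (q' (d + 1)) (B *\<^sub>v vec (d + 1) (\<lambda>r. c (r + 1)))"
    and c: "\<And>j. 1 \<le> j \<Longrightarrow> j \<le> d + 1 \<Longrightarrow> c j \<noteq> 0"
  shows "frame_basis d q' (B * companion d c)"
proof -
  let ?N = "d + 1" and ?C = "companion d c"
  note b = frame_basisD[OF B]
  have assoc: "(B * ?C) *\<^sub>v w = B *\<^sub>v (?C *\<^sub>v w)" if "w \<in> carrier_vec ?N" for w
    using b(1) that by (simp add: mult_mat_vec_assoc_dim)
  have scal: "proj_eq (q' j) (B *\<^sub>v (s \<cdot>\<^sub>v unit_vec ?N j))" if j: "j \<le> d" and s: "s \<noteq> 0" for j s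
  proof -
    have "proj_eq (q' j) (B *\<^sub>v unit_vec ?N j)"
      using proj_eq_trans[OF q'[OF j] b(4)[of j]] j by simp
    also have "proj_eq (B *\<^sub>v unit_vec ?N j) (B *\<^sub>v (s \<cdot>\<^sub>v unit_vec ?N j))"
      using b(1) s by (intro proj_eq_mult_mat proj_eq_sym[OF proj_eq_smult]) auto
    finally show ?thesis .
  qed
  have "proj_eq (q' 0) ((B * ?C) *\<^sub>v ones ?N)"
    unfolding assoc[OF vec_carrier] companion_mult_ones using c[of 1] by (intro scal) auto
  moreover have "proj_eq (q' (Suc j)) ((B * ?C) *\<^sub>v unit_vec ?N j)" if j: "j < ?N" for j
  proof (cases "j = d")
    case True
    then show ?thesis using last unfolding assoc[OF unit_vec_carrier] True companion_mult_last by simp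
  next
    case False
    then have "j < d" using j by simp
    then show ?thesis
      unfolding assoc[OF unit_vec_carrier] companion_mult_unit[OF \<open>j < d\<close>]
      using c[of "j + 2"] scal[of "j + 1" "- c (j + 2)"] by simp
  qed
  moreover have "det (B * ?C) \<noteq> 0"
    using det_mult[OF b(1) companion_carrier] b(2) det_companion_nonzero[OF c] by simp
  ultimately show ?thesis using b(1) unfolding frame_basis_def by auto
qed

abbreviation frame_at :: "'k polygon \<Rightarrow> int \<Rightarrow> nat \<Rightarrow> 'k::field vec" where
  "frame_at P i \<equiv> \<lambda>m. vertex P (i - 1 + int m)"

lemma ngon_proj_frame: "ngon d n P \<Longrightarrow> proj_frame d (frame_at P i)"
  unfolding ngon_def by blast

lemma ngon_vertex_carrier: "ngon d n P \<Longrightarrow> vertex P i \<in> carrier_vec (d + 1)"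
  using proj_frame_carrier[OF ngon_proj_frame[of d n P "i + 1"], of 0] by simp

text \<open>
  The transformation chosen in the definition of the coordinates is determined up to a scalar, which
  cancels in the quotient. So every basis of the frame gives the same coordinates.
\<close>

lemma cr_eq:
  fixes P :: "'k::field polygon"
  assumes carr: "\<And>i. vertex P i \<in> carrier_vec (d + 1)"
    and B: "frame_basis d (frame_at P i) B"
    and u: "u \<in> carrier_vec (d + 1)" and e: "proj_eq (vertex P (i + int d + 1)) (B *\<^sub>v u)"
    and j: "1 \<le> j" "j \<le> d + 1"
  shows "cr d P i j = u $ (j - 1) / u $ d"
proof -
  note b = frame_basisD[OF B]
  define A where "A = frame_transform d (frame_at P i)"
  have "frame_map d (frame_at P i) (minv B)"
    using frame_map_minv_iff[OF b(1,2), of "frame_at P i"] B carr by simp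
  then have A: "frame_map d (frame_at P i) A"
    unfolding A_def frame_transform_def by (rule someI)
  then have c: "A \<in> square_mats d" "det A \<noteq> 0" by (auto simp: frame_map_def)
  note inv = det_nonzero_minv[OF c]
  have "proj_eq_mat B (minv A)"
    by (rule frame_basis_unique[OF B frame_map_imp_frame_basis[OF A]]) (use carr proj_eq_refl in auto)
  then have "proj_eq_mat (A * B) (A * minv A)"
    using inv(1) c(1) by (intro proj_eq_mat_mult_left) auto
  then obtain s where s: "s \<noteq> 0" "A * B = s \<cdot>\<^sub>m 1\<^sub>m (d + 1)"
    unfolding inv(2) by (auto simp: proj_eq_mat_def)
  obtain t where t: "t \<noteq> 0" "vertex P (i + int d + 1) = t \<cdot>\<^sub>v (B *\<^sub>v u)"
    using e by (auto simp: proj_eq_def)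
  have "A *\<^sub>v vertex P (i + int d + 1) = t \<cdot>\<^sub>v ((A * B) *\<^sub>v u)"
    unfolding t(2) using c(1) b(1) u by (simp add: mult_mat_vec_smult mult_mat_vec_assoc_dim)
  also have "\<dots> = (t * s) \<cdot>\<^sub>v u" unfolding s(2) using u by (simp add: mat_scalars)
  finally show ?thesis
    unfolding cr_def Let_def A_def[symmetric] using u j s(1) t(1) by simp
qed

text \<open>
  No coordinate vanishes, since otherwise \<open>p\<^sub>i, \<dots>, p\<^sub>i\<^sub>+\<^sub>d\<^sub>+\<^sub>1\<close> would not be a frame.
\<close>

lemma ngon_coordinates:
  fixes P :: "'k::field polygon"
  assumes P: "ngon d n P" and B: "frame_basis d (frame_at P i) B"
  shows "proj_eq (vertex P (i + int d + 1)) (B *\<^sub>v vec (d + 1) (\<lambda>r. cr d P i (r + 1)))"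
    and "1 \<le> j \<Longrightarrow> j \<le> d + 1 \<Longrightarrow> cr d P i j \<noteq> 0"
    and "cr d P i (d + 1) = 1"
proof -
  let ?N = "d + 1"
  note b = frame_basisD[OF B] and carr = ngon_vertex_carrier[OF P]
  note inv = det_nonzero_minv[OF b(1,2)]
  define u where "u = minv B *\<^sub>v vertex P (i + int d + 1)"
  have u: "u \<in> carrier_vec ?N" using inv(1) carr by (simp add: u_def)
  have Bu: "B *\<^sub>v u = vertex P (i + int d + 1)"
    unfolding u_def using b(1) carr inv(1,2) by (simp add: carrier_vecD[OF carr] flip: mult_mat_vec_assoc_dim)
  have cr: "cr d P i j = u $ (j - 1) / u $ d" if "1 \<le> j" "j \<le> ?N" for j
    using cr_eq[OF carr B u _ that] Bu proj_eq_refl by simp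
  have u0: "u $ r \<noteq> 0" if r: "r < ?N" for r
  proof
    assume ur: "u $ r = 0"
    define z where "z = row (minv B) r"
    have z: "z \<in> carrier_vec ?N" using inv(1) r by (auto simp: z_def)
    have zB: "z \<bullet> (B *\<^sub>v w) = w $ r" if w: "w \<in> carrier_vec ?N" for w
    proof -
      have "z \<bullet> (B *\<^sub>v w) = (minv B *\<^sub>v (B *\<^sub>v w)) $ r" using inv(1) r by (simp add: z_def)
      also have "minv B *\<^sub>v (B *\<^sub>v w) = w"
        using b(1) w inv by (simp flip: mult_mat_vec_assoc_dim)
      finally show ?thesis .
    qed
    have "z \<bullet> frame_at P (i + 1) l = 0" if l: "l \<le> ?N" "l \<noteq> r" for l
    proof (cases "l = ?N")
      case True
      then show ?thesis using zB[OF u] ur unfolding Bu by (simp add: algebra_simps)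
    next
      case False
      then have l': "l < ?N" using l by simp
      obtain s where s: "frame_at P i (Suc l) = s \<cdot>\<^sub>v (B *\<^sub>v unit_vec ?N l)"
        using b(4)[OF l'] by (auto simp: proj_eq_def)
      have "frame_at P (i + 1) l = frame_at P i (Suc l)" by (simp add: algebra_simps)
      then have "z \<bullet> frame_at P (i + 1) l = s * (z \<bullet> (B *\<^sub>v unit_vec ?N l))"
        unfolding s using z b(1) by simp
      then show ?thesis using zB[of "unit_vec ?N l"] l l' r by simp
    qed
    then have "z = 0\<^sub>v ?N"
      using ngon_proj_frame[OF P, of "i + 1"] z r unfolding proj_frame_iff_annihilator
      by (metis less_imp_le_nat)
    then have "z \<bullet> (B *\<^sub>v unit_vec ?N r) = 0" using b(1) by simp
    then show False using zB[of "unit_vec ?N r"] r by simp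
  qed
  show "1 \<le> j \<Longrightarrow> j \<le> ?N \<Longrightarrow> cr d P i j \<noteq> 0" using cr[of j] u0[of "j - 1"] u0[of d] by simp
  show "cr d P i ?N = 1" using cr[of ?N] u0[of d] by simp
  have "u = u $ d \<cdot>\<^sub>v vec ?N (\<lambda>r. cr d P i (r + 1))"
    using u u0[of d] cr by (intro eq_vecI) auto
  then have "proj_eq u (vec ?N (\<lambda>r. cr d P i (r + 1)))"
    using u0[of d] unfolding proj_eq_def by auto
  then have "proj_eq (B *\<^sub>v u) (B *\<^sub>v vec ?N (\<lambda>r. cr d P i (r + 1)))"
    using b(1) by (intro proj_eq_mult_mat) auto
  then show "proj_eq (vertex P (i + int d + 1)) (B *\<^sub>v vec ?N (\<lambda>r. cr d P i (r + 1)))"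
    unfolding Bu .
qed

lemma ngon_frame_step:
  fixes P :: "'k::field polygon"
  assumes P: "ngon d n P" and B: "frame_basis d (frame_at P i) B"
  shows "frame_basis d (frame_at P (i + 1)) (B * companion d (cr d P i))"
proof (rule frame_basis_step[OF B])
  show "proj_eq (frame_at P (i + 1) (d + 1)) (B *\<^sub>v vec (d + 1) (\<lambda>r. cr d P i (r + 1)))"
    using ngon_coordinates(1)[OF P B] by (simp add: algebra_simps)
qed (use ngon_coordinates(2)[OF P B] proj_eq_refl in \<open>auto simp: algebra_simps\<close>)

definition companion_prod :: "nat \<Rightarrow> ('i \<Rightarrow> nat \<Rightarrow> 'k::comm_ring_1) \<Rightarrow> 'i list \<Rightarrow> 'k mat" where
  "companion_prod d c is = foldr (\<lambda>i X. companion d (c i) * X) is (1\<^sub>m (d + 1))"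

lemma companion_prod_simps [simp]:
  "companion_prod d c [] = 1\<^sub>m (d + 1)"
  "companion_prod d c (i # is) = companion d (c i) * companion_prod d c is"
  by (simp_all add: companion_prod_def)

lemma companion_prod_carrier [simp]: "companion_prod d c is \<in> square_mats d"
  by (induction "is") auto

lemma companion_prod_dims [simp]:
  "dim_row (companion_prod d c is) = d + 1" "dim_col (companion_prod d c is) = d + 1"
  using companion_prod_carrier[of d c "is"] by auto

lemma companion_prod_cong:
  "(\<And>i j. i \<in> set is \<Longrightarrow> 1 \<le> j \<Longrightarrow> j \<le> d + 1 \<Longrightarrow> c i j = c' i j) \<Longrightarrow>
   companion_prod d c is = companion_prod d c' is"
proof (induction "is")
  case (Cons i "is")
  then show ?case using companion_cong[of d "c i" "c' i"] by simp
qed simp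

lemma companion_upto_snoc:
  fixes c :: "int \<Rightarrow> nat \<Rightarrow> 'k::comm_ring_1"
  assumes "i \<le> j"
  shows "companion_prod d c [i..j] = companion_prod d c [i..j - 1] * companion d (c j)"
proof -
  have "companion_prod d c (xs @ [j]) = companion_prod d c xs * companion d (c j)" for xs
    by (induction xs) (simp_all add: mult_mat_assoc_dim)
  then show ?thesis using upto_rec2[OF assms] by simp
qed

lemma (in comm_ring_hom) map_companion: "map_mat hom (companion d c) = companion d (\<lambda>j. hom (c j))"
  by (rule eq_matI) (auto simp: companion_def hom_distribs)

lemma (in comm_ring_hom) map_companion_prod:
  "map_mat hom (companion_prod d c is) = companion_prod d (\<lambda>i j. hom (c i j)) is"
proof (induction "is")
  case (Cons i "is")
  then show ?case
    using mat_hom_mult[OF companion_carrier companion_prod_carrier, of d "c i" c "is"] by (simp add: map_companion)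
qed (simp add: mat_hom_one)

lemma ngon_frame_prod:
  fixes P :: "'k::field polygon"
  assumes P: "ngon d n P"
  shows "frame_basis d (frame_at P i) B \<Longrightarrow> i \<le> j + 1 \<Longrightarrow>
    frame_basis d (frame_at P (j + 1)) (B * companion_prod d (cr d P) [i..j])"
proof (induction "nat (j + 1 - i)" arbitrary: i B)
  case 0
  then have "i = j + 1" by simp
  then show ?case using 0(2) frame_basisD(1)[OF 0(2)] by simp
next
  case (Suc k)
  then have i: "i \<le> j" and k: "k = nat (j + 1 - (i + 1))" by auto
  have "frame_basis d (frame_at P (j + 1)) (B * companion d (cr d P i) * companion_prod d (cr d P) [i + 1..j])"
    using Suc.hyps(1)[OF k ngon_frame_step[OF P Suc.prems(1)]] i by simp
  then show ?case
    using i frame_basisD(1)[OF Suc.prems(1)] upto_rec1[OF i] by (simp add: mult_mat_assoc_dim)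
qed

text \<open>
  The frame \<open>n\<close> steps after the first one has two bases: the image of the first basis under the
  monodromy, and the one reached by \<open>n\<close> companion matrices.
\<close>

lemma monodromy_companion_prod:
  fixes P :: "'k::field polygon"
  assumes P: "ngon d n P" and B: "frame_basis d (frame_at P 1) B"
  shows "proj_eq_mat (monodromy P * B) (B * companion_prod d (cr d P) [1..int n])"
proof -
  let ?M = "monodromy P"
  note b = frame_basisD[OF B]
  have M: "?M \<in> square_mats d" "det ?M \<noteq> 0"
    and per: "\<And>i. proj_eq (vertex P (i + int n)) (?M *\<^sub>v vertex P i)"
    using P unfolding ngon_def by auto
  have step: "proj_eq (vertex P (i + int n)) ((?M * B) *\<^sub>v w)"
    if "proj_eq (vertex P i) (B *\<^sub>v w)" "w \<in> carrier_vec (d + 1)" for i w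
  proof -
    have "proj_eq (?M *\<^sub>v vertex P i) (?M *\<^sub>v (B *\<^sub>v w))"
      using that M(1) b(1) by (intro proj_eq_mult_mat) auto
    then show ?thesis
      using proj_eq_trans[OF per] M(1) b(1) that(2) by (simp add: mult_mat_vec_assoc_dim)
  qed
  have "proj_eq (frame_at P (int n + 1) 0) ((?M * B) *\<^sub>v ones (d + 1))"
    using step[OF _ vec_carrier, of 0] b(3) by simp
  moreover have "proj_eq (frame_at P (int n + 1) (Suc j)) ((?M * B) *\<^sub>v unit_vec (d + 1) j)"
    if "j < d + 1" for j
    using step[OF _ unit_vec_carrier, of "int j + 1"] b(4)[OF that] by (simp add: algebra_simps)
  moreover have "det (?M * B) \<noteq> 0" using det_mult[OF M(1) b(1)] M(2) b(2) by simp
  ultimately have "frame_basis d (frame_at P (int n + 1)) (?M * B)"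
    using M(1) b(1) unfolding frame_basis_def by auto
  from frame_basis_unique[OF this ngon_frame_prod[OF P B, of "int n"]]
  show ?thesis using proj_eq_refl by simp
qed

section \<open>Specialization from the function field to the ground field\<close>

abbreviation at_one :: "'b::comm_ring_1 poly \<Rightarrow> 'b" where
  "at_one \<equiv> \<lambda>f. poly f 1"

interpretation const: inj_comm_ring_hom "const :: 'a::field \<Rightarrow> 'a poly fract"
proof unfold_locales
  show "const (1 :: 'a) = 1" unfolding const_def by (metis to_fract_1 one_pCons)
qed (auto simp: const_def simp flip: to_fract_add to_fract_mult)

interpretation fract: inj_comm_ring_hom "to_fract :: 'b::idom \<Rightarrow> 'b fract"
  by unfold_locales auto

interpretation eval1: comm_ring_hom "\<lambda>f. poly f (1 :: 'b::comm_ring_1)"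
  by unfold_locales auto

interpretation constp: comm_ring_hom "\<lambda>a :: 'b::comm_ring_1. [:a:]"
  by unfold_locales (auto simp: one_pCons)

text \<open>
  A scalar that relates two families over the ground field lies in the ground field, being a quotient
  of two of their members. So proportionality descends.
\<close>

lemma const_scalar_descends:
  fixes u v :: "'i \<Rightarrow> 'a::field"
  assumes s: "s \<noteq> 0" and e: "\<And>k. k \<in> I \<Longrightarrow> const (u k) = s * const (v k)"
  shows "\<exists>r. r \<noteq> 0 \<and> (\<forall>k\<in>I. u k = r * v k)"
proof (cases "\<exists>k\<in>I. v k \<noteq> 0")
  case True
  then obtain k where k: "k \<in> I" "v k \<noteq> 0" by auto
  define r where "r = u k / v k"
  have "const (r * v k) = s * const (v k)" using e[OF k(1)] k(2) by (simp add: r_def)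
  then have sr: "s = const r" using k(2) by (simp add: const.hom_mult)
  have "u j = r * v j" if "j \<in> I" for j
    using e[OF that] unfolding sr const.hom_mult[symmetric] by simp
  then show ?thesis using s sr by auto
next
  case False
  then have "\<forall>k\<in>I. u k = 1 * v k" using e by auto
  then show ?thesis using one_neq_zero by blast
qed

lemma proj_eq_const_iff:
  fixes u v :: "'a::field vec"
  shows "proj_eq (map_vec const u) (map_vec const v) \<longleftrightarrow> proj_eq u v"
proof
  assume "proj_eq (map_vec const u) (map_vec const v)"
  then obtain s where s: "s \<noteq> 0" "map_vec const u = s \<cdot>\<^sub>v map_vec const v" by (auto simp: proj_eq_def)
  have dim: "dim_vec u = dim_vec v" using arg_cong[OF s(2), of dim_vec] by simp
  have "\<exists>r. r \<noteq> 0 \<and> (\<forall>k\<in>{..<dim_vec v}. u $ k = r * v $ k)"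
  proof (rule const_scalar_descends[OF s(1)])
    show "const (u $ k) = s * const (v $ k)" if "k \<in> {..<dim_vec v}" for k
      using arg_cong[OF s(2), of "\<lambda>w. w $ k"] that dim by simp
  qed
  then obtain r where r: "r \<noteq> 0" "\<And>k. k < dim_vec v \<Longrightarrow> u $ k = r * v $ k" by auto
  then have "u = r \<cdot>\<^sub>v v" using dim by (intro eq_vecI) auto
  then show "proj_eq u v" unfolding proj_eq_def using r(1) by blast
next
  assume "proj_eq u v"
  then show "proj_eq (map_vec const u) (map_vec const v)"
    unfolding proj_eq_def by (metis const.hom_0_iff const.vec_hom_smult)
qed

lemma proj_eq_mat_const_iff:
  fixes A B :: "'a::field mat"
  shows "proj_eq_mat (map_mat const A) (map_mat const B) \<longleftrightarrow> proj_eq_mat A B"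
proof
  assume "proj_eq_mat (map_mat const A) (map_mat const B)"
  then obtain s where s: "s \<noteq> 0" "map_mat const A = s \<cdot>\<^sub>m map_mat const B" by (auto simp: proj_eq_mat_def)
  have dim: "dim_row A = dim_row B" "dim_col A = dim_col B"
    using arg_cong[OF s(2), of dim_row] arg_cong[OF s(2), of dim_col] by simp_all
  have "\<exists>r. r \<noteq> 0 \<and> (\<forall>k\<in>{..<dim_row B} \<times> {..<dim_col B}. A $$ k = r * B $$ k)"
  proof (rule const_scalar_descends[OF s(1)])
    show "const (A $$ k) = s * const (B $$ k)" if "k \<in> {..<dim_row B} \<times> {..<dim_col B}" for k
      using arg_cong[OF s(2), of "\<lambda>X. X $$ k"] that dim by (cases k) simp
  qed
  then obtain r where r: "r \<noteq> 0" "\<And>i j. i < dim_row B \<Longrightarrow> j < dim_col B \<Longrightarrow> A $$ (i, j) = r * B $$ (i, j)"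
    by auto
  then have "A = r \<cdot>\<^sub>m B" using dim by (intro eq_matI) auto
  then show "proj_eq_mat A B" unfolding proj_eq_mat_def using r(1) by blast
next
  assume "proj_eq_mat A B"
  then obtain s where "s \<noteq> 0" "A = s \<cdot>\<^sub>m B" by (auto simp: proj_eq_mat_def)
  then have "const s \<noteq> 0" "map_mat const A = const s \<cdot>\<^sub>m map_mat const B"
    by (auto intro!: eq_matI simp: const.hom_mult)
  then show "proj_eq_mat (map_mat const A) (map_mat const B)" unfolding proj_eq_mat_def by blast
qed

text \<open>
  The polynomial vector \<open>w\<close> is a lift of the point \<open>q\<close> over \<open>F(t)\<close>, and its value at \<open>t = 1\<close> is a lift
  of the point \<open>p\<close> over \<open>F\<close>.
\<close>

definition vec_lift :: "'a::field poly vec \<Rightarrow> 'a poly fract vec \<Rightarrow> 'a vec \<Rightarrow> bool" where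
  "vec_lift w q p \<longleftrightarrow> proj_eq q (map_vec to_fract w) \<and> proj_eq p (map_vec at_one w)"

definition mat_lift :: "'a::field poly mat \<Rightarrow> 'a poly fract mat \<Rightarrow> 'a mat \<Rightarrow> bool" where
  "mat_lift W M N \<longleftrightarrow> proj_eq_mat M (map_mat to_fract W) \<and> proj_eq_mat N (map_mat at_one W)"

lemma specializes_iff_lifts:
  "specializes d Pt P \<longleftrightarrow>
     (\<forall>i. \<exists>w\<in>carrier_vec (d + 1). vec_lift w (vertex Pt i) (vertex P i)) \<and>
     (\<exists>W\<in>square_mats d. mat_lift W (monodromy Pt) (monodromy P))"
  unfolding specializes_def vec_lift_def mat_lift_def by blast

lemma vec_lift_cong:
  "vec_lift w q p \<Longrightarrow> proj_eq q' q \<Longrightarrow> proj_eq p' p \<Longrightarrow> vec_lift w q' p'"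
  unfolding vec_lift_def by (blast intro: proj_eq_trans)

lemma (in comm_ring_hom) map_mat_of_cols:
  assumes "\<And>w. w \<in> set ws \<Longrightarrow> w \<in> carrier_vec m"
  shows "map_mat hom (mat_of_cols m ws) = mat_of_cols m (map (map_vec hom) ws)"
proof (rule eq_matI)
  fix i j assume "i < dim_row (mat_of_cols m (map (map_vec hom) ws))"
    "j < dim_col (mat_of_cols m (map (map_vec hom) ws))"
  then have ij: "i < m" "j < length ws" by auto
  then have "dim_vec (ws ! j) = m" using assms[OF nth_mem[of j ws]] by simp
  then show "map_mat hom (mat_of_cols m ws) $$ (i, j) = mat_of_cols m (map (map_vec hom) ws) $$ (i, j)"
    using ij by (simp add: mat_of_cols_index)
qed auto

lemma (in comm_ring_hom) map_vec_unit_vec: "map_vec hom (unit_vec m j) = unit_vec m j"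
  by (rule eq_vecI) (auto simp: unit_vec_def)

text \<open>
  Being a frame is an open condition: a determinant of polynomials that does not vanish at \<open>t = 1\<close>
  is not zero.
\<close>

lemma proj_frame_lift:
  assumes w: "\<And>m. m \<le> d + 1 \<Longrightarrow> w m \<in> carrier_vec (d + 1)"
    and lift: "\<And>m. m \<le> d + 1 \<Longrightarrow> vec_lift (w m) (q m) (p m)"
    and p: "proj_frame d p"
  shows "proj_frame d q"
proof -
  have p': "proj_frame d (\<lambda>m. map_vec at_one (w m))"
    by (rule iffD1[OF proj_frame_cong p]) (use lift in \<open>simp add: vec_lift_def\<close>)
  have "det (mat_of_cols (d + 1) (map (\<lambda>m. map_vec to_fract (w m)) xs)) \<noteq> 0"
    if xs: "set xs \<subseteq> {..d + 1}"
      and 1: "det (mat_of_cols (d + 1) (map (\<lambda>m. map_vec at_one (w m)) xs)) \<noteq> 0" for xs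
  proof -
    have c: "v \<in> carrier_vec (d + 1)" if "v \<in> set (map w xs)" for v using that xs w by auto
    have "poly (det (mat_of_cols (d + 1) (map w xs))) 1 \<noteq> 0"
      using 1 eval1.map_mat_of_cols[of "map w xs" "d + 1", OF c] eval1.hom_det[of "mat_of_cols (d + 1) (map w xs)"]
      by (simp add: comp_def)
    then have "det (mat_of_cols (d + 1) (map w xs)) \<noteq> 0" by auto
    then show ?thesis
      using fract.map_mat_of_cols[of "map w xs" "d + 1", OF c] fract.hom_det[of "mat_of_cols (d + 1) (map w xs)"]
      by (simp add: comp_def)
  qed
  note det = this
  have "proj_frame d (\<lambda>m. map_vec to_fract (w m))"
    unfolding proj_frame_def
  proof (intro conjI allI impI)
    fix m assume "m \<le> d + 1"
    then show "map_vec to_fract (w m) \<in> carrier_vec (d + 1)" using w by simp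
  next
    fix m assume m: "m \<le> d + 1"
    have "set (filter (\<lambda>l. l \<noteq> m) [0..<d + 2]) \<subseteq> {..d + 1}" by auto
    then show "det (mat_of_cols (d + 1) (map (\<lambda>m. map_vec to_fract (w m)) (filter (\<lambda>l. l \<noteq> m) [0..<d + 2]))) \<noteq> 0"
      by (rule det) (use p' m in \<open>simp add: proj_frame_def\<close>)
  qed
  then show ?thesis
    by (rule iffD2[OF proj_frame_cong, rotated]) (use lift in \<open>simp add: vec_lift_def\<close>)
qed

text \<open>
  By Cramer's rule the adjugate yields a relation between the lifts with polynomial coefficients,
  hence one polynomial matrix that is a basis both over the function field and at \<open>t = 1\<close>.
\<close>

lemma lifted_frame_basis:
  fixes q :: "nat \<Rightarrow> 'a::field poly fract vec" and p :: "nat \<Rightarrow> 'a vec"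
  assumes q: "proj_frame d q" and p: "proj_frame d p"
    and lift: "\<And>m. m \<le> d + 1 \<Longrightarrow> \<exists>w\<in>carrier_vec (d + 1). vec_lift w (q m) (p m)"
  shows "\<exists>B\<in>square_mats d. frame_basis d q (map_mat to_fract B)
    \<and> frame_basis d p (map_mat at_one B)"
proof -
  let ?N = "d + 1"
  obtain y where y: "\<And>m. m \<le> ?N \<Longrightarrow> y m \<in> carrier_vec ?N" "\<And>m. m \<le> ?N \<Longrightarrow> vec_lift (y m) (q m) (p m)"
    using lift by metis
  define Y where "Y = mat ?N ?N (\<lambda>(r, c). y (Suc c) $ r)"
  have Y: "Y \<in> square_mats d" unfolding Y_def by (rule mat_carrier)
  note A = adj_mat[OF Y]
  have y0: "y 0 \<in> carrier_vec ?N" by (rule y(1)) simp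
  define x where "x = adj_mat Y *\<^sub>v y 0"
  have x: "x \<in> carrier_vec ?N" unfolding x_def by (rule mult_mat_vec_carrier[OF A(1) y0])
  have Yx: "Y *\<^sub>v x = det Y \<cdot>\<^sub>v y 0"
    using assoc_mult_mat_vec[OF Y A(1) y0] y0 unfolding A(2) x_def by (simp add: smult_mat_mult_vec)
  define B where "B = mat ?N ?N (\<lambda>(r, c). y (Suc c) $ r * x $ c)"
  have B: "B \<in> square_mats d" unfolding B_def by (rule mat_carrier)
  have basis: "frame_basis d u (map_mat hom B)"
    if hom: "comm_ring_hom hom" and u: "proj_frame d u" "\<And>m. m \<le> ?N \<Longrightarrow> proj_eq (u m) (map_vec hom (y m))"
    for hom :: "'a poly \<Rightarrow> 'k::field" and u
  proof (rule frame_basis_cong[OF _ u(2)])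
    interpret comm_ring_hom hom by (rule hom)
    have fr: "proj_frame d (\<lambda>m. map_vec hom (y m))"
      by (rule iffD1[OF proj_frame_cong u(1)]) (rule u(2))
    have hY: "map_mat hom Y = mat ?N ?N (\<lambda>(r, c). map_vec hom (y (Suc c)) $ r)"
    proof (rule eq_matI)
      fix r c assume "r < dim_row (mat ?N ?N (\<lambda>(r, c). map_vec hom (y (Suc c)) $ r))"
        "c < dim_col (mat ?N ?N (\<lambda>(r, c). map_vec hom (y (Suc c)) $ r))"
      then have rc: "r < ?N" "c < ?N" by auto
      then show "map_mat hom Y $$ (r, c) = mat ?N ?N (\<lambda>(r, c). map_vec hom (y (Suc c)) $ r) $$ (r, c)"
        using carrier_vecD[OF y(1)[of "Suc c"]] by (simp add: Y_def)
    qed (simp_all add: Y_def)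
    have "map_mat hom Y *\<^sub>v map_vec hom x = map_vec hom (det Y \<cdot>\<^sub>v y 0)"
      unfolding mult_mat_vec_hom[OF Y x, symmetric] Yx ..
    then have rel: "map_mat hom Y *\<^sub>v map_vec hom x = hom (det Y) \<cdot>\<^sub>v map_vec hom (y 0)"
      by (simp add: vec_hom_smult)
    have "det (map_mat hom Y) \<noteq> 0" by (rule proj_frame_det[OF fr hY])
    then have det: "hom (det Y) \<noteq> 0" by simp
    have "map_mat hom B = mat ?N ?N (\<lambda>(r, c). map_vec hom (y (Suc c)) $ r * map_vec hom x $ c)"
    proof (rule eq_matI)
      fix r c assume "r < dim_row (mat ?N ?N (\<lambda>(r, c). map_vec hom (y (Suc c)) $ r * map_vec hom x $ c))"
        "c < dim_col (mat ?N ?N (\<lambda>(r, c). map_vec hom (y (Suc c)) $ r * map_vec hom x $ c))"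
      then have rc: "r < ?N" "c < ?N" by auto
      then show "map_mat hom B $$ (r, c)
          = mat ?N ?N (\<lambda>(r, c). map_vec hom (y (Suc c)) $ r * map_vec hom x $ c) $$ (r, c)"
        using carrier_vecD[OF y(1)[of "Suc c"]] carrier_vecD[OF x] by (simp add: B_def hom_mult)
    qed (simp_all add: B_def)
    then show "frame_basis d (\<lambda>m. map_vec hom (y m)) (map_mat hom B)"
      using frame_basis_of_relation[OF fr hY _ rel det] x by simp
  qed
  have "frame_basis d q (map_mat to_fract B)"
    by (rule basis[OF fract.comm_ring_hom_axioms q]) (use y(2) in \<open>simp add: vec_lift_def\<close>)
  moreover have "frame_basis d p (map_mat at_one B)"
    by (rule basis[OF eval1.comm_ring_hom_axioms p]) (use y(2) in \<open>simp add: vec_lift_def\<close>)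
  ultimately show ?thesis using B by blast
qed

lemma (in comm_ring_hom) adj_mat_cancel:
  assumes W: "W \<in> carrier_mat m m" and x: "x \<in> carrier_vec m"
  shows "map_mat hom (adj_mat W) *\<^sub>v (map_mat hom W *\<^sub>v x) = hom (det W) \<cdot>\<^sub>v x"
proof -
  have "map_mat hom (adj_mat W) * map_mat hom W = map_mat hom (det W \<cdot>\<^sub>m 1\<^sub>m m)"
    using mat_hom_mult[OF adj_mat(1)[OF W] W] adj_mat(3)[OF W] by simp
  also have "\<dots> = hom (det W) \<cdot>\<^sub>m 1\<^sub>m m" by (rule eq_matI) auto
  finally have *: "map_mat hom (adj_mat W) * map_mat hom W = hom (det W) \<cdot>\<^sub>m 1\<^sub>m m" .
  have "map_mat hom (adj_mat W) *\<^sub>v (map_mat hom W *\<^sub>v x) = (map_mat hom (adj_mat W) * map_mat hom W) *\<^sub>v x"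
    using W x adj_mat(1)[OF W] by (simp add: mult_mat_vec_assoc_dim)
  then show ?thesis unfolding * using x by (simp add: mat_scalars)
qed

text \<open>
  A window of \<open>n\<close> consecutive vertices with polynomial lifts suffices. Polynomial lifts propagate
  forwards by the monodromy, and backwards by its adjugate, which is proportional to the inverse but
  has polynomial entries and does not vanish at \<open>t = 1\<close>.
\<close>

lemma vec_lift_periodic:
  fixes vQ :: "int \<Rightarrow> 'a::field poly fract vec" and vP :: "int \<Rightarrow> 'a vec"
  assumes n: "1 \<le> n"
    and Q: "\<And>i. proj_eq (vQ (i + int n)) (M *\<^sub>v vQ i)" "\<And>i. vQ i \<in> carrier_vec (d + 1)"
    and P: "\<And>i. proj_eq (vP (i + int n)) (N *\<^sub>v vP i)" "\<And>i. vP i \<in> carrier_vec (d + 1)"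
    and N: "N \<in> square_mats d" "det N \<noteq> 0"
    and W: "W \<in> square_mats d" "mat_lift W M N"
    and window: "\<And>i. a \<le> i \<Longrightarrow> i < a + int n \<Longrightarrow> \<exists>w\<in>carrier_vec (d + 1). vec_lift w (vQ i) (vP i)"
  shows "\<exists>w\<in>carrier_vec (d + 1). vec_lift w (vQ i) (vP i)"
proof -
  let ?good = "\<lambda>i. \<exists>w\<in>carrier_vec (d + 1). vec_lift w (vQ i) (vP i)"
  have MW: "proj_eq_mat M (map_mat to_fract W)" "proj_eq_mat N (map_mat at_one W)"
    using W(2) by (auto simp: mat_lift_def)
  have stepQ: "proj_eq (vQ (i + int n)) (map_mat to_fract W *\<^sub>v vQ i)" for i
    using proj_eq_trans[OF Q(1) proj_eq_mat_mult_vec[OF MW(1)]] W(1) Q(2)[of i] by simp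
  have stepP: "proj_eq (vP (i + int n)) (map_mat at_one W *\<^sub>v vP i)" for i
    using proj_eq_trans[OF P(1) proj_eq_mat_mult_vec[OF MW(2)]] W(1) P(2)[of i] by simp
  have "poly (det W) 1 \<noteq> 0"
  proof -
    obtain s where s: "s \<noteq> 0" "N = s \<cdot>\<^sub>m map_mat at_one W"
      using MW(2) by (auto simp: proj_eq_mat_def)
    then show ?thesis using N(2) eval1.hom_det[of W] by auto
  qed
  then have detW: "poly (det W) 1 \<noteq> 0" "to_fract (det W) \<noteq> 0" by auto
  have up: "?good (i + int n)" if "?good i" for i
  proof -
    obtain w where w: "w \<in> carrier_vec (d + 1)" "vec_lift w (vQ i) (vP i)" using \<open>?good i\<close> by auto
    have "proj_eq (map_mat to_fract W *\<^sub>v vQ i) (map_mat to_fract W *\<^sub>v map_vec to_fract w)"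
      "proj_eq (map_mat at_one W *\<^sub>v vP i) (map_mat at_one W *\<^sub>v map_vec at_one w)"
      using w W(1) by (auto simp: vec_lift_def intro!: proj_eq_mult_mat)
    then have "vec_lift (W *\<^sub>v w) (vQ (i + int n)) (vP (i + int n))"
      unfolding vec_lift_def fract.mult_mat_vec_hom[OF W(1) w(1)] eval1.mult_mat_vec_hom[OF W(1) w(1)]
      using stepQ stepP by (blast intro: proj_eq_trans)
    then show ?thesis using W(1) w(1) by (intro bexI[of _ "W *\<^sub>v w"]) auto
  qed
  have down: "?good i" if "?good (i + int n)" for i
  proof -
    obtain w where w: "w \<in> carrier_vec (d + 1)" "vec_lift w (vQ (i + int n)) (vP (i + int n))"
      using \<open>?good (i + int n)\<close> by auto
    note A = adj_mat(1)[OF W(1)]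
    have "proj_eq (map_mat to_fract W *\<^sub>v vQ i) (map_vec to_fract w)"
      "proj_eq (map_mat at_one W *\<^sub>v vP i) (map_vec at_one w)"
      using w(2) stepQ[of i] stepP[of i] unfolding vec_lift_def by (blast intro: proj_eq_trans proj_eq_sym)+
    then have
      "proj_eq (map_mat to_fract (adj_mat W) *\<^sub>v (map_mat to_fract W *\<^sub>v vQ i))
        (map_mat to_fract (adj_mat W) *\<^sub>v map_vec to_fract w)"
      "proj_eq (map_mat at_one (adj_mat W) *\<^sub>v (map_mat at_one W *\<^sub>v vP i))
        (map_mat at_one (adj_mat W) *\<^sub>v map_vec at_one w)"
      using A w(1) by (auto intro!: proj_eq_mult_mat)
    then have "vec_lift (adj_mat W *\<^sub>v w) (vQ i) (vP i)"
      unfolding vec_lift_def fract.mult_mat_vec_hom[OF A w(1)] eval1.mult_mat_vec_hom[OF A w(1)]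
        fract.adj_mat_cancel[OF W(1) Q(2)] eval1.adj_mat_cancel[OF W(1) P(2)]
      using detW by (blast intro: proj_eq_trans proj_eq_sym proj_eq_smult)
    then show ?thesis using A w(1) by (intro bexI[of _ "adj_mat W *\<^sub>v w"]) auto
  qed
  have ups: "?good (i + int n * int k)" if "?good i" for i k
  proof (induction k)
    case (Suc k)
    then show ?case using up[of "i + int n * int k"] by (simp add: algebra_simps)
  qed (use that in simp)
  have downs: "?good (i - int n * int k)" if "?good i" for i k
  proof (induction k)
    case (Suc k)
    then show ?case using down[of "i - int n * int (Suc k)"] by (simp add: algebra_simps)
  qed (use that in simp)
  define r where "r = a + (i - a) mod int n"
  define q where "q = (i - a) div int n"
  have r: "a \<le> r" "r < a + int n" using n by (auto simp: r_def)
  have i: "i = r + int n * q" unfolding r_def q_def by simp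
  show ?thesis
  proof (cases "0 \<le> q")
    case True
    then show ?thesis using ups[OF window[OF r], of "nat q"] unfolding i by simp
  next
    case False
    then show ?thesis using downs[OF window[OF r], of "nat (- q)"] unfolding i by simp
  qed
qed

section \<open>Evaluation of multivariate polynomials\<close>

lemma (in comm_semiring_hom) hom_mpoly_eval:
  "hom (mpoly_eval h x f) = mpoly_eval (\<lambda>a. hom (h a)) (\<lambda>v. hom (x v)) f"
  unfolding mpoly_eval_def by (simp add: hom_distribs)

lemma mpoly_eval_cong:
  assumes "\<And>v. v \<in> mpoly_vars f \<Longrightarrow> x v = y v"
  shows "mpoly_eval h x f = mpoly_eval h y f"
  unfolding mpoly_eval_def
proof (intro sum.cong refl arg_cong2[of _ _ _ _ "(*)"] prod.cong)
  fix m v assume "m \<in> Poly_Mapping.keys f" "v \<in> Poly_Mapping.keys m"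
  then show "x v ^ Poly_Mapping.lookup m v = y v ^ Poly_Mapping.lookup m v"
    using assms[of v] unfolding mpoly_vars_def by (metis UN_I)
qed

text \<open>
  The factor depends on the multidegree \<open>e\<close> alone, so it is the same for all components of a point of
  the image, and this point does not depend on the lifts at which the polynomials are evaluated.
\<close>

lemma mpoly_eval_multihomogeneous:
  fixes x :: "polygon_var \<Rightarrow> 'r::comm_semiring_1"
  assumes f: "multihomogeneous e f" and fin: "finite V" and V: "mpoly_vars f \<subseteq> V"
  shows "mpoly_eval h (\<lambda>v. s (var_block v) * x v) f = (\<Prod>b\<in>var_block ` V. s b ^ e b) * mpoly_eval h x f"
proof -
  have "(\<Prod>v\<in>Poly_Mapping.keys m. (s (var_block v) * x v) ^ Poly_Mapping.lookup m v)
      = (\<Prod>b\<in>var_block ` V. s b ^ e b) * (\<Prod>v\<in>Poly_Mapping.keys m. x v ^ Poly_Mapping.lookup m v)"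
    if m: "m \<in> Poly_Mapping.keys f" for m
  proof -
    have kV: "var_block ` Poly_Mapping.keys m \<subseteq> var_block ` V" using V m by (auto simp: mpoly_vars_def)
    have "(\<Prod>v\<in>Poly_Mapping.keys m. s (var_block v) ^ Poly_Mapping.lookup m v)
        = (\<Prod>b\<in>var_block ` V. \<Prod>v\<in>{v \<in> Poly_Mapping.keys m. var_block v = b}.
             s (var_block v) ^ Poly_Mapping.lookup m v)"
      using fin kV by (intro prod.group[symmetric]) auto
    also have "\<dots> = (\<Prod>b\<in>var_block ` V. s b ^ e b)"
    proof (intro prod.cong refl)
      fix b
      have "(\<Prod>v\<in>{v \<in> Poly_Mapping.keys m. var_block v = b}. s (var_block v) ^ Poly_Mapping.lookup m v)
          = s b ^ block_degree b m"
        unfolding block_degree_def power_sum by (intro prod.cong) auto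
      then show "(\<Prod>v\<in>{v \<in> Poly_Mapping.keys m. var_block v = b}. s (var_block v) ^ Poly_Mapping.lookup m v) = s b ^ e b"
        using f m by (simp add: multihomogeneous_def)
    qed
    finally show ?thesis by (simp add: power_mult_distrib prod.distrib)
  qed
  then show ?thesis
    unfolding mpoly_eval_def sum_distrib_left by (intro sum.cong) (auto simp: ac_simps)
qed

lemma finite_polygon_vars: "finite (polygon_vars d n)"
proof -
  have "polygon_vars d n = (\<lambda>(i, a). VertexCoord i a) ` ({..<n} \<times> {..d})
      \<union> (\<lambda>(a, b). MonodromyEntry a b) ` ({..d} \<times> {..d})"
    unfolding polygon_vars_def by auto
  then show ?thesis by simp
qed

section \<open>Polygonal transformations and specialization\<close>

lemma mpoly_eval_lift:
  fixes xw :: "polygon_var \<Rightarrow> 'a::field poly"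
  assumes f: "multihomogeneous e f" and fin: "finite V" and V: "mpoly_vars f \<subseteq> V"
    and x: "\<And>v. v \<in> V \<Longrightarrow> x v = s (var_block v) * to_fract (xw v)"
    and y: "\<And>v. v \<in> V \<Longrightarrow> y v = s' (var_block v) * poly (xw v) 1"
  shows "mpoly_eval const x f
      = (\<Prod>b\<in>var_block ` V. s b ^ e b) * to_fract (mpoly_eval (\<lambda>a. [:a:]) xw f)"
    and "mpoly_eval const (\<lambda>v. const (y v)) f
      = const ((\<Prod>b\<in>var_block ` V. s' b ^ e b) * poly (mpoly_eval (\<lambda>a. [:a:]) xw f) 1)"
proof -
  have "mpoly_eval const x f = mpoly_eval const (\<lambda>v. s (var_block v) * to_fract (xw v)) f"
    by (rule mpoly_eval_cong) (use x V in auto)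
  also have "\<dots> = (\<Prod>b\<in>var_block ` V. s b ^ e b) * mpoly_eval const (\<lambda>v. to_fract (xw v)) f"
    by (rule mpoly_eval_multihomogeneous[OF f fin V])
  also have "mpoly_eval const (\<lambda>v. to_fract (xw v)) f = to_fract (mpoly_eval (\<lambda>a. [:a:]) xw f)"
    unfolding fract.hom_mpoly_eval by (simp add: const_def[abs_def])
  finally show "mpoly_eval const x f
      = (\<Prod>b\<in>var_block ` V. s b ^ e b) * to_fract (mpoly_eval (\<lambda>a. [:a:]) xw f)" .
  have "mpoly_eval id y f = mpoly_eval id (\<lambda>v. s' (var_block v) * poly (xw v) 1) f"
    by (rule mpoly_eval_cong) (use y V in auto)
  also have "\<dots> = (\<Prod>b\<in>var_block ` V. s' b ^ e b) * mpoly_eval id (\<lambda>v. poly (xw v) 1) f"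
    by (rule mpoly_eval_multihomogeneous[OF f fin V])
  also have "mpoly_eval id (\<lambda>v. poly (xw v) 1) f = poly (mpoly_eval (\<lambda>a. [:a:]) xw f) 1"
    unfolding eval1.hom_mpoly_eval by (simp add: id_def)
  finally have "mpoly_eval id y f
      = (\<Prod>b\<in>var_block ` V. s' b ^ e b) * poly (mpoly_eval (\<lambda>a. [:a:]) xw f) 1" .
  then show "mpoly_eval const (\<lambda>v. const (y v)) f
      = const ((\<Prod>b\<in>var_block ` V. s' b ^ e b) * poly (mpoly_eval (\<lambda>a. [:a:]) xw f) 1)"
    using const.hom_mpoly_eval[of id y f] by (simp add: id_def)
qed

text \<open>
  Evaluating the polynomials of \<open>T\<close> at polynomial lifts of \<open>Pt\<close> gives polynomial lifts of the image.
  Substituting \<open>t = 1\<close> commutes with the evaluation, so their values are lifts of \<open>T(P)\<close>.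
\<close>

lemma transformation_lift:
  fixes T :: "'a::field polygon_map"
  assumes T: "wf_polygon_map d n T"
    and map: "maps_to d n T (const_polygon P) (const_polygon Q)"
    and spec: "specializes d Pt P"
  shows "i < n \<Longrightarrow> \<exists>y\<in>carrier_vec (d + 1).
      vec_lift y (vec (d + 1) (\<lambda>a. mpoly_eval const (polygon_coords Pt) (vertex_poly T i a))) (vertex Q (int i))"
    and "\<exists>Y\<in>square_mats d.
      mat_lift Y (mat (d + 1) (d + 1) (\<lambda>(a, b). mpoly_eval const (polygon_coords Pt) (monodromy_poly T a b)))
        (monodromy Q)"
proof -
  let ?N = "d + 1" and ?V = "polygon_vars d n"
  from spec obtain w W where w: "\<And>i. w i \<in> carrier_vec ?N" "\<And>i. vec_lift (w i) (vertex Pt i) (vertex P i)"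
    and W: "W \<in> square_mats d" "mat_lift W (monodromy Pt) (monodromy P)"
    unfolding specializes_iff_lifts by metis
  from w(2) have "\<exists>s. s \<noteq> 0 \<and> vertex Pt i = s \<cdot>\<^sub>v map_vec to_fract (w i)"
    "\<exists>s. s \<noteq> 0 \<and> vertex P i = s \<cdot>\<^sub>v map_vec at_one (w i)" for i
    unfolding vec_lift_def proj_eq_def by blast+
  then obtain sv sv' where
    sv: "\<And>i. sv i \<noteq> 0" "\<And>i. vertex Pt i = sv i \<cdot>\<^sub>v map_vec to_fract (w i)"
    and sv': "\<And>i. sv' i \<noteq> 0" "\<And>i. vertex P i = sv' i \<cdot>\<^sub>v map_vec at_one (w i)"
    by metis
  from W(2) obtain sm sm' where
    sm: "sm \<noteq> 0" "monodromy Pt = sm \<cdot>\<^sub>m map_mat to_fract W"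
    and sm': "sm' \<noteq> 0" "monodromy P = sm' \<cdot>\<^sub>m map_mat at_one W"
    unfolding mat_lift_def proj_eq_mat_def by blast
  \<comment> \<open>the factors between the given lifts and the polynomial ones, one for each block of variables\<close>
  define s where "s = case_option sm (\<lambda>i. sv (int i))"
  define s' where "s' = case_option sm' (\<lambda>i. sv' (int i))"
  define xw where "xw = (\<lambda>v. case v of VertexCoord i a \<Rightarrow> w (int i) $ a | MonodromyEntry a b \<Rightarrow> W $$ (a, b))"
  have s0: "s b \<noteq> 0" "s' b \<noteq> 0" for b
    using sv(1) sv'(1) sm(1) sm'(1) by (auto simp: s_def s'_def split: option.split)
  have dims: "dim_vec (w i) = ?N" "dim_row W = ?N" "dim_col W = ?N" for i using w(1)[of i] W(1) by auto
  have x: "polygon_coords Pt v = s (var_block v) * to_fract (xw v)" if "v \<in> ?V" for v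
    using that dims by (auto simp: polygon_vars_def s_def xw_def sv(2) sm(2))
  have y: "polygon_coords P v = s' (var_block v) * poly (xw v) 1" if "v \<in> ?V" for v
    using that dims by (auto simp: polygon_vars_def s'_def xw_def sv'(2) sm'(2))
  have Pc: "mpoly_eval const (polygon_coords (const_polygon P)) f = mpoly_eval const (\<lambda>v. const (polygon_coords P v)) f"
    if "mpoly_vars f \<subseteq> ?V" for f :: "(polygon_var, 'a) mpoly"
  proof (rule mpoly_eval_cong)
    fix v assume "v \<in> mpoly_vars f"
    then show "polygon_coords (const_polygon P) v = const (polygon_coords P v)"
      using that dims by (auto simp: polygon_vars_def const_polygon_def sv'(2) sm'(2))
  qed
  have lift: "mpoly_eval const (polygon_coords Pt) f
        = (\<Prod>b\<in>var_block ` ?V. s b ^ e b) * to_fract (mpoly_eval (\<lambda>a. [:a:]) xw f)"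
      "mpoly_eval const (\<lambda>v. const (polygon_coords P v)) f
        = const ((\<Prod>b\<in>var_block ` ?V. s' b ^ e b) * poly (mpoly_eval (\<lambda>a. [:a:]) xw f) 1)"
    if f: "multihomogeneous e f" "mpoly_vars f \<subseteq> ?V" for e and f :: "(polygon_var, 'a) mpoly"
    by (rule mpoly_eval_lift[OF f(1) finite_polygon_vars f(2), where s = s and s' = s' and xw = xw];
        use x y in blast)+
  have prod0: "(\<Prod>b\<in>var_block ` ?V. s b ^ e b) \<noteq> 0" "(\<Prod>b\<in>var_block ` ?V. s' b ^ e b) \<noteq> 0" for e
    using s0 finite_polygon_vars[of d n] by auto
  show "\<exists>y\<in>carrier_vec ?N.
      vec_lift y (vec ?N (\<lambda>a. mpoly_eval const (polygon_coords Pt) (vertex_poly T i a))) (vertex Q (int i))"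
    if i: "i < n"
  proof -
    obtain e where e: "\<And>a. a \<le> d \<Longrightarrow> mpoly_vars (vertex_poly T i a) \<subseteq> ?V"
      "\<And>a. a \<le> d \<Longrightarrow> multihomogeneous e (vertex_poly T i a)"
      using T i unfolding wf_polygon_map_def by metis
    define y where "y = vec ?N (\<lambda>a. mpoly_eval (\<lambda>a. [:a:]) xw (vertex_poly T i a))"
    define c where "c = (\<Prod>b\<in>var_block ` ?V. s b ^ e b)"
    define c' where "c' = (\<Prod>b\<in>var_block ` ?V. s' b ^ e b)"
    have "vec ?N (\<lambda>a. mpoly_eval const (polygon_coords Pt) (vertex_poly T i a)) = c \<cdot>\<^sub>v map_vec to_fract y"
      by (rule eq_vecI) (auto simp: y_def c_def lift(1)[OF e(2,1)])
    then have 1: "proj_eq (vec ?N (\<lambda>a. mpoly_eval const (polygon_coords Pt) (vertex_poly T i a))) (map_vec to_fract y)"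
      using prod0(1)[of e] by (simp add: proj_eq_smult c_def)
    have "proj_eq (vertex (const_polygon Q) (int i))
        (vec ?N (\<lambda>a. mpoly_eval const (polygon_coords (const_polygon P)) (vertex_poly T i a)))"
      using map i unfolding maps_to_def by blast
    also have "vec ?N (\<lambda>a. mpoly_eval const (polygon_coords (const_polygon P)) (vertex_poly T i a))
        = map_vec const (c' \<cdot>\<^sub>v map_vec at_one y)"
      by (rule eq_vecI) (auto simp: y_def c'_def Pc[OF e(1)] lift(2)[OF e(2,1)])
    finally have "proj_eq (vertex Q (int i)) (c' \<cdot>\<^sub>v map_vec at_one y)"
      by (simp add: const_polygon_def proj_eq_const_iff)
    also have "proj_eq \<dots> (map_vec at_one y)"
      using prod0(2)[of e] by (simp add: proj_eq_smult c'_def)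
    finally have "vec_lift y (vec ?N (\<lambda>a. mpoly_eval const (polygon_coords Pt) (vertex_poly T i a))) (vertex Q (int i))"
      using 1 by (simp add: vec_lift_def)
    then show ?thesis by (intro bexI[of _ y]) (auto simp: y_def)
  qed
  show "\<exists>Y\<in>square_mats d.
      mat_lift Y (mat ?N ?N (\<lambda>(a, b). mpoly_eval const (polygon_coords Pt) (monodromy_poly T a b))) (monodromy Q)"
  proof -
    obtain e where e: "\<And>a b. a \<le> d \<Longrightarrow> b \<le> d \<Longrightarrow> mpoly_vars (monodromy_poly T a b) \<subseteq> ?V"
      "\<And>a b. a \<le> d \<Longrightarrow> b \<le> d \<Longrightarrow> multihomogeneous e (monodromy_poly T a b)"
      using T unfolding wf_polygon_map_def by metis
    define Y where "Y = mat ?N ?N (\<lambda>(a, b). mpoly_eval (\<lambda>a. [:a:]) xw (monodromy_poly T a b))"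
    define c where "c = (\<Prod>b\<in>var_block ` ?V. s b ^ e b)"
    define c' where "c' = (\<Prod>b\<in>var_block ` ?V. s' b ^ e b)"
    have "mat ?N ?N (\<lambda>(a, b). mpoly_eval const (polygon_coords Pt) (monodromy_poly T a b)) = c \<cdot>\<^sub>m map_mat to_fract Y"
      by (rule eq_matI) (auto simp: Y_def c_def lift(1)[OF e(2,1)])
    then have 1: "proj_eq_mat (mat ?N ?N (\<lambda>(a, b). mpoly_eval const (polygon_coords Pt) (monodromy_poly T a b))) (map_mat to_fract Y)"
      using prod0(1)[of e] by (simp add: proj_eq_mat_smult c_def)
    have "proj_eq_mat (monodromy (const_polygon Q))
        (mat ?N ?N (\<lambda>(a, b). mpoly_eval const (polygon_coords (const_polygon P)) (monodromy_poly T a b)))"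
      using map unfolding maps_to_def by blast
    also have "mat ?N ?N (\<lambda>(a, b). mpoly_eval const (polygon_coords (const_polygon P)) (monodromy_poly T a b))
        = map_mat const (c' \<cdot>\<^sub>m map_mat at_one Y)"
      by (rule eq_matI) (auto simp: Y_def c'_def Pc[OF e(1)] lift(2)[OF e(2,1)])
    finally have "proj_eq_mat (monodromy Q) (c' \<cdot>\<^sub>m map_mat at_one Y)"
      by (simp add: const_polygon_def proj_eq_mat_const_iff)
    also have "proj_eq_mat \<dots> (map_mat at_one Y)"
      using prod0(2)[of e] by (simp add: proj_eq_mat_smult c'_def)
    finally have "mat_lift Y (mat ?N ?N (\<lambda>(a, b). mpoly_eval const (polygon_coords Pt) (monodromy_poly T a b))) (monodromy Q)"
      using 1 by (simp add: mat_lift_def)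
    then show ?thesis by (intro bexI[of _ Y]) (auto simp: Y_def)
  qed
qed

lemma ngon_periodic:
  assumes "ngon d n P"
  shows "monodromy P \<in> square_mats d" "det (monodromy P) \<noteq> 0"
    "proj_eq (vertex P (i + int n)) (monodromy P *\<^sub>v vertex P i)"
  using assms unfolding ngon_def by auto

lemma specializes_image:
  fixes T :: "'a::field polygon_map"
  assumes n: "1 \<le> n" and T: "wf_polygon_map d n T"
    and map: "maps_to d n T (const_polygon P) (const_polygon Q)" and Q: "ngon d n Q"
    and spec: "specializes d Pt P" and mapt: "maps_to d n T Pt Qt"
  shows "specializes d Qt Q"
proof -
  have Qt: "ngon d n Qt"
    and vert: "\<And>i. i < n \<Longrightarrow> proj_eq (vertex Qt (int i))
        (vec (d + 1) (\<lambda>a. mpoly_eval const (polygon_coords Pt) (vertex_poly T i a)))"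
    and mono: "proj_eq_mat (monodromy Qt)
       (mat (d + 1) (d + 1) (\<lambda>(a, b). mpoly_eval const (polygon_coords Pt) (monodromy_poly T a b)))"
    using mapt unfolding maps_to_def by auto
  note lift = transformation_lift[OF T map spec]
  obtain Y where Y: "Y \<in> square_mats d" "mat_lift Y (monodromy Qt) (monodromy Q)"
    using lift(2) mono unfolding mat_lift_def by (blast intro: proj_eq_mat_trans)
  have "\<exists>y\<in>carrier_vec (d + 1). vec_lift y (vertex Qt i) (vertex Q i)" for i
  proof (rule vec_lift_periodic[where vQ = "vertex Qt" and vP = "vertex Q" and a = 0, OF n ngon_periodic(3)[OF Qt] ngon_vertex_carrier[OF Qt]
        ngon_periodic(3)[OF Q] ngon_vertex_carrier[OF Q] ngon_periodic(1,2)[OF Q] Y])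
    fix i assume "0 \<le> i" "i < 0 + int n"
    then obtain k where "i = int k" "k < n" by (cases i) auto
    then show "\<exists>y\<in>carrier_vec (d + 1). vec_lift y (vertex Qt i) (vertex Q i)"
      using lift(1)[of k] vert[of k] vec_lift_cong[OF _ _ proj_eq_refl] by blast
  qed
  then show ?thesis unfolding specializes_iff_lifts using Y by blast
qed

text \<open>Invertibility lets the recursion run towards negative indices.\<close>

lemma int_recurrence:
  fixes L :: "int \<Rightarrow> 'k::field mat"
  assumes L: "\<And>i. L i \<in> carrier_mat m m" "\<And>i. det (L i) \<noteq> 0"
    and B0: "B0 \<in> carrier_mat m m" "det B0 \<noteq> 0"
  shows "\<exists>B. B a = B0 \<and> (\<forall>i. B i \<in> carrier_mat m m \<and> det (B i) \<noteq> 0 \<and> B (i + 1) = B i * L i)"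
proof -
  note inv = det_nonzero_minv[OF L]
  define f where "f = rec_nat B0 (\<lambda>k X. X * L (a + int k))"
  define g where "g = rec_nat B0 (\<lambda>k X. X * minv (L (a - 1 - int k)))"
  define B where "B i = (if a \<le> i then f (nat (i - a)) else g (nat (a - i)))" for i
  have f: "f 0 = B0" "f (Suc k) = f k * L (a + int k)" for k by (auto simp: f_def)
  have g: "g 0 = B0" "g (Suc k) = g k * minv (L (a - 1 - int k))" for k by (auto simp: g_def)
  have fc: "f k \<in> carrier_mat m m \<and> det (f k) \<noteq> 0" for k
    by (induction k) (use B0 L in \<open>auto simp: f det_mult[OF _ L(1)]\<close>)
  have gc: "g k \<in> carrier_mat m m \<and> det (g k) \<noteq> 0" for k
    by (induction k) (use B0 inv in \<open>auto simp: g det_mult[OF _ inv(1)]\<close>)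
  have "B (i + 1) = B i * L i" for i
  proof (cases "a \<le> i")
    case True
    then have "nat (i + 1 - a) = Suc (nat (i - a))" by simp
    then show ?thesis using True by (simp add: B_def f)
  next
    case False
    define k where "k = nat (a - i - 1)"
    have k: "nat (a - i) = Suc k" "a - 1 - int k = i" using False by (auto simp: k_def)
    have "B (i + 1) = g k"
    proof (cases "i + 1 = a")
      case True
      then show ?thesis by (simp add: B_def f g k_def)
    next
      case False
      then show ?thesis using \<open>\<not> a \<le> i\<close> by (simp add: B_def k_def algebra_simps)
    qed
    moreover have "B i * L i = g k * minv (L i) * L i" using False by (simp add: B_def k g)
    moreover have "g k * minv (L i) * L i = g k"
      using conjunct1[OF gc[of k]] inv(1)[of i] inv(3)[of i] L(1)[of i] by (simp add: mult_mat_assoc_dim)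
    ultimately show ?thesis by simp
  qed
  moreover have "B a = B0" by (simp add: B_def f)
  moreover have "B i \<in> carrier_mat m m \<and> det (B i) \<noteq> 0" for i using fc gc by (simp add: B_def)
  ultimately show ?thesis by (intro exI[of _ B]) blast
qed

text \<open>
  The polynomials of \<open>T\<close> give the first \<open>n\<close> vertices and the monodromy of the image. The other
  vertices are obtained from powers of the monodromy, and the frame conditions hold because they hold
  at \<open>t = 1\<close>, for \<open>T(P)\<close>.
\<close>

lemma transformation_defined:
  fixes T :: "'a::field polygon_map"
  assumes n: "1 \<le> n" and T: "wf_polygon_map d n T"
    and map: "maps_to d n T (const_polygon P) (const_polygon Q)" and Q: "ngon d n Q"
    and Pt: "ngon d n Pt" and spec: "specializes d Pt P"
  shows "\<exists>Qt. maps_to d n T Pt Qt"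
proof -
  let ?N = "d + 1"
  note lift = transformation_lift[OF T map spec]
  define v where "v i = vec ?N (\<lambda>a. mpoly_eval const (polygon_coords Pt) (vertex_poly T i a))" for i
  define M where "M = mat ?N ?N (\<lambda>(a, b). mpoly_eval const (polygon_coords Pt) (monodromy_poly T a b))"
  have M: "M \<in> square_mats d" by (simp add: M_def)
  obtain Y where Y: "Y \<in> square_mats d" "mat_lift Y M (monodromy Q)"
    using lift(2) unfolding M_def by blast
  note per = ngon_periodic[OF Q]
  have "det M \<noteq> 0"
  proof -
    obtain s s' where s: "s \<noteq> 0" "M = s \<cdot>\<^sub>m map_mat to_fract Y"
      and s': "s' \<noteq> 0" "monodromy Q = s' \<cdot>\<^sub>m map_mat at_one Y"
      using Y(2) by (auto simp: mat_lift_def proj_eq_mat_def)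
    have "poly (det Y) 1 \<noteq> 0" using per(2) s' eval1.hom_det[of Y] by auto
    then have "to_fract (det Y) \<noteq> 0" by auto
    then show ?thesis using s fract.hom_det[of Y] by simp
  qed
  then have "\<exists>B. B (0::int) = 1\<^sub>m ?N \<and> (\<forall>q. B q \<in> square_mats d \<and> det (B q) \<noteq> 0 \<and> B (q + 1) = B q * M)"
    by (intro int_recurrence) (use M in auto)
  then obtain B where B0: "B (0::int) = 1\<^sub>m ?N" and B: "\<And>q. B q \<in> square_mats d"
    "\<And>q. B (q + 1) = B q * M" by blast
  have comm: "B q * M = M * B q" for q
  proof (induction q rule: int_induct[of _ 0])
    case base
    then show ?case using M by (simp add: B0)
  next
    case (step1 q)
    then show ?case using M B(1)[of q] B(2)[of q] by (simp add: mult_mat_assoc_dim)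
  next
    case (step2 q)
    have e: "(B (q - 1) * M) * M = (M * B (q - 1)) * M"
      using step2(2) B(2)[of "q - 1"] M B(1)[of "q - 1"] by (simp add: mult_mat_assoc_dim)
    note inv = det_nonzero_minv[OF M \<open>det M \<noteq> 0\<close>]
    have "((B (q - 1) * M) * M) * minv M = ((M * B (q - 1)) * M) * minv M" unfolding e ..
    then show ?case using M B(1)[of "q - 1"] inv(1,2) by (simp add: mult_mat_assoc_dim)
  qed
  define Qt where "Qt = Polygon (\<lambda>i. B (i div int n) *\<^sub>v v (nat (i mod int n))) M"
  have vert: "vertex Qt (int i) = v i" if "i < n" for i
    using that by (simp add: Qt_def B0 v_def)
  have carr: "vertex Qt i \<in> carrier_vec ?N" for i
    using B(1)[of "i div int n"] by (auto simp: Qt_def v_def)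
  have perQ: "vertex Qt (i + int n) = M *\<^sub>v vertex Qt i" for i
  proof -
    have "(i + int n) div int n = i div int n + 1" "(i + int n) mod int n = i mod int n"
      using n by auto
    then have "vertex Qt (i + int n) = (M * B (i div int n)) *\<^sub>v v (nat (i mod int n))"
      by (simp add: Qt_def B(2) comm)
    also have "\<dots> = M *\<^sub>v vertex Qt i"
      using M B(1)[of "i div int n"] by (simp add: Qt_def v_def mult_mat_vec_assoc_dim)
    finally show ?thesis .
  qed
  have "\<exists>y\<in>carrier_vec ?N. vec_lift y (vertex Qt i) (vertex Q i)" for i
  proof (rule vec_lift_periodic[where vQ = "vertex Qt" and vP = "vertex Q" and a = 0, OF n _ carr per(3) ngon_vertex_carrier[OF Q] per(1,2) Y])
    show "proj_eq (vertex Qt (i + int n)) (M *\<^sub>v vertex Qt i)" for i by (simp add: perQ)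
    fix i assume "0 \<le> i" "i < 0 + int n"
    then obtain k where "i = int k" "k < n" by (cases i) auto
    then show "\<exists>y\<in>carrier_vec ?N. vec_lift y (vertex Qt i) (vertex Q i)"
      using lift(1)[of k] vert[of k] by (simp add: v_def)
  qed
  then obtain y where y: "\<And>i. y i \<in> carrier_vec ?N" "\<And>i. vec_lift (y i) (vertex Qt i) (vertex Q i)" by metis
  have "proj_frame d (\<lambda>m. vertex Qt (i + int m))" for i
    by (rule proj_frame_lift[OF y(1) y(2)]) (use Q in \<open>simp add: ngon_def\<close>)
  then have "ngon d n Qt" unfolding ngon_def using M \<open>det M \<noteq> 0\<close> perQ by (simp add: Qt_def)
  then have "maps_to d n T Pt Qt"
    unfolding maps_to_def using Pt vert by (simp add: v_def M_def[symmetric]) (simp add: Qt_def M_def)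
  then show ?thesis by blast
qed

section \<open>Scaling of cross-ratio coordinates\<close>

lemma scaling_curve_cong:
  assumes c: "moduli_eq d n c c'"
    and f: "mpoly_vars f \<subseteq> {Time} \<union> {Coord i j | i j. i \<in> {1..int n} \<and> j \<in> {1..d}}"
  shows "scaling_curve h c f = scaling_curve h c' f"
  unfolding scaling_curve_def
  by (rule mpoly_eval_cong) (use c f in \<open>auto simp: moduli_eq_def split: scaling_var.split\<close>)

lemma scaled_cong:
  assumes \<rho>: "wf_scaling d n \<rho>" and c: "moduli_eq d n c c'" and ij: "i \<in> {1..int n}" "j \<in> {1..d}"
  shows "numer h \<rho> c i j = numer h \<rho> c' i j" "denom h \<rho> c i j = denom h \<rho> c' i j"
    "scaled h \<rho> t c i j = scaled h \<rho> t c' i j"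
proof -
  have "mpoly_vars (fst (\<rho> i j)) \<union> mpoly_vars (snd (\<rho> i j))
      \<subseteq> {Time} \<union> {Coord i j | i j. i \<in> {1..int n} \<and> j \<in> {1..d}}"
    using \<rho> ij unfolding wf_scaling_def by blast
  then show "numer h \<rho> c i j = numer h \<rho> c' i j" "denom h \<rho> c i j = denom h \<rho> c' i j"
    by (auto intro!: scaling_curve_cong[OF c])
  then show "scaled h \<rho> t c i j = scaled h \<rho> t c' i j" by (simp add: scaled_def)
qed

lemma map_poly_const_hom: "comm_ring_hom (map_poly (const :: 'a::field \<Rightarrow> _))"
proof unfold_locales
  fix p q :: "'a poly"
  show "map_poly const (p + q) = map_poly const p + map_poly const q"
    by (rule poly_eqI) (simp add: coeff_map_poly const.hom_add)
  show "map_poly const (p * q) = map_poly const p * map_poly const q"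
    by (rule poly_eqI) (simp add: coeff_map_poly coeff_mult const.hom_mult const.hom_sum)
  show "map_poly const (1 :: 'a poly) = 1"
    by (rule poly_eqI) (simp add: coeff_map_poly coeff_1)
qed simp

interpretation constpoly: comm_ring_hom "map_poly (const :: 'a::field \<Rightarrow> _)"
  by (rule map_poly_const_hom)

lemma scaling_curve_const:
  "scaling_curve const (\<lambda>i j. const (c i j)) f = map_poly const (scaling_curve id c f)"
proof -
  have "map_poly const (scaling_curve id c f)
      = mpoly_eval (\<lambda>a. [:const a:])
          (\<lambda>v. map_poly const (case v of Time \<Rightarrow> [:0, 1:] | Coord i j \<Rightarrow> [:c i j:])) f"
    unfolding scaling_curve_def constpoly.hom_mpoly_eval by (simp add: map_poly_pCons)
  also have "(\<lambda>v. map_poly const (case v of Time \<Rightarrow> [:0, 1:] | Coord i j \<Rightarrow> [:c i j:]))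
      = (\<lambda>v. case v of Time \<Rightarrow> [:0, 1:] | Coord i j \<Rightarrow> [:const (c i j):])"
    by (rule ext) (simp add: map_poly_pCons split: scaling_var.split)
  finally show ?thesis by (simp add: scaling_curve_def)
qed

lemma poly_map_poly_const: "poly (map_poly const p) (const x) = const (poly p (x :: 'a::field))"
  by (induction p) (simp_all add: map_poly_pCons const.hom_add const.hom_mult)

lemma poly_map_poly_const_1: "poly (map_poly const p) 1 = const (poly p (1 :: 'a::field))"
  using poly_map_poly_const[of p 1] by simp

lemma pderiv_map_poly_const: "pderiv (map_poly const p) = map_poly const (pderiv (p :: 'a::field poly))"
  by (induction p) (simp_all add: map_poly_pCons pderiv_pCons constpoly.hom_add)

text \<open>
  The generic parameter is transcendental: substituting it into a polynomial over \<open>F\<close> yields that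
  polynomial as an element of \<open>F(t)\<close>.
\<close>

lemma poly_map_poly_generic: "poly (map_poly const p) generic_t = to_fract (p :: 'a::field poly)"
proof (induction p)
  case (pCons a p)
  have "pCons a p = [:a:] + [:0, 1:] * p" by simp
  then have "to_fract (pCons a p) = const a + generic_t * to_fract p"
    unfolding const_def generic_t_def by (metis to_fract_add to_fract_mult)
  then show ?case using pCons by (simp add: map_poly_pCons)
qed simp

lemma const_inverse: "const (inverse a) = inverse (const (a :: 'a::field))"
proof (cases "a = 0")
  case False
  then have "const a * const (inverse a) = 1" by (simp flip: const.hom_mult)
  then show ?thesis by (metis inverse_unique)
qed simp

lemma const_divide: "const (a / b) = const a / const (b :: 'a::field)"
  by (simp add: field_class.field_divide_inverse const.hom_mult const_inverse)

text \<open>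
  Linearity is an identity of rational functions in one variable over \<open>F(t)\<close>. At a point with
  coordinates in \<open>F\<close> the denominator does not vanish at the generic parameter, because its value
  there is the denominator over \<open>F\<close>, which is not zero at \<open>1\<close>; so the identity may be evaluated there.
\<close>

lemma linear_scaling_generic:
  fixes \<rho> :: "'a::field scaling"
  assumes lin: "linear_scaling d n \<rho>"
    and unit: "\<forall>c. moduli_point d n c \<and> scaling_defined d n const \<rho> 1 c \<longrightarrow>
      moduli_eq d n (scaled const \<rho> 1 c) c"
    and c: "moduli_point d n (cr d P)" and def1: "scaling_defined d n id \<rho> 1 (cr d P)"
    and ij: "i \<in> {1..int n}" "j \<in> {1..d}"
  shows "poly (denom const \<rho> (\<lambda>i j. const (cr d P i j)) i j) generic_t \<noteq> 0"
    and "scaled const \<rho> generic_t (\<lambda>i j. const (cr d P i j)) i j = to_fract (cr_poly d \<rho> P i j)"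
proof -
  let ?c = "cr d P" and ?cK = "\<lambda>i j. const (cr d P i j)"
  have num: "numer const \<rho> ?cK i j = map_poly const (numer id \<rho> ?c i j)"
    and den: "denom const \<rho> ?cK i j = map_poly const (denom id \<rho> ?c i j)" for i j
    by (rule scaling_curve_const)+
  have s1: "scaled const \<rho> 1 ?cK i j = const (scaled id \<rho> 1 ?c i j)" for i j
    unfolding scaled_def num den poly_map_poly_const_1 const_divide ..
  have vel: "scaling_velocity const \<rho> ?cK i j = const (scaling_velocity id \<rho> ?c i j)"
    unfolding scaling_velocity_def num den pderiv_map_poly_const poly_map_poly_const_1
    by (simp add: const_divide const.hom_minus const.hom_mult const.hom_power)
  have pt: "moduli_point d n ?cK" using c unfolding moduli_point_def by simp
  have defK: "scaling_defined d n const \<rho> 1 ?cK"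
    using def1 unfolding scaling_defined_def s1 den poly_map_poly_const_1 by simp
  have "poly (denom id \<rho> ?c i j) 1 \<noteq> 0" using def1 ij unfolding scaling_defined_def by blast
  then have "denom id \<rho> ?c i j \<noteq> 0" by auto
  then show den0: "poly (denom const \<rho> ?cK i j) generic_t \<noteq> 0"
    unfolding den poly_map_poly_generic by simp
  then have D: "denom const \<rho> ?cK i j \<noteq> 0" by auto
  have unit': "scaled const \<rho> 1 ?cK i j = ?cK i j"
    using unit pt defK ij unfolding moduli_eq_def by blast
  have "j \<noteq> d + 1" using ij by auto
  then have crp: "[:?cK i j:] + Polynomial.smult (const (scaling_velocity id \<rho> ?c i j)) [:-1, 1:]
      = map_poly const (cr_poly d \<rho> P i j)"
    by (simp add: cr_poly_def cr_deriv_def map_poly_pCons const.hom_minus)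
  have "Fract (numer const \<rho> ?cK i j) (denom const \<rho> ?cK i j) = to_fract (map_poly const (cr_poly d \<rho> P i j))"
    using lin pt defK ij unfolding linear_scaling_def by (simp only: unit' vel crp)
  then have "to_fract (numer const \<rho> ?cK i j)
      = to_fract (map_poly const (cr_poly d \<rho> P i j) * denom const \<rho> ?cK i j)"
    using D by (simp add: Fract_conv_to_fract field_simps)
  then have "numer const \<rho> ?cK i j = map_poly const (cr_poly d \<rho> P i j) * denom const \<rho> ?cK i j"
    by (simp only: to_fract_eq_iff)
  then have "poly (numer const \<rho> ?cK i j) generic_t
      = to_fract (cr_poly d \<rho> P i j) * poly (denom const \<rho> ?cK i j) generic_t"
    by (simp add: poly_map_poly_generic)
  then show "scaled const \<rho> generic_t ?cK i j = to_fract (cr_poly d \<rho> P i j)"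
    using den0 by (simp add: scaled_def)
qed

lemma poly_cr_poly_1: "poly (cr_poly d \<rho> P i j) 1 = cr d P i j"
  by (simp add: cr_poly_def)

section \<open>The monodromy of the deformation\<close>

lemma L_mat_eq_companion: "L_mat d \<rho> P i = companion d (cr_poly d \<rho> P i)"
  by (simp add: L_mat_def companion_def)

lemma map_const_eq: "map_mat to_fract (map_mat (\<lambda>a. [:a:]) A) = map_mat const A"
  by (rule eq_matI) (auto simp: const_def)

lemma map_eval_constp: "map_mat at_one (map_mat (\<lambda>a. [:a :: 'a::field:]) A) = A"
  by (rule eq_matI) auto

lemma frame_basis_const:
  fixes q :: "nat \<Rightarrow> 'a::field vec"
  assumes B: "frame_basis d q B"
    and q': "\<And>m. m \<le> d + 1 \<Longrightarrow> proj_eq (q' m) (map_vec const (q m))"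
  shows "frame_basis d q' (map_mat const B)"
proof -
  note b = frame_basisD[OF B]
  have *: "proj_eq (q' m) (map_mat const B *\<^sub>v map_vec const w)"
    if "m \<le> d + 1" "proj_eq (q m) (B *\<^sub>v w)" "w \<in> carrier_vec (d + 1)" for m w
    using proj_eq_trans[OF q'[OF that(1)]] that(2,3) b(1)
    by (simp add: proj_eq_const_iff flip: const.mult_mat_vec_hom)
  have ones: "map_vec const (ones m) = (ones m :: 'a poly fract vec)" for m
    by (rule eq_vecI) auto
  have unit: "map_vec const (unit_vec m j) = (unit_vec m j :: 'a poly fract vec)" for m j
    by (rule eq_vecI) (auto simp: unit_vec_def)
  show ?thesis
    unfolding frame_basis_def
    using b(1,2) *[OF _ b(3) vec_carrier] *[OF _ b(4) unit_vec_carrier]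
    by (auto simp: ones unit const.hom_det)
qed

lemma cr_const_polygon:
  fixes P :: "'a::field polygon"
  assumes P: "ngon d n P" and j: "1 \<le> j" "j \<le> d + 1"
  shows "cr d (const_polygon P) i j = const (cr d P i j)"
proof -
  let ?N = "d + 1"
  have vert: "vertex (const_polygon P) i = map_vec const (vertex P i)" for i
    by (simp add: const_polygon_def)
  obtain B where B: "frame_basis d (frame_at P i) B"
    using proj_frame_has_basis[OF ngon_proj_frame[OF P]] by blast
  define u where "u = vec ?N (\<lambda>r. cr d P i (r + 1))"
  have u: "u \<in> carrier_vec ?N" unfolding u_def by (rule vec_carrier)
  have "cr d (const_polygon P) i j = map_vec const u $ (j - 1) / map_vec const u $ d"
  proof (rule cr_eq[OF _ _ _ _ j])
    show "vertex (const_polygon P) i \<in> carrier_vec ?N" for i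
      unfolding vert map_carrier_vec by (rule ngon_vertex_carrier[OF P])
    show "frame_basis d (frame_at (const_polygon P) i) (map_mat const B)"
      by (rule frame_basis_const[OF B]) (simp add: vert)
    show "map_vec const u \<in> carrier_vec ?N" using u by simp
    show "proj_eq (vertex (const_polygon P) (i + int d + 1)) (map_mat const B *\<^sub>v map_vec const u)"
      unfolding vert const.mult_mat_vec_hom[OF frame_basisD(1)[OF B] u, symmetric] proj_eq_const_iff
      unfolding u_def by (rule ngon_coordinates(1)[OF P B])
  qed
  also have "\<dots> = const (cr d P i j)"
    using j ngon_coordinates(3)[OF P B] by (cases j) (auto simp: u_def)
  finally show ?thesis .
qed

lemma frame_transform_basis:
  fixes P :: "'k::field polygon"
  assumes P: "ngon d n P"
  defines "C \<equiv> frame_transform d (\<lambda>m. vertex P (int m))"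
  shows "C \<in> square_mats d" "det C \<noteq> 0" "frame_basis d (frame_at P 1) (minv C)"
proof -
  have C: "C = frame_transform d (frame_at P 1)" by (simp add: C_def)
  obtain B where B: "frame_basis d (frame_at P 1) B"
    using proj_frame_has_basis[OF ngon_proj_frame[OF P]] by blast
  then have "frame_map d (frame_at P 1) (minv B)"
    using frame_map_minv_iff[OF frame_basisD(1,2)[OF B], of "frame_at P 1"] ngon_vertex_carrier[OF P] by simp
  then have C: "frame_map d (frame_at P 1) C"
    unfolding C frame_transform_def by (rule someI)
  then show "C \<in> square_mats d" "det C \<noteq> 0" by (auto simp: frame_map_def)
  show "frame_basis d (frame_at P 1) (minv C)"
    by (rule frame_map_imp_frame_basis[OF C]) (rule ngon_vertex_carrier[OF P])
qed

text \<open>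
  A linear scaling symmetry enters the computation of the monodromy only through the coordinates of
  the generic deformation, which are the polynomials \<open>c\<^sub>i\<^sub>,\<^sub>j(t)\<close>. The locale is used twice, for \<open>P\<close>
  and for \<open>T(P)\<close>.
\<close>

locale linear_deformation =
  fixes d n :: nat and \<rho> :: "'a::field scaling" and P :: "'a polygon"
  assumes n: "1 \<le> n" and P: "ngon d n P" and closed: "closed_polygon d P"
    and generic: "\<And>i j. i \<in> {1..int n} \<Longrightarrow> j \<in> {1..d} \<Longrightarrow>
      scaled const \<rho> generic_t (\<lambda>i j. const (cr d P i j)) i j = to_fract (cr_poly d \<rho> P i j)"
begin

text \<open>The transformation that maps the initial frame \<open>(p\<^sub>0, \<dots>, p\<^sub>d\<^sub>+\<^sub>1)\<close> to the standard one.\<close>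

definition C :: "'a mat" where "C = frame_transform d (\<lambda>m. vertex P (int m))"

definition total :: "'a poly mat" where "total = companion_prod d (cr_poly d \<rho> P) [1..int n]"

lemma C: "C \<in> square_mats d" "det C \<noteq> 0" "frame_basis d (frame_at P 1) (minv C)"
  using frame_transform_basis[OF P] by (auto simp: C_def)

lemmas C_inv = det_nonzero_minv[OF C(1,2)]

lemma total_carrier: "total \<in> square_mats d"
  unfolding total_def by (rule companion_prod_carrier)

abbreviation family :: "'a poly mat" where "family \<equiv> monodromy_family d n \<rho> P"

abbreviation raw_family :: "'a poly mat" where "raw_family \<equiv> raw_monodromy_family d n \<rho> P"

lemma raw_eq: "raw_family
    = map_mat (\<lambda>a. [:a:]) (minv C) * total * map_mat (\<lambda>a. [:a:]) C"
  by (simp add: raw_monodromy_family_def Let_def C_def total_def companion_prod_def L_mat_eq_companion)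

lemma raw_carrier: "raw_family \<in> square_mats d"
  unfolding raw_eq using C(1) C_inv(1) total_carrier by auto

lemma basis_at: "\<exists>B. frame_basis d (frame_at P i) B"
  by (rule proj_frame_has_basis[OF ngon_proj_frame[OF P]])

lemma cr_nonzero: "1 \<le> j \<Longrightarrow> j \<le> d + 1 \<Longrightarrow> cr d P i j \<noteq> 0"
  using ngon_coordinates(2)[OF P] basis_at by blast

lemma cr_last: "cr d P i (d + 1) = 1"
  using ngon_coordinates(3)[OF P] basis_at by blast

lemma cr_poly_last: "cr_poly d \<rho> P i (d + 1) = 1"
  unfolding cr_poly_def cr_deriv_def cr_last by simp

lemma total_at_one: "map_mat at_one total = companion_prod d (cr d P) [1..int n]"
  unfolding total_def eval1.map_companion_prod poly_cr_poly_1 ..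

text \<open>At \<open>t = 1\<close> the product is the monodromy of the closed polygon \<open>P\<close> itself.\<close>

lemma raw_at_one: "proj_eq_mat (map_mat at_one raw_family) (1\<^sub>m (d + 1))"
proof -
  let ?\<Pi> = "companion_prod d (cr d P) [1..int n]"
  have "map_mat at_one raw_family = minv C * ?\<Pi> * C"
    unfolding raw_eq total_at_one[symmetric]
    using C(1) C_inv(1) total_carrier
    by (subst eval1.mat_hom_mult[of _ "d + 1" "d + 1" _ "d + 1"],
        auto simp: map_eval_constp eval1.mat_hom_mult[of _ "d + 1" "d + 1" _ "d + 1"])
  moreover have "proj_eq_mat (minv C * ?\<Pi> * C) (monodromy P * minv C * C)"
    using monodromy_companion_prod[OF P C(3)] C(1) C_inv(1)
    by (intro proj_eq_mat_mult_right proj_eq_mat_sym[OF monodromy_companion_prod[OF P C(3)]]) auto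
  moreover have "monodromy P * minv C * C = monodromy P"
    using C(1) C_inv(1,3) ngon_periodic(1)[OF P] by (simp add: mult_mat_assoc_dim)
  ultimately show ?thesis using closed unfolding closed_polygon_def by (metis proj_eq_mat_trans)
qed

lemma family_at_one: "map_mat at_one family = 1\<^sub>m (d + 1)"
  and family_proj_eq: "\<exists>s. s \<noteq> 0 \<and> family = [:s:] \<cdot>\<^sub>m raw_family"
proof -
  let ?W = "raw_family"
  obtain s where s: "s \<noteq> 0" "map_mat at_one ?W = s \<cdot>\<^sub>m 1\<^sub>m (d + 1)"
    using raw_at_one by (auto simp: proj_eq_mat_def)
  have e: "poly (?W $$ (i, j)) 1 = (if i = j then s else 0)" if "i < d + 1" "j < d + 1" for i j
    using arg_cong[OF s(2), of "\<lambda>X. X $$ (i, j)"] that raw_carrier by simp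
  have fam: "family = [:inverse s:] \<cdot>\<^sub>m ?W"
    using e[of 0 0] by (simp add: monodromy_family_def Let_def)
  show "map_mat at_one family = 1\<^sub>m (d + 1)"
    unfolding fam by (rule eq_matI) (use raw_carrier s(1) e in auto)
  show "\<exists>s. s \<noteq> 0 \<and> family = [:s:] \<cdot>\<^sub>m ?W"
    using fam s(1) by (intro exI[of _ "inverse s"]) simp
qed

lemma family_carrier: "family \<in> square_mats d"
  using family_proj_eq raw_carrier by auto

lemma family_proj_eq_raw:
  "proj_eq_mat (map_mat to_fract family) (map_mat to_fract raw_family)"
proof -
  obtain s where s: "s \<noteq> 0" "family = [:s:] \<cdot>\<^sub>m raw_family"
    using family_proj_eq by blast
  have "map_mat to_fract family = to_fract [:s:] \<cdot>\<^sub>m map_mat to_fract raw_family"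
    unfolding s(2) by (rule eq_matI) (auto simp flip: to_fract_mult)
  then show ?thesis using s(1) by (simp add: proj_eq_mat_smult)
qed

lemma fract_raw:
  "map_mat to_fract raw_family
    = map_mat const (minv C) * (map_mat to_fract total * map_mat const C)"
proof -
  have "map_mat to_fract raw_family
     = map_mat to_fract (map_mat (\<lambda>a. [:a:]) (minv C) * (total * map_mat (\<lambda>a. [:a:]) C))"
    unfolding raw_eq using C(1) C_inv(1) total_carrier by (simp add: mult_mat_assoc_dim)
  also have "\<dots> = map_mat const (minv C) * (map_mat to_fract total * map_mat const C)"
    unfolding map_const_eq[symmetric]
    using C(1) C_inv(1) total_carrier
    by (subst fract.mat_hom_mult[of _ "d + 1" "d + 1" _ "d + 1"],
        auto simp: fract.mat_hom_mult[of _ "d + 1" "d + 1" _ "d + 1"])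
  finally show ?thesis .
qed

lemma const_C_inv: "map_mat const C * map_mat const (minv C) = 1\<^sub>m (d + 1)"
  "map_mat const (minv C) * map_mat const C = 1\<^sub>m (d + 1)"
  using const.mat_hom_mult[OF C(1) C_inv(1)] const.mat_hom_mult[OF C_inv(1) C(1)] C_inv(2,3)
  by (simp_all add: const.mat_hom_one)

text \<open>
  The deformation enters through its coordinates only, and these are prescribed. The initial frame
  is left free, since the image of a framed deformation under a transformation is only lifted.
\<close>

lemma lifted_monodromy:
  assumes Pt: "lifted_deformation d n \<rho> P Pt" and B: "frame_basis d (frame_at Pt 1) B"
  shows "proj_eq_mat (monodromy Pt * B) (B * map_mat to_fract total)"
proof -
  have ng: "ngon d n Pt"
    and eq: "moduli_eq d n (cr d Pt) (scaled const \<rho> generic_t (\<lambda>i j. const (cr d P i j)))"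
    using Pt unfolding lifted_deformation_def by auto
  have "cr d Pt i j = to_fract (cr_poly d \<rho> P i j)" if i: "i \<in> {1..int n}" and j: "1 \<le> j" "j \<le> d + 1" for i j
  proof (cases "j = d + 1")
    case True
    obtain B' where "frame_basis d (frame_at Pt i) B'"
      using proj_frame_has_basis[OF ngon_proj_frame[OF ng]] by blast
    from ngon_coordinates(3)[OF ng this] show ?thesis
      unfolding True cr_poly_last by simp
  next
    case False
    then have "j \<in> {1..d}" using j by auto
    then show ?thesis using eq generic[OF i] i unfolding moduli_eq_def by simp
  qed
  then have "companion_prod d (cr d Pt) [1..int n] = map_mat to_fract total"
    unfolding total_def fract.map_companion_prod by (intro companion_prod_cong) auto
  then show ?thesis using monodromy_companion_prod[OF ng B] by simp
qed

lemma framed_monodromy: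
  assumes Pt: "framed_deformation d n \<rho> P Pt"
  shows "proj_eq_mat (monodromy Pt) (map_mat to_fract family)"
proof -
  have lifted: "lifted_deformation d n \<rho> P Pt"
    and fr: "\<And>m. m \<le> d + 1 \<Longrightarrow> proj_eq (vertex Pt (int m)) (map_vec const (vertex P (int m)))"
    using Pt unfolding framed_deformation_def by auto
  then have M: "monodromy Pt \<in> square_mats d"
    unfolding lifted_deformation_def ngon_def by auto
  let ?B = "map_mat const (minv C)"
  have B: "?B \<in> square_mats d" using C_inv(1) by simp
  have "frame_basis d (frame_at Pt 1) ?B"
    by (rule frame_basis_const[OF C(3)]) (use fr in simp)
  from lifted_monodromy[OF lifted this]
  have "proj_eq_mat (monodromy Pt * ?B * map_mat const C) (?B * map_mat to_fract total * map_mat const C)"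
    using C(1) C_inv(1) total_carrier by (intro proj_eq_mat_mult_right) auto
  also have "?B * map_mat to_fract total * map_mat const C = map_mat to_fract raw_family"
    unfolding fract_raw using C(1) C_inv(1) total_carrier by (simp add: mult_mat_assoc_dim)
  also have "monodromy Pt * ?B * map_mat const C = monodromy Pt"
    using M C(1) B const_C_inv(2) by (simp add: mult_mat_assoc_dim)
  finally show ?thesis using family_proj_eq_raw by (blast intro: proj_eq_mat_trans proj_eq_mat_sym)
qed

text \<open>
  The recursion is solved over \<open>F(t)\<close> for all integer indices, with the coordinates continued
  periodically. Periodicity makes the solution equivariant under the monodromy. The polynomial lifts
  come from the vertices \<open>1, \<dots>, n\<close>, which the recursion reaches from the constant initial frame by
  multiplication with polynomial matrices.
\<close>

lemma framed_deformation_exists: "\<exists>Pt. framed_deformation d n \<rho> P Pt"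
proof -
  let ?N = "d + 1"
  \<comment> \<open>the coordinates are only given for indices from 1 to \<open>n\<close>\<close>
  define per where "per i = (i - 1) mod int n + 1" for i
  have per: "per i \<in> {1..int n}" for i
    using n Euclidean_Rings.pos_mod_bound[of "int n" "i - 1"] Euclidean_Rings.pos_mod_sign[of "int n" "i - 1"]
    unfolding per_def atLeastAtMost_iff by linarith
  have per_shift: "per (i + int n) = per i" for i
  proof -
    have "(i + int n - 1) mod int n = (i - 1 + int n) mod int n" by (simp add: algebra_simps)
    then show ?thesis unfolding per_def by simp
  qed
  have per_id: "per i = i" if "i \<in> {1..int n}" for i
    using that by (simp add: per_def)
  define c where "c i j = to_fract (cr_poly d \<rho> P (per i) j)" for i j
  have c0: "c i j \<noteq> 0" if "1 \<le> j" "j \<le> ?N" for i j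
    using cr_nonzero[OF that, of "per i"] poly_cr_poly_1[of d \<rho> P "per i" j] by (auto simp: c_def)
  have c_last: "c i ?N = 1" for i unfolding c_def cr_poly_last by simp
  define L where "L i = companion d (c i)" for i
  have L: "L i \<in> square_mats d" "det (L i) \<noteq> 0" for i
    unfolding L_def by (rule companion_carrier, rule det_companion_nonzero, rule c0)
  have L_shift: "L (i + int n) = L i" for i unfolding L_def c_def per_shift ..
  define B1 where "B1 = map_mat const (minv C)"
  have B1: "B1 \<in> square_mats d" "det B1 \<noteq> 0"
    using C_inv(1,4) const.hom_det[of "minv C"] by (auto simp: B1_def)
  obtain Bs where Bs1: "Bs 1 = B1" and Bs': "\<forall>i. Bs i \<in> square_mats d \<and> det (Bs i) \<noteq> 0 \<and> Bs (i + 1) = Bs i * L i"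
    using int_recurrence[of L, OF L B1, of 1] by blast
  have Bs: "Bs i \<in> square_mats d" "det (Bs i) \<noteq> 0" "Bs (i + 1) = Bs i * L i" for i
    using Bs' by blast+
  have Bs_mult: "Bs (i + 1) *\<^sub>v w = Bs i *\<^sub>v (L i *\<^sub>v w)" if "w \<in> carrier_vec ?N" for i w
    unfolding Bs(3) using Bs(1)[of i] L(1)[of i] that by (simp add: mult_mat_vec_assoc_dim)
  define M where "M = map_mat to_fract raw_family"
  have M: "M \<in> square_mats d" using raw_carrier by (simp add: M_def)
  have Bs_upto: "Bs (int k + 1) = B1 * map_mat to_fract (companion_prod d (cr_poly d \<rho> P) [1..int k])"
    if "k \<le> n" for k
    using that
  proof (induction k)
    case 0
    then show ?case using B1 by (simp add: Bs1 fract.mat_hom_one)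
  next
    case (Suc k)
    define \<Theta> where "\<Theta> = companion_prod d (cr_poly d \<rho> P) [1..int k]"
    have \<Theta>: "\<Theta> \<in> square_mats d" unfolding \<Theta>_def by (rule companion_prod_carrier)
    have LK: "L (int k + 1) = map_mat to_fract (companion d (cr_poly d \<rho> P (int k + 1)))"
      using Suc.prems per_id[of "int k + 1"] unfolding L_def c_def fract.map_companion by simp
    have "companion_prod d (cr_poly d \<rho> P) [1..int (Suc k)] = \<Theta> * companion d (cr_poly d \<rho> P (int k + 1))"
      using companion_upto_snoc[of 1 "int k + 1"] by (simp add: \<Theta>_def add.commute)
    then have "map_mat to_fract (companion_prod d (cr_poly d \<rho> P) [1..int (Suc k)])
        = map_mat to_fract \<Theta> * L (int k + 1)"
      unfolding LK using fract.mat_hom_mult[OF \<Theta> companion_carrier] by simp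
    moreover have "Bs (int (Suc k) + 1) = B1 * map_mat to_fract \<Theta> * L (int k + 1)"
      using Suc Bs(3)[of "int k + 1"] unfolding \<Theta>_def by (simp add: add.commute)
    ultimately show ?case using B1(1) \<Theta> L(1)[of "int k + 1"] by (simp add: mult_mat_assoc_dim)
  qed
  have MB: "M * B1 = B1 * map_mat to_fract total"
    unfolding M_def fract_raw B1_def using C(1) C_inv(1) total_carrier const_C_inv(1)
    by (simp add: mult_mat_assoc_dim)
  have detM: "det M \<noteq> 0"
  proof -
    have "B1 * map_mat to_fract total = Bs (int n + 1)" unfolding total_def using Bs_upto[of n] by simp
    then have "det M * det B1 = det (Bs (int n + 1))" using det_mult[OF M B1(1)] MB by simp
    then show ?thesis using Bs(2)[of "int n + 1"] by auto
  qed
  have Bs_shift: "Bs (i + int n) = M * Bs i" for i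
  proof (induction i rule: int_induct[of _ 1])
    case base
    then show ?case using Bs_upto[of n] MB unfolding Bs1 total_def by (simp add: add.commute)
  next
    case (step1 i)
    have "Bs (i + 1 + int n) = Bs (i + int n) * L i"
      using Bs(3)[of "i + int n"] L_shift[of i] by (simp add: algebra_simps)
    then show ?case
      using step1(2) M Bs(1)[of i] L(1)[of i] by (simp add: Bs(3) mult_mat_assoc_dim)
  next
    case (step2 i)
    note inv = det_nonzero_minv[OF L, of "i - 1"]
    have "Bs (i - 1 + int n) * L (i - 1) = M * (Bs (i - 1) * L (i - 1))"
      using Bs(3)[of "i - 1 + int n"] L_shift[of "i - 1"] step2(2) Bs(3)[of "i - 1"]
      by (simp add: algebra_simps)
    then have "Bs (i - 1 + int n) * L (i - 1) * minv (L (i - 1)) = M * (Bs (i - 1) * L (i - 1)) * minv (L (i - 1))"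
      by simp
    then show ?case
      using inv(1,2) Bs(1)[of "i - 1 + int n"] Bs(1)[of "i - 1"] M L(1)[of "i - 1"]
      by (simp add: mult_mat_assoc_dim)
  qed
  define Pt where "Pt = Polygon (\<lambda>i. Bs i *\<^sub>v unit_vec ?N 0) M"
  have vert: "vertex Pt i = Bs i *\<^sub>v unit_vec ?N 0" for i by (simp add: Pt_def)
  have ahead: "proj_eq (vertex Pt (i + int j)) (Bs i *\<^sub>v unit_vec ?N j)" if "j \<le> d" for i j
    using that
  proof (induction j arbitrary: i)
    case (Suc j)
    have "proj_eq (vertex Pt (i + 1 + int j)) (Bs (i + 1) *\<^sub>v unit_vec ?N j)"
      using Suc by simp
    also have "Bs (i + 1) *\<^sub>v unit_vec ?N j = Bs i *\<^sub>v ((- c i (j + 2)) \<cdot>\<^sub>v unit_vec ?N (j + 1))"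
      unfolding Bs_mult[OF unit_vec_carrier] L_def using Suc.prems by (simp only: companion_mult_unit Suc_le_eq)
    also have "proj_eq \<dots> (Bs i *\<^sub>v unit_vec ?N (j + 1))"
      using Bs(1)[of i] c0[of "j + 2" i] Suc.prems by (intro proj_eq_mult_mat proj_eq_smult) auto
    finally show ?case by (simp add: algebra_simps)
  qed (simp add: vert)
  have last: "proj_eq (vertex Pt (i + int d + 1)) (Bs i *\<^sub>v vec ?N (\<lambda>r. c i (r + 1)))" for i
    using ahead[of d "i + 1"] unfolding Bs_mult[OF unit_vec_carrier] L_def companion_mult_last
    by (simp add: algebra_simps)
  have basis: "frame_basis d (frame_at Pt i) (Bs i)" for i
  proof -
    have "Bs i *\<^sub>v ones ?N = Bs (i - 1) *\<^sub>v (c (i - 1) 1 \<cdot>\<^sub>v unit_vec ?N 0)"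
      using Bs_mult[OF vec_carrier, of "i - 1" "\<lambda>_. 1"] unfolding L_def companion_mult_ones by simp
    moreover have "proj_eq (Bs (i - 1) *\<^sub>v unit_vec ?N 0) (Bs (i - 1) *\<^sub>v (c (i - 1) 1 \<cdot>\<^sub>v unit_vec ?N 0))"
      using Bs(1)[of "i - 1"] c0[of 1 "i - 1"] by (intro proj_eq_mult_mat proj_eq_sym[OF proj_eq_smult]) auto
    ultimately have "proj_eq (frame_at Pt i 0) (Bs i *\<^sub>v ones ?N)" by (simp add: vert)
    moreover have "proj_eq (frame_at Pt i (Suc j)) (Bs i *\<^sub>v unit_vec ?N j)" if "j < ?N" for j
      using ahead[of j i] that by (simp add: algebra_simps)
    ultimately show ?thesis using Bs(1,2)[of i] unfolding frame_basis_def by blast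
  qed
  have carr: "vertex Pt i \<in> carrier_vec ?N" for i using Bs(1)[of i] by (simp add: vert)
  have ng: "ngon d n Pt"
    unfolding ngon_def
  proof (intro conjI allI)
    show "monodromy Pt \<in> square_mats d" "det (monodromy Pt) \<noteq> 0"
      using M detM by (simp_all add: Pt_def)
    fix i
    show "proj_eq (vertex Pt (i + int n)) (monodromy Pt *\<^sub>v vertex Pt i)"
      using M Bs(1)[of i] unfolding vert Bs_shift by (simp add: Pt_def mult_mat_vec_assoc_dim)
    show "proj_frame d (\<lambda>m. vertex Pt (i + int m))"
      using frame_basis_imp_proj_frame[OF basis[of "i + 1"]] by simp
  qed
  have "moduli_eq d n (cr d Pt) (scaled const \<rho> generic_t (\<lambda>i j. const (cr d P i j)))"
    unfolding moduli_eq_def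
  proof (intro ballI)
    fix i j assume i: "i \<in> {1..int n}" and j: "j \<in> {1..d}"
    have "cr d Pt i j = vec ?N (\<lambda>r. c i (r + 1)) $ (j - 1) / vec ?N (\<lambda>r. c i (r + 1)) $ d"
      by (rule cr_eq[OF carr basis _ last]) (use j in auto)
    also have "\<dots> = c i j" using j c_last[of i] by (cases j) auto
    finally show "cr d Pt i j = scaled const \<rho> generic_t (\<lambda>i j. const (cr d P i j)) i j"
      using generic[OF i j] per_id[OF i] by (simp add: c_def)
  qed
  moreover have "specializes d Pt P"
    unfolding specializes_iff_lifts
  proof (intro conjI allI)
    have M_lift: "mat_lift raw_family (monodromy Pt) (monodromy P)"
      unfolding mat_lift_def using raw_at_one closed unfolding closed_polygon_def
      by (auto simp: Pt_def M_def intro: proj_eq_mat_trans proj_eq_mat_sym)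
    then show "\<exists>W\<in>square_mats d. mat_lift W (monodromy Pt) (monodromy P)"
      using raw_carrier by blast
    fix i
    show "\<exists>w\<in>carrier_vec ?N. vec_lift w (vertex Pt i) (vertex P i)"
    proof (rule vec_lift_periodic[where vQ = "vertex Pt" and vP = "vertex P" and a = 1,
          OF n ngon_periodic(3)[OF ng] carr ngon_periodic(3)[OF P] ngon_vertex_carrier[OF P]
            ngon_periodic(1,2)[OF P] raw_carrier M_lift])
      fix i :: int assume i: "1 \<le> i" "i < 1 + int n"
      define k where "k = nat (i - 1)"
      have k: "i = int k + 1" "k \<le> n" using i by (auto simp: k_def)
      define \<Theta> where "\<Theta> = companion_prod d (cr_poly d \<rho> P) [1..int k]"
      have \<Theta>: "\<Theta> \<in> square_mats d" unfolding \<Theta>_def by (rule companion_prod_carrier)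
      define W where "W = map_mat (\<lambda>a. [:a:]) (minv C) * \<Theta>"
      have cC: "map_mat (\<lambda>a. [:a:]) (minv C) \<in> square_mats d" using C_inv(1) by simp
      have W: "W \<in> square_mats d" using cC \<Theta> by (simp add: W_def)
      define w where "w = W *\<^sub>v unit_vec ?N 0"
      have "Bs i = map_mat to_fract W"
        unfolding W_def fract.mat_hom_mult[OF cC \<Theta>] map_const_eq using Bs_upto[OF k(2)]
        by (simp add: k(1) \<Theta>_def B1_def)
      then have "vertex Pt i = map_vec to_fract w"
        using W unfolding vert w_def by (simp add: fract.mult_mat_vec_hom[OF W] fract.map_vec_unit_vec)
      moreover have "map_mat at_one W = minv C * companion_prod d (cr d P) [1..int k]"
        unfolding W_def eval1.mat_hom_mult[OF cC \<Theta>] map_eval_constp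
        by (simp add: \<Theta>_def eval1.map_companion_prod poly_cr_poly_1)
      then have "frame_basis d (frame_at P i) (map_mat at_one W)"
        using ngon_frame_prod[OF P C(3), of "int k"] by (simp add: k(1))
      from frame_basisD(4)[OF this, of 0]
      have "proj_eq (vertex P i) (map_vec at_one w)"
        unfolding w_def eval1.mult_mat_vec_hom[OF W unit_vec_carrier] eval1.map_vec_unit_vec by simp
      ultimately show "\<exists>w\<in>carrier_vec ?N. vec_lift w (vertex Pt i) (vertex P i)"
        using W by (intro bexI[of _ w]) (auto simp: vec_lift_def w_def)
    qed
  qed
  ultimately have "lifted_deformation d n \<rho> P Pt"
    unfolding lifted_deformation_def using ng by blast
  moreover have "proj_eq (vertex Pt (int m)) (map_vec const (vertex P (int m)))" if m: "m \<le> ?N" for m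
  proof -
    have "frame_basis d (\<lambda>m. map_vec const (frame_at P 1 m)) B1"
      unfolding B1_def by (rule frame_basis_const[OF C(3)]) simp
    note b = frame_basisD[OF this] and b' = frame_basisD[OF basis[of 1], unfolded Bs1]
    show ?thesis
    proof (cases m)
      case 0
      then show ?thesis using b(3) b'(3) by (auto intro: proj_eq_trans proj_eq_sym)
    next
      case (Suc j)
      then show ?thesis using b(4)[of j] b'(4)[of j] m by (auto intro: proj_eq_trans proj_eq_sym)
    qed
  qed
  ultimately show ?thesis unfolding framed_deformation_def by blast
qed

section \<open>The operators as matrices\<close>

definition Delta :: "int \<Rightarrow> 'a mat" where
  "Delta i = mat (d + 1) (d + 1) (\<lambda>(r, s). if r = s then cr_deriv d \<rho> P i (r + 1) / cr d P i (r + 1) else 0)"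

definition S_mat :: "int \<Rightarrow> 'a mat" where
  "S_mat i = mat (d + 1) (d + 1) (\<lambda>(r, s). S_op d \<rho> P i (unit_vec (d + 1) s) $ r)"

lemma Delta_carrier: "Delta i \<in> square_mats d"
  unfolding Delta_def by (rule mat_carrier)

lemma S_mat_carrier: "S_mat i \<in> square_mats d"
  unfolding S_mat_def by (rule mat_carrier)

text \<open>
  By Cramer's rule the quotient of determinants is the coordinate of \<open>v\<close> with respect to the lifts
  \<open>p\<^sub>i, \<dots>, p\<^sub>i\<^sub>+\<^sub>d\<close>. Hence \<open>S\<^sub>i\<close> is diagonal in every basis of lifts of these points, and rescaling the
  lifts does not change it.
\<close>

lemma S_op_eq:
  assumes B: "frame_basis d (frame_at P i) B" and v: "v \<in> carrier_vec (d + 1)"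
  shows "S_op d \<rho> P i v = (B * (Delta i * minv B)) *\<^sub>v v"
proof -
  let ?N = "d + 1"
  note b = frame_basisD[OF B]
  note inv = det_nonzero_minv[OF b(1,2)]
  define q where "q = map (\<lambda>l. vertex P (i + int l)) [0..<?N]"
  define Q where "Q = mat_of_cols ?N q"
  have lenq: "length q = ?N" by (simp add: q_def)
  have qnth: "q ! l = vertex P (i + int l)" if "l < ?N" for l
    using that by (simp add: q_def del: upt_Suc)
  have Q: "Q \<in> square_mats d" unfolding Q_def using mat_of_cols_carrier(1)[of ?N q] lenq by simp
  have "\<exists>s. s \<noteq> 0 \<and> vertex P (i + int l) = s \<cdot>\<^sub>v (B *\<^sub>v unit_vec ?N l)" if "l < ?N" for l
    using b(4)[OF that] by (auto simp: proj_eq_def algebra_simps)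
  then obtain s where s: "\<And>l. l < ?N \<Longrightarrow> s l \<noteq> 0"
    "\<And>l. l < ?N \<Longrightarrow> vertex P (i + int l) = s l \<cdot>\<^sub>v (B *\<^sub>v unit_vec ?N l)" by metis
  have colB: "B *\<^sub>v unit_vec ?N l = col B l" if "l < ?N" for l
    using mult_unit_vec_eq_col[of l B] b(1) that by simp
  have vertr: "vertex P (i + int l) $ r = s l * B $$ (r, l)" if "l < ?N" "r < ?N" for l r
    unfolding s(2)[OF that(1)] colB[OF that(1)] using that b(1) by simp
  have Qrl: "Q $$ (r, l) = s l * B $$ (r, l)" if "l < ?N" "r < ?N" for l r
    unfolding Q_def using that lenq vertr[OF that] qnth[OF that(1)] by (simp add: mat_of_cols_index)
  have colQ: "col Q l = s l \<cdot>\<^sub>v col B l" if "l < ?N" for l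
    using that Q b(1) Qrl by (intro eq_vecI) auto
  have detQ: "det Q \<noteq> 0"
    unfolding det_nonzero_iff_left_kernel[OF Q]
  proof (intro ballI impI)
    fix z :: "'a vec" assume z: "z \<in> carrier_vec ?N" and 0: "\<forall>l<?N. z \<bullet> col Q l = 0"
    have "z \<bullet> col B l = 0" if l: "l < ?N" for l
    proof -
      have "col B l \<in> carrier_vec ?N" using b(1) l by auto
      then have "s l * (z \<bullet> col B l) = z \<bullet> col Q l"
        unfolding colQ[OF l] using z by simp
      then show ?thesis using 0 l s(1)[OF l] by simp
    qed
    then show "z = 0\<^sub>v ?N" using b(2) z unfolding det_nonzero_iff_left_kernel[OF b(1)] by blast
  qed
  define y where "y = minv B *\<^sub>v v"
  have y: "y \<in> carrier_vec ?N" using inv(1) v by (simp add: y_def)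
  have By: "B *\<^sub>v y = v" unfolding y_def using b(1) inv(1,2) v by (simp flip: mult_mat_vec_assoc_dim)
  define x where "x = vec ?N (\<lambda>l. y $ l / s l)"
  have x: "x \<in> carrier_vec ?N" by (simp add: x_def)
  have Qx: "Q *\<^sub>v x = v"
    unfolding By[symmetric]
  proof (rule eq_vecI)
    fix r assume "r < dim_vec (B *\<^sub>v y)"
    then have r: "r < ?N" using b(1) by simp
    have "(Q *\<^sub>v x) $ r = (\<Sum>l = 0..<?N. Q $$ (r, l) * x $ l)"
      using Q r x by (simp add: scalar_prod_def)
    also have "\<dots> = (\<Sum>l = 0..<?N. B $$ (r, l) * y $ l)"
      using Qrl r s(1) by (intro sum.cong) (auto simp: x_def)
    also have "\<dots> = (B *\<^sub>v y) $ r" using b(1) r y by (simp add: scalar_prod_def)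
    finally show "(Q *\<^sub>v x) $ r = (B *\<^sub>v y) $ r" .
  qed (use Q b(1) in auto)
  have cramer: "det (mat_of_cols ?N (q[j := v])) / det Q = y $ j / s j" if j: "j < ?N" for j
  proof -
    have "mat_of_cols ?N (q[j := v]) = replace_col Q v j"
      unfolding replace_col_def Q_def using lenq j v
      by (intro eq_matI) (auto simp: mat_of_cols_index nth_list_update)
    then have "det (mat_of_cols ?N (q[j := v])) = x $ j * det Q"
      using cramer_lemma_mat[OF Q x j] unfolding Qx by simp
    then show ?thesis using detQ j by (simp add: x_def)
  qed
  have "S_op d \<rho> P i v = finsum_vec TYPE('a) ?N
      (\<lambda>j. (cr_deriv d \<rho> P i (j + 1) / cr d P i (j + 1) * (det (mat_of_cols ?N (q[j := v])) / det Q))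
        \<cdot>\<^sub>v vertex P (i + int j)) {0..d}" (is "_ = finsum_vec _ _ ?f _")
    unfolding S_op_def Let_def q_def[symmetric] Q_def ..
  moreover have f: "?f \<in> {0..d} \<rightarrow> carrier_vec ?N" using ngon_vertex_carrier[OF P] by auto
  moreover have "finsum_vec TYPE('a) ?N ?f {0..d} = B *\<^sub>v (Delta i *\<^sub>v y)"
  proof (rule eq_vecI)
    show "dim_vec (finsum_vec TYPE('a) ?N ?f {0..d}) = dim_vec (B *\<^sub>v (Delta i *\<^sub>v y))"
      using finsum_vec_closed[OF f] b(1) by simp
    fix r assume "r < dim_vec (B *\<^sub>v (Delta i *\<^sub>v y))"
    then have r: "r < ?N" using b(1) by simp
    have Dy: "(Delta i *\<^sub>v y) $ l = cr_deriv d \<rho> P i (l + 1) / cr d P i (l + 1) * y $ l" if l: "l < ?N" for l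
    proof -
      have "(Delta i *\<^sub>v y) $ l = (\<Sum>m = 0..<?N. (if l = m then cr_deriv d \<rho> P i (l + 1) / cr d P i (l + 1) else 0) * y $ m)"
        using l y by (simp add: Delta_def scalar_prod_def del: sum.op_ivl_Suc)
      also have "\<dots> = (\<Sum>m = 0..<?N. if m = l then cr_deriv d \<rho> P i (l + 1) / cr d P i (l + 1) * y $ l else 0)"
        by (intro sum.cong) auto
      finally show ?thesis using l by (simp del: sum.op_ivl_Suc)
    qed
    have "finsum_vec TYPE('a) ?N ?f {0..d} $ r = (\<Sum>j\<in>{0..d}. ?f j $ r)"
      by (rule index_finsum_vec[OF _ r f]) simp
    also have "\<dots> = (\<Sum>j = 0..<?N. B $$ (r, j) * (Delta i *\<^sub>v y) $ j)"
    proof (rule sum.cong)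
      fix j assume "j \<in> {0..<?N}"
      then have j: "j < ?N" by simp
      have "vertex P (i + int j) \<in> carrier_vec ?N" by (rule ngon_vertex_carrier[OF P])
      then have "?f j $ r = cr_deriv d \<rho> P i (j + 1) / cr d P i (j + 1) * (y $ j / s j) * (s j * B $$ (r, j))"
        unfolding cramer[OF j] using r vertr[OF j r] by simp
      then show "?f j $ r = B $$ (r, j) * (Delta i *\<^sub>v y) $ j"
        unfolding Dy[OF j] using s(1)[OF j] by simp
    qed auto
    also have "\<dots> = (B *\<^sub>v (Delta i *\<^sub>v y)) $ r"
      using b(1) r Delta_carrier[of i] by (simp add: scalar_prod_def)
    finally show "finsum_vec TYPE('a) ?N ?f {0..d} $ r = (B *\<^sub>v (Delta i *\<^sub>v y)) $ r" .
  qed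
  ultimately show ?thesis
    unfolding y_def using b(1) inv(1) Delta_carrier[of i] v by (simp add: mult_mat_vec_assoc_dim)
qed

lemma S_mat_eq:
  assumes B: "frame_basis d (frame_at P i) B"
  shows "S_mat i = B * (Delta i * minv B)"
proof (rule eq_mat_unit_vecI[OF S_mat_carrier])
  note b = frame_basisD[OF B]
  note inv = det_nonzero_minv[OF b(1,2)]
  show c: "B * (Delta i * minv B) \<in> square_mats d"
    using b(1) inv(1) Delta_carrier[of i] by auto
  fix j assume j: "j < d + 1"
  have "S_mat i *\<^sub>v unit_vec (d + 1) j = col (S_mat i) j"
    using mult_unit_vec_eq_col[of j "S_mat i"] S_mat_carrier[of i] j by simp
  also have "\<dots> = S_op d \<rho> P i (unit_vec (d + 1) j)"
    using j b(1) S_op_eq[OF B unit_vec_carrier, of j] by (intro eq_vecI) (auto simp: S_mat_def)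
  also have "\<dots> = (B * (Delta i * minv B)) *\<^sub>v unit_vec (d + 1) j"
    by (rule S_op_eq[OF B unit_vec_carrier])
  finally show "S_mat i *\<^sub>v unit_vec (d + 1) j = (B * (Delta i * minv B)) *\<^sub>v unit_vec (d + 1) j" .
qed

lemma S_op_S_mat: "v \<in> carrier_vec (d + 1) \<Longrightarrow> S_op d \<rho> P i v = S_mat i *\<^sub>v v"
  using S_op_eq S_mat_eq basis_at[of i] by metis

section \<open>Factorization of the monodromy\<close>

abbreviation tau :: "'a poly" where "tau \<equiv> [:-1, 1:]"
abbreviation pc :: "'a mat \<Rightarrow> 'a poly mat" where "pc \<equiv> map_mat (\<lambda>a. [:a:])"

definition factor :: "int \<Rightarrow> 'a poly mat" where
  "factor i = 1\<^sub>m (d + 1) + tau \<cdot>\<^sub>m pc (S_mat i)"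

lemma factor_carrier: "factor i \<in> square_mats d"
  using S_mat_carrier[of i] unfolding factor_def by simp

lemma factor_mult:
  assumes X: "X \<in> carrier_mat (d + 1) m"
  shows "factor i * X = X + tau \<cdot>\<^sub>m (pc (S_mat i) * X)"
proof -
  have S: "pc (S_mat i) \<in> square_mats d" using S_mat_carrier[of i] by simp
  have "factor i * X = 1\<^sub>m (d + 1) * X + (tau \<cdot>\<^sub>m pc (S_mat i)) * X"
    unfolding factor_def using S X by (intro add_mult_distrib_mat) auto
  then show ?thesis using S X by (simp add: smult_mat_mult_dim)
qed

text \<open>Row \<open>r\<close> of the companion matrix is a multiple of the coordinate \<open>c\<^sub>i\<^sub>,\<^sub>r\<^sub>+\<^sub>1\<close>, which is linear in \<open>t\<close>.\<close>

lemma companion_cr_poly: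
  "companion d (cr_poly d \<rho> P i)
    = pc (companion d (cr d P i)) + tau \<cdot>\<^sub>m pc (Delta i * companion d (cr d P i))"
proof (rule eq_matI)
  let ?K = "companion d (cr d P i)"
  show "dim_row (companion d (cr_poly d \<rho> P i)) = dim_row (pc ?K + tau \<cdot>\<^sub>m pc (Delta i * ?K))"
    "dim_col (companion d (cr_poly d \<rho> P i)) = dim_col (pc ?K + tau \<cdot>\<^sub>m pc (Delta i * ?K))"
    using Delta_carrier[of i] by auto
  fix r s assume "r < dim_row (pc ?K + tau \<cdot>\<^sub>m pc (Delta i * ?K))" "s < dim_col (pc ?K + tau \<cdot>\<^sub>m pc (Delta i * ?K))"
  then have rs: "r < d + 1" "s < d + 1" using Delta_carrier[of i] by auto
  define \<delta> where "\<delta> = cr_deriv d \<rho> P i (r + 1) / cr d P i (r + 1)"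
  have "(Delta i * ?K) $$ (r, s) = (\<Sum>m = 0..<d + 1. (if r = m then \<delta> else 0) * ?K $$ (m, s))"
    unfolding \<delta>_def using rs by (simp add: Delta_def scalar_prod_def del: sum.op_ivl_Suc)
  also have "\<dots> = (\<Sum>m = 0..<d + 1. if m = r then \<delta> * ?K $$ (r, s) else 0)"
    by (intro sum.cong) auto
  also have "\<dots> = \<delta> * ?K $$ (r, s)" using rs by (simp del: sum.op_ivl_Suc)
  finally have "(pc ?K + tau \<cdot>\<^sub>m pc (Delta i * ?K)) $$ (r, s)
      = [:?K $$ (r, s):] + tau * [:\<delta> * ?K $$ (r, s):]"
    using rs Delta_carrier[of i] by simp
  moreover have "cr_poly d \<rho> P i (r + 1) = [:cr d P i (r + 1):] + tau * [:\<delta> * cr d P i (r + 1):]"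
    using cr_nonzero[of "r + 1" i] rs by (simp add: cr_poly_def \<delta>_def)
  \<comment> \<open>the three cases of the definition differ by a factor that does not depend on the coordinates\<close>
  moreover define \<epsilon> where "\<epsilon> = (if s = d then 1 else if r = s + 1 then - 1 else 0 :: 'a)"
  have "?K $$ (r, s) = \<epsilon> * cr d P i (r + 1)"
    "companion d (cr_poly d \<rho> P i) $$ (r, s) = [:\<epsilon>:] * cr_poly d \<rho> P i (r + 1)"
    unfolding \<epsilon>_def using rs by (simp_all add: companion_def)
  ultimately show "companion d (cr_poly d \<rho> P i) $$ (r, s) = (pc ?K + tau \<cdot>\<^sub>m pc (Delta i * ?K)) $$ (r, s)"
    by (simp add: algebra_simps)
qed

text \<open>
  The basis turns the diagonal factor into \<open>1 + (t - 1) S\<^sub>i\<close>, and behind this factor it continues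
  as the basis of the next frame. Repeating this moves all factors to the front.
\<close>

lemma basis_mult_companion:
  assumes B: "frame_basis d (frame_at P i) B"
  shows "pc B * companion d (cr_poly d \<rho> P i) = factor i * pc (B * companion d (cr d P i))"
proof -
  let ?K = "companion d (cr d P i)" and ?N = "d + 1"
  note b = frame_basisD[OF B]
  note inv = det_nonzero_minv[OF b(1,2)]
  have K: "?K \<in> square_mats d" by (rule companion_carrier)
  have DK: "Delta i * ?K \<in> square_mats d" using Delta_carrier[of i] K by (rule mult_carrier_mat)
  have BK: "B * ?K \<in> square_mats d" using b(1) K by (rule mult_carrier_mat)
  have "S_mat i * (B * ?K) = B * (Delta i * ?K)"
  proof -
    have "minv B * (B * ?K) = ?K"
      unfolding assoc_mult_mat[OF inv(1) b(1) K, symmetric] inv(3) using K by simp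
    moreover have "S_mat i * (B * ?K) = B * (Delta i * (minv B * (B * ?K)))"
      unfolding S_mat_eq[OF B] using b(1) inv(1) Delta_carrier[of i] K by (simp add: mult_mat_assoc_dim)
    ultimately show ?thesis by simp
  qed
  then have "pc (S_mat i) * pc (B * ?K) = pc B * pc (Delta i * ?K)"
    by (simp only: constp.mat_hom_mult[OF S_mat_carrier BK, symmetric] constp.mat_hom_mult[OF b(1) DK, symmetric])
  moreover have "pc B * companion d (cr_poly d \<rho> P i) = pc B * pc ?K + pc B * (tau \<cdot>\<^sub>m pc (Delta i * ?K))"
    unfolding companion_cr_poly using b(1) K DK by (intro mult_add_distrib_mat) auto
  moreover have "pc B * (tau \<cdot>\<^sub>m pc (Delta i * ?K)) = tau \<cdot>\<^sub>m (pc B * pc (Delta i * ?K))"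
    using b(1) DK by (intro mult_mat_smult_dim) auto
  moreover have "factor i * pc (B * ?K) = pc (B * ?K) + tau \<cdot>\<^sub>m (pc (S_mat i) * pc (B * ?K))"
    using BK by (intro factor_mult[of _ ?N]) auto
  ultimately show ?thesis using constp.mat_hom_mult[OF b(1) K] by simp
qed

definition factors :: "int list \<Rightarrow> 'a poly mat" where
  "factors is = foldr (\<lambda>i X. factor i * X) is (1\<^sub>m (d + 1))"

lemma factors_simps: "factors [] = 1\<^sub>m (d + 1)" "factors (i # is) = factor i * factors is"
  by (simp_all add: factors_def)

lemma factors_carrier: "factors is \<in> square_mats d"
  by (induction "is") (simp_all only: factors_simps one_carrier_mat mult_carrier_mat[OF factor_carrier])

lemma basis_mult_companion_prod:
  "frame_basis d (frame_at P i) B \<Longrightarrow> i \<le> j + 1 \<Longrightarrow>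
    pc B * companion_prod d (cr_poly d \<rho> P) [i..j] = factors [i..j] * pc (B * companion_prod d (cr d P) [i..j])"
proof (induction "nat (j + 1 - i)" arbitrary: i B)
  case 0
  then have i: "i = j + 1" by simp
  have "pc B \<in> square_mats d" using frame_basisD(1)[OF 0(2)] by simp
  then show ?case using frame_basisD(1)[OF 0(2)] unfolding i by (simp add: factors_simps)
next
  case (Suc k)
  then have i: "i \<le> j" and k: "k = nat (j + 1 - (i + 1))" by auto
  let ?N = "d + 1" and ?K = "companion d (cr d P i)"
  let ?R = "companion_prod d (cr d P) [i + 1..j]" and ?Rp = "companion_prod d (cr_poly d \<rho> P) [i + 1..j]"
  note b = frame_basisD[OF Suc.prems(1)]
  have R: "?R \<in> square_mats d" "?Rp \<in> square_mats d" by (rule companion_prod_carrier)+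
  have K: "?K \<in> square_mats d" "companion d (cr_poly d \<rho> P i) \<in> square_mats d"
    by (rule companion_carrier)+
  have BK: "B * ?K \<in> square_mats d" using b(1) K(1) by (rule mult_carrier_mat)
  have "pc B * companion_prod d (cr_poly d \<rho> P) [i..j] = pc B * companion d (cr_poly d \<rho> P i) * ?Rp"
    using upto_rec1[OF i] b(1) K(2) R(2) by (simp add: mult_mat_assoc_dim)
  also have "\<dots> = factor i * (pc (B * ?K) * ?Rp)"
    unfolding basis_mult_companion[OF Suc.prems(1)] using factor_carrier[of i] BK R(2)
    by (simp add: mult_mat_assoc_dim)
  also have "pc (B * ?K) * ?Rp = factors [i + 1..j] * pc (B * ?K * ?R)"
    using Suc.hyps(1)[OF k ngon_frame_step[OF P Suc.prems(1)]] i by simp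
  also have "B * ?K * ?R = B * companion_prod d (cr d P) [i..j]"
    using upto_rec1[OF i] b(1) K(1) R(1) by (simp add: mult_mat_assoc_dim)
  also have "factor i * (factors [i + 1..j] * pc (B * companion_prod d (cr d P) [i..j]))
      = factors [i..j] * pc (B * companion_prod d (cr d P) [i..j])"
    using upto_rec1[OF i] factor_carrier[of i] factors_carrier[of "[i + 1..j]"] b(1)
    by (simp add: factors_simps mult_mat_assoc_dim)
  finally show ?case .
qed

lemma factors_at_one: "map_mat at_one (factors is) = 1\<^sub>m (d + 1)"
proof (induction "is")
  case (Cons i "is")
  have "map_mat at_one (factor i) = 1\<^sub>m (d + 1)"
    by (rule eq_matI) (use S_mat_carrier[of i] in \<open>auto simp: factor_def\<close>)
  then show ?case
    using Cons eval1.mat_hom_mult[OF factor_carrier factors_carrier, of i "is"] by (simp add: factors_simps)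
qed (simp add: factors_simps eval1.mat_hom_one)

text \<open>
  The constant matrix left behind the factors is the value at \<open>t = 1\<close>. It is scalar, and the
  normalization removes it.
\<close>

lemma family_eq_factors: "family = factors [1..int n]"
proof -
  let ?N = "d + 1" and ?\<Theta> = "companion_prod d (cr d P) [1..int n]" and ?F = "factors [1..int n]"
  have \<Theta>: "?\<Theta> \<in> square_mats d" by (rule companion_prod_carrier)
  note F = factors_carrier[of "[1..int n]"]
  have "raw_family = ?F * pc (minv C * ?\<Theta>) * pc C"
    unfolding raw_eq total_def using basis_mult_companion_prod[OF C(3), of "int n"] by simp
  also have "\<dots> = ?F * (pc (minv C * ?\<Theta>) * pc C)"
    using F C(1) C_inv(1) by (simp add: mult_mat_assoc_dim)
  also have "pc (minv C * ?\<Theta>) * pc C = pc (minv C * ?\<Theta> * C)"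
    using constp.mat_hom_mult[of "minv C * ?\<Theta>" ?N ?N C ?N] C(1) mult_carrier_mat[OF C_inv(1) \<Theta>] by simp
  finally have raw: "raw_family = ?F * pc (minv C * ?\<Theta> * C)" .
  have X: "minv C * ?\<Theta> * C \<in> square_mats d"
    by (rule mult_carrier_mat[OF mult_carrier_mat[OF C_inv(1) \<Theta>] C(1)])
  then have pcX: "pc (minv C * ?\<Theta> * C) \<in> square_mats d" by simp
  have "map_mat at_one raw_family = minv C * ?\<Theta> * C"
    unfolding raw eval1.mat_hom_mult[OF F pcX] factors_at_one map_eval_constp
    by (rule left_mult_one_mat[OF X])
  then obtain s where s: "minv C * ?\<Theta> * C = s \<cdot>\<^sub>m 1\<^sub>m ?N" using raw_at_one by (auto simp: proj_eq_mat_def)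
  have "pc (s \<cdot>\<^sub>m 1\<^sub>m ?N) = [:s:] \<cdot>\<^sub>m 1\<^sub>m ?N" by (rule eq_matI) auto
  then have "raw_family = [:s:] \<cdot>\<^sub>m ?F"
    unfolding raw s using F by (simp add: mult_mat_smult_dim)
  then obtain c where c: "family = [:c:] \<cdot>\<^sub>m ?F"
    using family_proj_eq by (auto simp: smult_mat_smult)
  have "1 = map_mat at_one family $$ (0, 0)"
    unfolding family_at_one by simp
  also have "\<dots> = c * map_mat at_one ?F $$ (0, 0)" unfolding c using F by simp
  also have "\<dots> = c" unfolding factors_at_one by simp
  finally have "[:c:] = 1" by simp
  then show ?thesis using c by (simp add: one_smult_mat)
qed

section \<open>Taylor coefficients\<close>

lemma taylor_factor_mult:
  assumes X: "X \<in> square_mats d" and rs: "r < d + 1" "s < d + 1"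
  shows "taylor_at_one 0 (factor i * X) $$ (r, s) = taylor_at_one 0 X $$ (r, s)"
    and "taylor_at_one (Suc k) (factor i * X) $$ (r, s)
      = taylor_at_one (Suc k) X $$ (r, s) + (S_mat i * taylor_at_one k X) $$ (r, s)"
proof -
  have S: "pc (S_mat i) \<in> square_mats d" using S_mat_carrier[of i] by simp
  define g where "g = (pc (S_mat i) * X) $$ (r, s)"
  have e: "(factor i * X) $$ (r, s) = X $$ (r, s) + tau * g"
    unfolding factor_mult[OF X] g_def using X S rs by simp
  have carr: "factor i * X \<in> square_mats d" using factor_carrier X by (rule mult_carrier_mat)
  have tau: "pcompose tau [:1, 1:] = [:0, 1 :: 'a:]"
    by (simp only: pcompose_pCons pcompose_0 mult_zero_right add_0_right) simp
  have comp: "pcompose ((factor i * X) $$ (r, s)) [:1, 1:]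
      = pcompose (X $$ (r, s)) [:1, 1:] + pCons 0 (pcompose g [:1, 1:])"
    unfolding e pcompose_add pcompose_mult tau by simp
  have t: "taylor_at_one m Y $$ (r, s) = Polynomial.coeff (pcompose (Y $$ (r, s)) [:1, 1:]) m"
    if "Y \<in> square_mats d" for Y m
    using that rs by (simp add: taylor_at_one_def)
  show "taylor_at_one 0 (factor i * X) $$ (r, s) = taylor_at_one 0 X $$ (r, s)"
    unfolding t[OF carr] t[OF X] comp by simp
  have "g = (\<Sum>l = 0..<d + 1. [:S_mat i $$ (r, l):] * X $$ (l, s))"
    unfolding g_def using X S_mat_carrier[of i] rs by (simp add: scalar_prod_def)
  then have "Polynomial.coeff (pcompose g [:1, 1:]) k
      = (\<Sum>l = 0..<d + 1. S_mat i $$ (r, l) * Polynomial.coeff (pcompose (X $$ (l, s)) [:1, 1:]) k)"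
    by (simp only: pcompose_sum pcompose_mult pcompose_const coeff_sum) simp
  also have "\<dots> = (S_mat i * taylor_at_one k X) $$ (r, s)"
    using X S_mat_carrier[of i] rs by (simp add: scalar_prod_def taylor_at_one_def)
  finally show "taylor_at_one (Suc k) (factor i * X) $$ (r, s)
      = taylor_at_one (Suc k) X $$ (r, s) + (S_mat i * taylor_at_one k X) $$ (r, s)"
    unfolding t[OF carr] t[OF X] comp by simp
qed

definition S_prod :: "int list \<Rightarrow> 'a mat" where
  "S_prod is = foldr (\<lambda>i X. S_mat i * X) is (1\<^sub>m (d + 1))"

lemma S_prod_simps: "S_prod [] = 1\<^sub>m (d + 1)" "S_prod (i # is) = S_mat i * S_prod is"
  by (simp_all add: S_prod_def)

lemma S_prod_carrier: "S_prod is \<in> square_mats d"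
  by (induction "is") (simp_all only: S_prod_simps one_carrier_mat mult_carrier_mat[OF S_mat_carrier])

lemma S_op_prod:
  "v \<in> carrier_vec (d + 1) \<Longrightarrow> foldr (\<lambda>i f. S_op d \<rho> P i \<circ> f) is id v = S_prod is *\<^sub>v v"
proof (induction "is")
  case (Cons i "is")
  have "S_prod is *\<^sub>v v \<in> carrier_vec (d + 1)"
    by (rule mult_mat_vec_carrier[OF S_prod_carrier Cons.prems])
  then show ?case
    using Cons S_mat_carrier[of i] S_prod_carrier[of "is"] 
    by (simp add: S_op_S_mat S_prod_simps mult_mat_vec_assoc_dim)
qed (simp add: S_prod_simps)

definition chains :: "nat \<Rightarrow> int \<Rightarrow> int \<Rightarrow> int list set" where
  "chains k i j = {is. length is = k \<and> sorted_wrt (<) is \<and> set is \<subseteq> {i..j}}"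

lemma finite_chains: "finite (chains k i j)"
  by (rule finite_subset[OF _ finite_lists_length_eq[of "{i..j}" k]]) (auto simp: chains_def)

lemma chains_0: "chains 0 i j = {[]}"
  by (auto simp: chains_def)

text \<open>An increasing list either starts with \<open>i\<close> or avoids it.\<close>

lemma chains_Suc:
  assumes "i \<le> j"
  shows "chains (Suc k) i j = chains (Suc k) (i + 1) j \<union> (#) i ` chains k (i + 1) j"
    and "chains (Suc k) (i + 1) j \<inter> (#) i ` chains k (i + 1) j = {}"
proof -
  show "chains (Suc k) i j = chains (Suc k) (i + 1) j \<union> (#) i ` chains k (i + 1) j"
  proof (intro equalityI subsetI)
    fix xs assume xs: "xs \<in> chains (Suc k) i j"
    then obtain x ys where [simp]: "xs = x # ys" by (cases xs) (auto simp: chains_def)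
    show "xs \<in> chains (Suc k) (i + 1) j \<union> (#) i ` chains k (i + 1) j"
    proof (cases "x = i")
      case True
      then have "ys \<in> chains k (i + 1) j" using xs by (fastforce simp: chains_def)
      then show ?thesis using True by simp
    next
      case False
      then have "xs \<in> chains (Suc k) (i + 1) j" using xs by (fastforce simp: chains_def)
      then show ?thesis by simp
    qed
  next
    fix xs assume "xs \<in> chains (Suc k) (i + 1) j \<union> (#) i ` chains k (i + 1) j"
    then show "xs \<in> chains (Suc k) i j" using assms by (fastforce simp: chains_def)
  qed
  show "chains (Suc k) (i + 1) j \<inter> (#) i ` chains k (i + 1) j = {}"
    by (auto simp: chains_def)
qed

text \<open>
  Expanding the first factor of the product matches the case distinction on whether an increasing
  list of indices starts with the first index.
\<close>

lemma taylor_factors: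
  assumes rs: "r < d + 1" "s < d + 1"
  shows "i \<le> j + 1 \<Longrightarrow> taylor_at_one k (factors [i..j]) $$ (r, s) = (\<Sum>is\<in>chains k i j. S_prod is $$ (r, s))"
  using rs
proof (induction "nat (j + 1 - i)" arbitrary: i k r s)
  case 0
  then have i: "i = j + 1" by simp
  have one: "pcompose (1\<^sub>m (d + 1) $$ (r, s)) [:1, 1:] = (if r = s then 1 else 0 :: 'a poly)"
    using 0 by (simp add: pcompose_1)
  have "chains k i j = (if k = 0 then {[]} else {})" unfolding i by (auto simp: chains_def)
  then show ?case
    using 0 one unfolding i by (simp add: factors_simps S_prod_simps taylor_at_one_def coeff_1)
next
  case (Suc m)
  then have i: "i \<le> j" and m: "m = nat (j + 1 - (i + 1))" by auto
  have IH: "taylor_at_one k (factors [i + 1..j]) $$ (r, s) = (\<Sum>is\<in>chains k (i + 1) j. S_prod is $$ (r, s))"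
    if "r < d + 1" "s < d + 1" for k r s
    using Suc.hyps(1)[OF m] i that by simp
  have F: "factors [i..j] = factor i * factors [i + 1..j]"
    using upto_rec1[OF i] by (simp add: factors_simps)
  note T = taylor_factor_mult[OF factors_carrier Suc.prems(2,3)]
  show ?case
  proof (cases k)
    case 0
    then show ?thesis unfolding F using T(1) IH[OF Suc.prems(2,3), of 0] by (simp add: chains_0)
  next
    case (Suc l)
    have Tl: "taylor_at_one l (factors [i + 1..j]) \<in> square_mats d"
      using factors_carrier[of "[i + 1..j]"] by (simp add: taylor_at_one_def)
    have "(S_mat i * taylor_at_one l (factors [i + 1..j])) $$ (r, s)
        = (\<Sum>a = 0..<d + 1. S_mat i $$ (r, a) * taylor_at_one l (factors [i + 1..j]) $$ (a, s))"
      using Tl S_mat_carrier[of i] Suc.prems by (simp add: scalar_prod_def)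
    also have "\<dots> = (\<Sum>a = 0..<d + 1. \<Sum>is\<in>chains l (i + 1) j. S_mat i $$ (r, a) * S_prod is $$ (a, s))"
      using IH Suc.prems by (intro sum.cong) (auto simp: sum_distrib_left)
    also have "\<dots> = (\<Sum>is\<in>chains l (i + 1) j. \<Sum>a = 0..<d + 1. S_mat i $$ (r, a) * S_prod is $$ (a, s))"
      by (rule sum.swap)
    also have "\<dots> = (\<Sum>is\<in>chains l (i + 1) j. S_prod (i # is) $$ (r, s))"
    proof (intro sum.cong refl)
      fix "is"
      show "(\<Sum>a = 0..<d + 1. S_mat i $$ (r, a) * S_prod is $$ (a, s)) = S_prod (i # is) $$ (r, s)"
        using S_mat_carrier[of i] S_prod_carrier[of "is"] Suc.prems by (simp add: S_prod_simps scalar_prod_def)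
    qed
    also have "\<dots> = (\<Sum>is\<in>(#) i ` chains l (i + 1) j. S_prod is $$ (r, s))"
      by (subst sum.reindex) auto
    finally show ?thesis
      unfolding F Suc T(2) IH[OF Suc.prems(2,3)]
      unfolding chains_Suc(1)[OF i] using chains_Suc(2)[OF i] finite_chains by (subst sum.union_disjoint) auto
  qed
qed

lemma taylor_family:
  assumes v: "v \<in> carrier_vec (d + 1)"
  shows "taylor_at_one k family *\<^sub>v v = S_sum d n \<rho> P k v"
proof -
  let ?N = "d + 1" and ?T = "taylor_at_one k family"
  have T: "?T \<in> square_mats d" using family_carrier by (simp add: taylor_at_one_def)
  let ?f = "\<lambda>is. foldr (\<lambda>i f. S_op d \<rho> P i \<circ> f) is id v"
  have f: "?f \<in> chains k 1 (int n) \<rightarrow> carrier_vec ?N"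
    unfolding S_op_prod[OF v] by (rule Pi_I) (rule mult_mat_vec_carrier[OF S_prod_carrier v])
  have sum: "S_sum d n \<rho> P k v = finsum_vec TYPE('a) ?N ?f (chains k 1 (int n))"
    by (simp add: S_sum_def chains_def)
  show ?thesis
    unfolding sum
  proof (rule eq_vecI)
    show "dim_vec (?T *\<^sub>v v) = dim_vec (finsum_vec TYPE('a) ?N ?f (chains k 1 (int n)))"
      using finsum_vec_closed[OF f] T by simp
    fix r assume "r < dim_vec (finsum_vec TYPE('a) ?N ?f (chains k 1 (int n)))"
    then have r: "r < ?N" using finsum_vec_closed[OF f] by simp
    have "(?T *\<^sub>v v) $ r = (\<Sum>s = 0..<?N. ?T $$ (r, s) * v $ s)"
      using T r v by (simp add: scalar_prod_def)
    also have "\<dots> = (\<Sum>s = 0..<?N. \<Sum>is\<in>chains k 1 (int n). S_prod is $$ (r, s) * v $ s)"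
      unfolding family_eq_factors using taylor_factors[OF r] by (intro sum.cong) (auto simp: sum_distrib_right)
    also have "\<dots> = (\<Sum>is\<in>chains k 1 (int n). \<Sum>s = 0..<?N. S_prod is $$ (r, s) * v $ s)"
      by (rule sum.swap)
    also have "\<dots> = (\<Sum>is\<in>chains k 1 (int n). ?f is $ r)"
    proof (intro sum.cong refl)
      fix "is"
      show "(\<Sum>s = 0..<?N. S_prod is $$ (r, s) * v $ s) = ?f is $ r"
        unfolding S_op_prod[OF v] using S_prod_carrier[of "is"] r v by (simp add: scalar_prod_def)
    qed
    also have "\<dots> = finsum_vec TYPE('a) ?N ?f (chains k 1 (int n)) $ r"
      by (rule index_finsum_vec[OF finite_chains r f, symmetric])
    finally show "(?T *\<^sub>v v) $ r = finsum_vec TYPE('a) ?N ?f (chains k 1 (int n)) $ r" .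
  qed
qed

end

lemma pochhammer_1_eq_fact: "pochhammer (1 :: 'a::comm_semiring_1) k = of_nat (fact k)"
  by (induction k) (simp_all add: pochhammer_Suc algebra_simps)

text \<open>
  This version of Taylor's formula has no division, so it holds in positive characteristic, where
  both sides may vanish.
\<close>

lemma higher_pderiv_at_one:
  "poly ((pderiv ^^ k) f) 1 = of_nat (fact k) * Polynomial.coeff (pcompose f [:1, 1 :: 'a::field:]) k"
proof -
  have step: "pcompose (pderiv g) [:1, 1:] = pderiv (pcompose g [:1, 1:])" for g :: "'a poly"
    by (simp add: pderiv_pcompose pderiv_pCons)
  have "pcompose ((pderiv ^^ k) f) [:1, 1:] = (pderiv ^^ k) (pcompose f [:1, 1:])"
    by (induction k) (simp_all only: step funpow.simps comp_apply id_apply)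
  then have "poly ((pderiv ^^ k) f) 1 = poly ((pderiv ^^ k) (pcompose f [:1, 1:])) 0"
    by (metis (no_types, lifting) add.right_neutral mult_zero_left poly_pCons poly_pcompose)
  then show ?thesis
    by (simp add: poly_0_coeff_0 coeff_higher_pderiv pochhammer_1_eq_fact)
qed

lemma deriv_at_one_eq:
  fixes W :: "'a::field poly mat"
  shows "deriv_at_one k W = of_nat (fact k) \<cdot>\<^sub>m taylor_at_one k W"
  by (rule eq_matI) (simp_all add: deriv_at_one_def taylor_at_one_def higher_pderiv_at_one del: of_nat_fact)

section \<open>Conjugate families\<close>

lemma pcompose_power: "pcompose (p ^ k) q = (pcompose p q :: 'a::comm_ring_1 poly) ^ k"
  by (induction k) (simp_all add: pcompose_mult pcompose_1)

lemma vanishing_order_at_one: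
  assumes "\<And>l. l < k \<Longrightarrow> Polynomial.coeff (pcompose f [:1, 1:]) l = (0 :: 'a::field)"
  shows "\<exists>g. f = [:-1, 1:] ^ k * g"
proof -
  have "monom 1 k dvd pcompose f [:1, 1:]" unfolding monom_1_dvd_iff' using assms by blast
  then obtain g where g: "pcompose f [:1, 1:] = monom 1 k * g" by (elim dvdE)
  have X: "monom 1 k = [:0, 1 :: 'a:] ^ k" by (simp add: monom_altdef)
  have t1: "pcompose [:1, 1:] [:-1, 1 :: 'a:] = [:0, 1:]"
    by (simp only: pcompose_pCons pcompose_0 mult_zero_right add_0_right)
      (simp, simp only: one_pCons add_pCons, simp)
  have t2: "pcompose [:0, 1:] [:-1, 1 :: 'a:] = [:-1, 1:]"
    by (simp only: pcompose_pCons pcompose_0 mult_zero_right add_0_right) simp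
  have "f = pcompose (pcompose f [:1, 1:]) [:-1, 1:]"
    by (simp only: pcompose_assoc[symmetric] t1 pcompose_idR)
  also have "\<dots> = [:-1, 1:] ^ k * pcompose g [:-1, 1:]"
    unfolding g X pcompose_mult pcompose_power t2 ..
  finally show ?thesis by blast
qed

lemma coeff_at_vanishing_order:
  "Polynomial.coeff (pcompose ([:-1, 1:] ^ k * g) [:1, 1:]) k = poly g (1 :: 'a::field)"
proof -
  have t1: "pcompose [:-1, 1:] [:1, 1 :: 'a:] = [:0, 1:]"
    by (simp only: pcompose_pCons pcompose_0 mult_zero_right add_0_right) simp
  have X: "[:0, 1 :: 'a:] ^ k = monom 1 k" by (simp add: monom_altdef)
  have "Polynomial.coeff (pcompose g [:1, 1:]) 0 = poly g 1"
    by (metis (no_types, lifting) add.right_neutral mult_zero_left poly_0_coeff_0 poly_pCons poly_pcompose)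
  then show ?thesis
    unfolding pcompose_mult pcompose_power t1 X by (simp add: coeff_monom_mult)
qed

lemma power_dvd_cancel_unit_at_one:
  fixes u f g :: "'a::field poly"
  assumes u: "poly u 1 \<noteq> 0" and e: "u * f = [:-1, 1:] ^ k * g"
  shows "\<exists>h. f = [:-1, 1:] ^ k * h"
proof (cases "f = 0")
  case False
  have "u \<noteq> 0" using u by auto
  then have "order 1 (u * f) = order 1 f"
    using False u by (simp add: order_mult order_root order_0I)
  moreover have "u * f \<noteq> 0" using \<open>u \<noteq> 0\<close> False by simp
  moreover have "[:-1, 1:] ^ k dvd u * f" using e by simp
  ultimately have "[:-1, 1:] ^ k dvd f"
    unfolding order_divides[of 1] by simp
  then show ?thesis by (elim dvdE) blast
qed (intro exI[of _ 0], simp)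

lemma coeff_of_multiple:
  fixes u f g :: "'a::field poly"
  assumes u: "poly u 1 \<noteq> 0" and e: "u * f = [:-1, 1:] ^ k * g"
  shows "Polynomial.coeff (pcompose f [:1, 1:]) k = poly g 1 / poly u 1"
proof -
  obtain h where h: "f = [:-1, 1:] ^ k * h" using power_dvd_cancel_unit_at_one[OF u e] by blast
  have "[:-1, 1:] ^ k * (u * h) = [:-1, 1:] ^ k * g" using e h by (simp add: ac_simps)
  then have "u * h = g" by simp
  then have "poly u 1 * poly h 1 = poly g 1" by (metis poly_mult)
  then show ?thesis unfolding h coeff_at_vanishing_order using u by (simp add: field_simps)
qed

text \<open>
  If \<open>a / b\<close> equals a quotient of polynomials that do not vanish at \<open>1\<close>, then \<open>a\<close> and \<open>b\<close> have the same
  order there, and cancelling the common power leaves two polynomials that do not vanish.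
\<close>

lemma equal_order_quotients:
  fixes a b f g :: "'a::field poly"
  assumes ab: "a \<noteq> 0" "b \<noteq> 0" and e: "b * f = a * g" and f: "poly f 1 \<noteq> 0" and g: "poly g 1 \<noteq> 0"
  shows "\<exists>c a' b'. c \<noteq> 0 \<and> a = c * a' \<and> b = c * b' \<and> poly a' 1 \<noteq> 0 \<and> poly b' 1 \<noteq> 0"
proof -
  have "f \<noteq> 0" "g \<noteq> 0" "order 1 f = 0" "order 1 g = 0" using f g by (auto simp: order_root order_0I)
  then have ord: "order 1 a = order 1 b"
    using arg_cong[OF e, of "order 1"] ab by (simp add: order_mult)
  obtain a' where a': "a = [:-1, 1:] ^ order 1 a * a'" "\<not> [:-1, 1:] dvd a'"
    using order_decomp[OF ab(1), of 1] by auto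
  obtain b' where b': "b = [:-1, 1:] ^ order 1 a * b'" "\<not> [:-1, 1:] dvd b'"
    using order_decomp[OF ab(2), of 1] unfolding ord by auto
  have "poly a' 1 \<noteq> 0" "poly b' 1 \<noteq> 0" "[:-1, 1 :: 'a:] ^ order 1 a \<noteq> 0"
    using a'(2) b'(2) by (simp_all add: poly_eq_0_iff_dvd)
  then show ?thesis using a'(1) b'(1) by blast
qed

text \<open>
  Write \<open>P = \<sigma> + (t - 1)\<^sup>k R\<close> with \<open>\<sigma>\<close> scalar. Conjugation does not affect \<open>\<sigma>\<close>, and at order \<open>k\<close> it
  acts on \<open>R\<close> through the value of \<open>H\<close> at \<open>t = 1\<close>, which is scalar. The matrices are related up to a
  rational factor only, but this factor takes the value \<open>1\<close> at \<open>t = 1\<close>. So it changes the Taylor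
  coefficient of order \<open>k\<close> by a scalar matrix.
\<close>

lemma taylor_conjugate:
  fixes P Q H :: "'a::field poly mat"
  assumes carr: "P \<in> square_mats d" "Q \<in> square_mats d" "H \<in> square_mats d"
    and ab: "a \<noteq> 0" "b \<noteq> 0" and conj: "b \<cdot>\<^sub>m (P * H) = a \<cdot>\<^sub>m (H * Q)"
    and P1: "map_mat at_one P = 1\<^sub>m (d + 1)" and Q1: "map_mat at_one Q = 1\<^sub>m (d + 1)"
    and H1: "map_mat at_one H = h \<cdot>\<^sub>m 1\<^sub>m (d + 1)" and h: "h \<noteq> 0"
    and low: "\<forall>l\<in>{1..<k}. scalar_matrix d (taylor_at_one l P)"
  shows "scalar_matrix d (taylor_at_one k Q - taylor_at_one k P)"
proof -
  let ?N = "d + 1" and ?t = "[:-1, 1 :: 'a:]"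
  let ?ev = "map_mat at_one"
  let ?co = "\<lambda>f. Polynomial.coeff (pcompose f [:1, 1 :: 'a:])"
  have PH: "P * H \<in> square_mats d" and HQ: "H * Q \<in> square_mats d"
    by (rule mult_carrier_mat[OF carr(1,3)], rule mult_carrier_mat[OF carr(3,2)])
  have ev: "?ev (P * H) = h \<cdot>\<^sub>m 1\<^sub>m ?N" "?ev (H * Q) = h \<cdot>\<^sub>m 1\<^sub>m ?N"
    unfolding eval1.mat_hom_mult[OF carr(1,3)] eval1.mat_hom_mult[OF carr(3,2)] P1 Q1 H1
    by (simp_all add: smult_mat_mult_dim)
  have ev00: "poly (X $$ (0, 0)) 1 = ?ev X $$ (0, 0)" if "X \<in> square_mats d" for X
    using that by simp
  have "poly ((P * H) $$ (0, 0)) 1 = h" "poly ((H * Q) $$ (0, 0)) 1 = h"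
    unfolding ev00[OF PH] ev00[OF HQ] ev by simp_all
  moreover have "b * (P * H) $$ (0, 0) = a * (H * Q) $$ (0, 0)"
    using arg_cong[OF conj, of "\<lambda>X. X $$ (0, 0)"] carr by simp
  \<comment> \<open>cancel the common zero of \<open>a\<close> and \<open>b\<close> at \<open>1\<close>\<close>
  ultimately obtain c a' b' where c: "c \<noteq> 0" "a = c * a'" "b = c * b'"
    and a1: "poly a' 1 \<noteq> 0" and "poly b' 1 \<noteq> 0"
    and ab': "c * (b' * (P * H) $$ (0, 0)) = c * (a' * (H * Q) $$ (0, 0))"
    and PH1: "poly ((P * H) $$ (0, 0)) 1 = h" and HQ1: "poly ((H * Q) $$ (0, 0)) 1 = h"
    using equal_order_quotients[OF ab, of "(P * H) $$ (0, 0)" "(H * Q) $$ (0, 0)"] h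
    by (auto simp: mult.assoc)
  have "b' * (P * H) $$ (0, 0) = a' * (H * Q) $$ (0, 0)" using ab' c(1) by simp
  then have "poly b' 1 * h = poly a' 1 * h" using PH1 HQ1 by (metis poly_mult)
  then have b1: "poly b' 1 = poly a' 1" using h by simp
  have conj': "b' \<cdot>\<^sub>m (P * H) = a' \<cdot>\<^sub>m (H * Q)"
  proof (rule eq_matI)
    fix i j assume "i < dim_row (a' \<cdot>\<^sub>m (H * Q))" "j < dim_col (a' \<cdot>\<^sub>m (H * Q))"
    then have ij: "i < ?N" "j < ?N" using carr by auto
    have "b * (P * H) $$ (i, j) = a * (H * Q) $$ (i, j)"
      using arg_cong[OF conj, of "\<lambda>X. X $$ (i, j)"] carr ij by simp
    then have "c * (b' * (P * H) $$ (i, j)) = c * (a' * (H * Q) $$ (i, j))"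
      unfolding c(2,3) by (simp only: mult.assoc)
    then show "(b' \<cdot>\<^sub>m (P * H)) $$ (i, j) = (a' \<cdot>\<^sub>m (H * Q)) $$ (i, j)"
      using c(1) carr ij by simp
  qed (use carr in auto)
  \<comment> \<open>an entry of \<open>P\<close> in place of the scalar Taylor polynomial: they agree below order \<open>k\<close>\<close>
  define \<sigma> where "\<sigma> = P $$ (0, 0)"
  have scal: "\<exists>c. \<forall>r<?N. \<forall>s<?N. ?co (P $$ (r, s)) l = (if r = s then c else 0)" if l: "l < k" for l
  proof -
    have "scalar_matrix d (taylor_at_one l P)"
    proof (cases "l = 0")
      case True
      have "?co f 0 = poly f 1" for f
        by (metis (no_types, lifting) add.right_neutral mult_zero_left poly_0_coeff_0 poly_pCons poly_pcompose)
      then have "taylor_at_one l P = 1 \<cdot>\<^sub>m 1\<^sub>m ?N"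
        unfolding P1[symmetric] True by (simp add: taylor_at_one_def one_smult_mat)
      then show ?thesis unfolding scalar_matrix_def by blast
    qed (use low l in auto)
    then obtain c where e: "taylor_at_one l P = c \<cdot>\<^sub>m 1\<^sub>m ?N" unfolding scalar_matrix_def by blast
    have "?co (P $$ (r, s)) l = (if r = s then c else 0)" if "r < ?N" "s < ?N" for r s
      using arg_cong[OF e, of "\<lambda>X. X $$ (r, s)"] that carr(1) by (simp add: taylor_at_one_def)
    then show ?thesis by blast
  qed
  have "\<exists>g. P $$ (r, s) - (if r = s then \<sigma> else 0) = ?t ^ k * g" if rs: "r < ?N" "s < ?N" for r s
  proof (rule vanishing_order_at_one)
    fix l assume "l < k"
    from scal[OF this] obtain c where c: "\<And>r s. r < ?N \<Longrightarrow> s < ?N \<Longrightarrow> ?co (P $$ (r, s)) l = (if r = s then c else 0)"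
      by blast
    show "?co (P $$ (r, s) - (if r = s then \<sigma> else 0)) l = 0"
      using c[OF rs] c[of 0 0] by (simp add: pcompose_diff \<sigma>_def)
  qed
  then obtain \<gamma> where \<gamma>: "\<And>r s. r < ?N \<Longrightarrow> s < ?N \<Longrightarrow> P $$ (r, s) - (if r = s then \<sigma> else 0) = ?t ^ k * \<gamma> r s"
    by metis
  define R where "R = mat ?N ?N (\<lambda>(r, s). \<gamma> r s)"
  have R: "R \<in> square_mats d" unfolding R_def by (rule mat_carrier)
  have PR: "P = \<sigma> \<cdot>\<^sub>m 1\<^sub>m ?N + ?t ^ k \<cdot>\<^sub>m R"
  proof (rule eq_matI)
    fix r s assume "r < dim_row (\<sigma> \<cdot>\<^sub>m 1\<^sub>m ?N + ?t ^ k \<cdot>\<^sub>m R)" "s < dim_col (\<sigma> \<cdot>\<^sub>m 1\<^sub>m ?N + ?t ^ k \<cdot>\<^sub>m R)"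
    then have rs: "r < ?N" "s < ?N" using R by auto
    have "(\<sigma> \<cdot>\<^sub>m 1\<^sub>m ?N + ?t ^ k \<cdot>\<^sub>m R) $$ (r, s) = (if r = s then \<sigma> else 0) + ?t ^ k * \<gamma> r s"
      using rs by (simp add: R_def)
    then show "P $$ (r, s) = (\<sigma> \<cdot>\<^sub>m 1\<^sub>m ?N + ?t ^ k \<cdot>\<^sub>m R) $$ (r, s)"
      unfolding \<gamma>[OF rs, symmetric] by simp
  qed (use carr R in auto)
  define Z where "Z = a' \<cdot>\<^sub>m Q - (b' * \<sigma>) \<cdot>\<^sub>m 1\<^sub>m ?N"
  have Z: "Z \<in> square_mats d" unfolding Z_def by (rule minus_carrier_mat) simp
  have RH: "R * H \<in> square_mats d" using R carr(3) by (rule mult_carrier_mat)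
  have HZ: "H * Z = (b' * ?t ^ k) \<cdot>\<^sub>m (R * H)"
  proof -
    have "H * Z = H * (a' \<cdot>\<^sub>m Q) - H * ((b' * \<sigma>) \<cdot>\<^sub>m 1\<^sub>m ?N)"
      unfolding Z_def using carr by (intro mult_minus_distrib_mat) auto
    also have "H * (a' \<cdot>\<^sub>m Q) = b' \<cdot>\<^sub>m (P * H)"
      unfolding conj' using carr by (simp add: mult_mat_smult_dim)
    also have "P * H = (\<sigma> \<cdot>\<^sub>m 1\<^sub>m ?N) * H + (?t ^ k \<cdot>\<^sub>m R) * H"
      unfolding PR using R carr(3) by (intro add_mult_distrib_mat) auto
    also have "(\<sigma> \<cdot>\<^sub>m 1\<^sub>m ?N) * H = \<sigma> \<cdot>\<^sub>m H"
      using carr(3) by (simp add: smult_mat_mult_dim)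
    also have "(?t ^ k \<cdot>\<^sub>m R) * H = ?t ^ k \<cdot>\<^sub>m (R * H)"
      using R carr(3) by (simp add: smult_mat_mult_dim)
    also have "H * ((b' * \<sigma>) \<cdot>\<^sub>m 1\<^sub>m ?N) = (b' * \<sigma>) \<cdot>\<^sub>m H"
      using carr(3) by (simp add: mult_mat_smult_dim)
    also have "b' \<cdot>\<^sub>m (\<sigma> \<cdot>\<^sub>m H + ?t ^ k \<cdot>\<^sub>m (R * H)) - (b' * \<sigma>) \<cdot>\<^sub>m H = (b' * ?t ^ k) \<cdot>\<^sub>m (R * H)"
      by (rule eq_matI) (use carr(3) R in \<open>auto simp: algebra_simps\<close>)
    finally show ?thesis .
  qed
  have "poly (det H) 1 = h ^ ?N" using eval1.hom_det[of H] unfolding H1 by simp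
  then have detH: "poly (det H) 1 \<noteq> 0" using h by simp
  note A = adj_mat[OF carr(3)]
  have "det H \<cdot>\<^sub>m Z = (b' * ?t ^ k) \<cdot>\<^sub>m (adj_mat H * (R * H))"
  proof -
    have "adj_mat H * (H * Z) = det H \<cdot>\<^sub>m Z"
      using assoc_mult_mat[OF A(1) carr(3) Z] unfolding A(3) using Z by (simp add: smult_mat_mult_dim)
    then show ?thesis unfolding HZ using A(1) R carr(3) by (simp add: mult_mat_smult_dim)
  qed
  note detZ = this
  have "\<exists>y. Z $$ (r, s) = ?t ^ k * y" if rs: "r < ?N" "s < ?N" for r s
  proof (rule power_dvd_cancel_unit_at_one[OF detH])
    show "det H * Z $$ (r, s) = ?t ^ k * (b' * (adj_mat H * (R * H)) $$ (r, s))"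
      using arg_cong[OF detZ, of "\<lambda>X. X $$ (r, s)"] Z A(1) R carr rs by (simp add: ac_simps)
  qed
  then obtain y where y: "\<And>r s. r < ?N \<Longrightarrow> s < ?N \<Longrightarrow> Z $$ (r, s) = ?t ^ k * y r s" by metis
  define Y where "Y = mat ?N ?N (\<lambda>(r, s). y r s)"
  have Y: "Y \<in> square_mats d" unfolding Y_def by (rule mat_carrier)
  have HY: "H * Y = b' \<cdot>\<^sub>m (R * H)"
  proof (rule eq_matI)
    have "Z = ?t ^ k \<cdot>\<^sub>m Y" by (rule eq_matI) (use Z y in \<open>auto simp: Y_def\<close>)
    then have e: "?t ^ k \<cdot>\<^sub>m (H * Y) = (b' * ?t ^ k) \<cdot>\<^sub>m (R * H)"
      using HZ carr(3) Y by (simp add: mult_mat_smult_dim)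
    fix r s assume "r < dim_row (b' \<cdot>\<^sub>m (R * H))" "s < dim_col (b' \<cdot>\<^sub>m (R * H))"
    then have rs: "r < ?N" "s < ?N" using RH by auto
    have "?t ^ k * (H * Y) $$ (r, s) = ?t ^ k * (b' * (R * H) $$ (r, s))"
      using arg_cong[OF e, of "\<lambda>X. X $$ (r, s)"] R Y carr rs by (simp add: ac_simps)
    then show "(H * Y) $$ (r, s) = (b' \<cdot>\<^sub>m (R * H)) $$ (r, s)" using R carr rs by simp
  qed (use R carr Y in auto)
  have Y1: "poly (Y $$ (r, s)) 1 = poly b' 1 * poly (R $$ (r, s)) 1" if rs: "r < ?N" "s < ?N" for r s
  proof -
    have "?ev (H * Y) = h \<cdot>\<^sub>m ?ev Y"
      unfolding eval1.mat_hom_mult[OF carr(3) Y] H1 using Y by (simp add: smult_mat_mult_dim)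
    moreover have "?ev (R * H) = h \<cdot>\<^sub>m ?ev R"
      unfolding eval1.mat_hom_mult[OF R carr(3)] H1 using R by (simp add: mult_mat_smult_dim)
    moreover have "?ev (b' \<cdot>\<^sub>m (R * H)) = poly b' 1 \<cdot>\<^sub>m ?ev (R * H)" by (rule eq_matI) auto
    ultimately have e: "h \<cdot>\<^sub>m ?ev Y = poly b' 1 \<cdot>\<^sub>m (h \<cdot>\<^sub>m ?ev R)" unfolding HY by simp
    have "h * poly (Y $$ (r, s)) 1 = poly b' 1 * (h * poly (R $$ (r, s)) 1)"
      using arg_cong[OF e, of "\<lambda>X. X $$ (r, s)"] Y R rs by simp
    then show ?thesis using h by simp
  qed
  \<comment> \<open>a matrix is scalar if its off-diagonal entries and the differences of diagonal ones vanish\<close>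
  define D where "D = taylor_at_one k Q - taylor_at_one k P"
  have Dc: "D \<in> square_mats d"
    unfolding D_def by (rule minus_carrier_mat) (use carr in \<open>simp add: taylor_at_one_def\<close>)
  have Drs: "D $$ (r, s) = ?co (Q $$ (r, s)) k - ?co (P $$ (r, s)) k" if "r < ?N" "s < ?N" for r s
    using that carr by (simp add: D_def taylor_at_one_def)
  have aQ: "a' * Q $$ (r, s) = (if r = s then b' * \<sigma> else 0) + ?t ^ k * Y $$ (r, s)"
    and Prs: "P $$ (r, s) = (if r = s then \<sigma> else 0) + ?t ^ k * R $$ (r, s)" if rs: "r < ?N" "s < ?N" for r s
  proof -
    have "Z $$ (r, s) = a' * Q $$ (r, s) - (if r = s then b' * \<sigma> else 0)"
      using rs carr(2) by (simp add: Z_def)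
    then show "a' * Q $$ (r, s) = (if r = s then b' * \<sigma> else 0) + ?t ^ k * Y $$ (r, s)"
      using y[OF rs] rs by (simp add: Y_def)
    show "P $$ (r, s) = (if r = s then \<sigma> else 0) + ?t ^ k * R $$ (r, s)"
      using \<gamma>[OF rs] rs by (simp add: R_def algebra_simps)
  qed
  have off: "D $$ (r, s) = 0" if rs: "r < ?N" "s < ?N" and "r \<noteq> s" for r s
  proof -
    have "?co (Q $$ (r, s)) k = poly (Y $$ (r, s)) 1 / poly a' 1"
      by (rule coeff_of_multiple[OF a1]) (use aQ[OF rs] \<open>r \<noteq> s\<close> in simp)
    moreover have "?co (P $$ (r, s)) k = poly (R $$ (r, s)) 1"
      using Prs[OF rs] \<open>r \<noteq> s\<close> coeff_at_vanishing_order[of k "R $$ (r, s)"] by simp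
    ultimately show ?thesis using Y1[OF rs] a1 b1 Drs[OF rs] by simp
  qed
  have diag: "D $$ (r, r) = D $$ (0, 0)" if r: "r < ?N" for r
  proof -
    have 0: "0 < ?N" by simp
    have "?co (Q $$ (r, r) - Q $$ (0, 0)) k = poly (Y $$ (r, r) - Y $$ (0, 0)) 1 / poly a' 1"
    proof (rule coeff_of_multiple[OF a1])
      show "a' * (Q $$ (r, r) - Q $$ (0, 0)) = ?t ^ k * (Y $$ (r, r) - Y $$ (0, 0))"
        unfolding right_diff_distrib aQ[OF r r] aQ[OF 0 0] by simp
    qed
    moreover have "P $$ (r, r) - P $$ (0, 0) = ?t ^ k * (R $$ (r, r) - R $$ (0, 0))"
      unfolding right_diff_distrib using Prs[OF r r] Prs[OF 0 0] by simp
    then have "?co (P $$ (r, r) - P $$ (0, 0)) k = poly (R $$ (r, r) - R $$ (0, 0)) 1"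
      by (simp only: coeff_at_vanishing_order)
    moreover have "poly (Y $$ (r, r) - Y $$ (0, 0)) 1 / poly a' 1 = poly (R $$ (r, r) - R $$ (0, 0)) 1"
      using Y1[OF r r] Y1[OF 0 0] a1 b1 by (simp add: field_simps)
    ultimately have "?co (Q $$ (r, r)) k - ?co (Q $$ (0, 0)) k = ?co (P $$ (r, r)) k - ?co (P $$ (0, 0)) k"
      by (simp only: pcompose_diff coeff_diff)
    then show ?thesis unfolding Drs[OF r r] Drs[OF 0 0] by (simp add: algebra_simps)
  qed
  have "D = D $$ (0, 0) \<cdot>\<^sub>m 1\<^sub>m ?N"
  proof (rule eq_matI)
    fix r s assume "r < dim_row (D $$ (0, 0) \<cdot>\<^sub>m 1\<^sub>m ?N)" "s < dim_col (D $$ (0, 0) \<cdot>\<^sub>m 1\<^sub>m ?N)"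
    then have rs: "r < ?N" "s < ?N" by auto
    show "D $$ (r, s) = (D $$ (0, 0) \<cdot>\<^sub>m 1\<^sub>m ?N) $$ (r, s)"
    proof (cases "r = s")
      case True
      have "D $$ (r, s) = D $$ (0, 0)" unfolding True[symmetric] by (rule diag[OF rs(1)])
      then show ?thesis using rs True by simp
    next
      case False
      then show ?thesis using off[OF rs] rs by simp
    qed
  qed (use Dc in auto)
  then show ?thesis unfolding scalar_matrix_def D_def by blast
qed

section \<open>Invariance of the infinitesimal monodromy\<close>

context linear_deformation
begin

text \<open>
  The lifted deformation has a polynomial basis \<open>B(t)\<close> of its initial frame. Together with the
  constant initial frame of \<open>P\<close> it gives the conjugating matrix \<open>H\<close>, whose value at \<open>t = 1\<close> compares
  two bases of the same frame and hence is scalar.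
\<close>

lemma taylor_invariance:
  assumes Pt: "lifted_deformation d n \<rho> P Pt"
    and W: "W \<in> square_mats d" "map_mat at_one W = 1\<^sub>m (d + 1)"
    and mono: "proj_eq_mat (monodromy Pt) (map_mat to_fract W)"
    and low: "\<forall>l\<in>{1..<k}. scalar_matrix d (taylor_at_one l W)"
  shows "scalar_matrix d (taylor_at_one k family - taylor_at_one k W)"
proof -
  let ?N = "d + 1"
  have ng: "ngon d n Pt" and spec: "specializes d Pt P"
    using Pt unfolding lifted_deformation_def by auto
  have "\<exists>B\<in>square_mats d. frame_basis d (frame_at Pt 1) (map_mat to_fract B)
      \<and> frame_basis d (frame_at P 1) (map_mat at_one B)"
    by (rule lifted_frame_basis[OF ngon_proj_frame[OF ng] ngon_proj_frame[OF P]])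
      (use spec in \<open>simp add: specializes_iff_lifts\<close>)
  then obtain B where B: "B \<in> square_mats d" "frame_basis d (frame_at Pt 1) (map_mat to_fract B)"
    "frame_basis d (frame_at P 1) (map_mat at_one B)" by blast
  have pcC: "pc C \<in> square_mats d" using C(1) by simp
  define H where "H = B * pc C"
  have H: "H \<in> square_mats d" unfolding H_def using B(1) pcC by (rule mult_carrier_mat)
  have V: "family \<in> square_mats d" by (rule family_carrier)
  let ?B = "map_mat to_fract B" and ?C = "map_mat const C" and ?total = "map_mat to_fract total"
  have fB: "?B \<in> square_mats d" and fC: "?C \<in> square_mats d" and ft: "?total \<in> square_mats d"
    and fCi: "map_mat const (minv C) \<in> square_mats d" and fW: "map_mat to_fract W \<in> square_mats d"
    and M: "monodromy Pt \<in> square_mats d"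
    using B(1) C(1) C_inv(1) total_carrier W(1) ngon_periodic(1)[OF ng] by simp_all
  have fH: "map_mat to_fract H = ?B * ?C"
    unfolding H_def fract.mat_hom_mult[OF B(1) pcC] map_const_eq ..
  have BC: "?B * ?C \<in> square_mats d" using fB fC by (rule mult_carrier_mat)
  have "proj_eq_mat (map_mat to_fract W * (?B * ?C)) (monodromy Pt * (?B * ?C))"
    using fW fB fC M by (intro proj_eq_mat_mult_right proj_eq_mat_sym[OF mono]) auto
  also have "monodromy Pt * (?B * ?C) = monodromy Pt * ?B * ?C"
    using M fB fC by (simp add: mult_mat_assoc_dim)
  also have "proj_eq_mat \<dots> (?B * ?total * ?C)"
    using lifted_monodromy[OF Pt B(2)] fB fC ft by (intro proj_eq_mat_mult_right) auto
  also have "?B * ?total * ?C = (?B * ?C) * map_mat to_fract raw_family"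
  proof -
    have tC: "?total * ?C \<in> square_mats d" using ft fC by (rule mult_carrier_mat)
    have "?C * (map_mat const (minv C) * (?total * ?C)) = ?total * ?C"
      unfolding assoc_mult_mat[OF fC fCi tC, symmetric] const_C_inv(1) by (rule left_mult_one_mat[OF tC])
    then show ?thesis
      unfolding fract_raw using fB fC ft fCi by (simp add: mult_mat_assoc_dim)
  qed
  also have "proj_eq_mat \<dots> ((?B * ?C) * map_mat to_fract family)"
    using BC raw_carrier V by (intro proj_eq_mat_mult_left proj_eq_mat_sym[OF family_proj_eq_raw]) auto
  finally have "proj_eq_mat (map_mat to_fract (W * H)) (map_mat to_fract (H * family))"
    unfolding fract.mat_hom_mult[OF W(1) H] fract.mat_hom_mult[OF H V] fH .
  then obtain s where s: "s \<noteq> 0" "map_mat to_fract (W * H) = s \<cdot>\<^sub>m map_mat to_fract (H * family)"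
    by (auto simp: proj_eq_mat_def)
  obtain a b where ab: "s = Fract a b" "b \<noteq> 0" by (cases s)
  then have a: "a \<noteq> 0" using s(1) by (auto simp: fract_collapse)
  have conj: "b \<cdot>\<^sub>m (W * H) = a \<cdot>\<^sub>m (H * family)"
  proof (rule eq_matI)
    fix i j assume "i < dim_row (a \<cdot>\<^sub>m (H * family))" "j < dim_col (a \<cdot>\<^sub>m (H * family))"
    then have ij: "i < ?N" "j < ?N" using H V by auto
    have "to_fract ((W * H) $$ (i, j)) = s * to_fract ((H * family) $$ (i, j))"
      using arg_cong[OF s(2), of "\<lambda>X. X $$ (i, j)"] W(1) H V ij by simp
    then have "to_fract (b * (W * H) $$ (i, j)) = to_fract (a * (H * family) $$ (i, j))"
      unfolding ab(1) Fract_conv_to_fract using ab(2) by (simp add: field_simps)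
    then have "b * (W * H) $$ (i, j) = a * (H * family) $$ (i, j)" by (simp only: to_fract_eq_iff)
    then show "(b \<cdot>\<^sub>m (W * H)) $$ (i, j) = (a \<cdot>\<^sub>m (H * family)) $$ (i, j)" using W(1) H V ij by simp
  qed (use W(1) H V in auto)
  have "proj_eq_mat (map_mat at_one B) (minv C)"
    by (rule frame_basis_unique[OF B(3) C(3)]) simp
  then have "proj_eq_mat (map_mat at_one B * C) (minv C * C)"
    using C(1) C_inv(1) by (intro proj_eq_mat_mult_right) auto
  then obtain h where h: "h \<noteq> 0" "map_mat at_one B * C = h \<cdot>\<^sub>m 1\<^sub>m ?N"
    unfolding C_inv(3) by (auto simp: proj_eq_mat_def)
  then have "map_mat at_one H = h \<cdot>\<^sub>m 1\<^sub>m ?N"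
    unfolding H_def eval1.mat_hom_mult[OF B(1) pcC] map_eval_constp by simp
  from taylor_conjugate[OF W(1) V H a ab(2) conj W(2) family_at_one this h(1) low] show ?thesis .
qed

end

theorem proposition2p14:
  fixes T :: "'a::field polygon_map" and \<rho> :: "'a scaling" and P :: "'a polygon"
    and d n k :: nat
  assumes "1 \<le> d" and "1 \<le> n"
    and "polygonal_transformation d n T"
    and "scaling_symmetry d n T \<rho>" and "linear_scaling d n \<rho>"
    and "ngon d n P" and "closed_polygon d P"
    and "scaling_defined d n id \<rho> 1 (cr d P)"
    and "1 \<le> k"
  shows
    \<comment> \<open>\<open>M(t)\<close> is the monodromy of the deformation, with \<open>M(1) = Id\<close>\<close>
    "(\<exists>Pt. framed_deformation d n \<rho> P Pt)
     \<and> (\<forall>Pt. framed_deformation d n \<rho> P Pt \<longrightarrow>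
          proj_eq_mat (monodromy Pt) (map_mat to_fract (monodromy_family d n \<rho> P)))
     \<and> map_mat (\<lambda>f. poly f 1) (monodromy_family d n \<rho> P) = 1\<^sub>m (d + 1)
     \<comment> \<open>the formula, for the Taylor coefficient and for the derivative\<close>
     \<and> (\<forall>v\<in>carrier_vec (d + 1).
          taylor_at_one k (monodromy_family d n \<rho> P) *\<^sub>v v = S_sum d n \<rho> P k v
          \<and> deriv_at_one k (monodromy_family d n \<rho> P) *\<^sub>v v = of_nat (fact k) \<cdot>\<^sub>v S_sum d n \<rho> P k v)
     \<comment> \<open>invariance\<close>
     \<and> (\<forall>Q. preserves_monodromy d n T
            \<and> ngon d n Q \<and> maps_to d n T (const_polygon P) (const_polygon Q)
            \<and> scaling_defined d n id \<rho> 1 (cr d Q) \<longrightarrow>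
          closed_polygon d Q
          \<comment> \<open>along the lifted deformation \<open>T(P\<^sub>t)\<close> of \<open>T(P)\<close> the monodromy is again \<open>M(t)\<close>\<close>
          \<and> (\<forall>Pt. framed_deformation d n \<rho> P Pt \<longrightarrow>
               (\<exists>Qt. maps_to d n T Pt Qt)
               \<and> (\<forall>Qt. maps_to d n T Pt Qt \<longrightarrow>
                    lifted_deformation d n \<rho> Q Qt
                    \<and> proj_eq_mat (monodromy Qt) (map_mat to_fract (monodromy_family d n \<rho> P))))
          \<comment> \<open>intrinsically, modulo scalars: the infinitesimal monodromy of lowest order (so always \<open>k = 1\<close>)\<close>
          \<and> ((\<forall>l\<in>{1..<k}. scalar_matrix d (taylor_at_one l (monodromy_family d n \<rho> P))) \<longrightarrow>
               scalar_matrix d (taylor_at_one k (monodromy_family d n \<rho> Q)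
                                - taylor_at_one k (monodromy_family d n \<rho> P))))"
proof -
  have T: "wf_polygon_map d n T"
    using assms(3) unfolding polygonal_transformation_def birational_map_def by blast
  have wf\<rho>: "wf_scaling d n \<rho>"
    and unit: "\<forall>c. moduli_point d n c \<and> scaling_defined d n const \<rho> 1 c \<longrightarrow>
      moduli_eq d n (scaled const \<rho> 1 c) c"
    using assms(4) unfolding scaling_symmetry_def by blast+
  have commutes: "moduli_eq d n (cr d Q') (scaled const \<rho> t (cr d Q))"
    if "t \<noteq> 0" "maps_to d n T P Q" "maps_to d n T P' Q'" "scaling_defined d n const \<rho> t (cr d P)"
      "moduli_eq d n (cr d P') (scaled const \<rho> t (cr d P))" "scaling_defined d n const \<rho> t (cr d Q)" for t P Q P' Q'
    using assms(4) that unfolding scaling_symmetry_def by blast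
  have t0: "generic_t \<noteq> (0 :: 'a poly fract)" by (simp add: generic_t_def)
  have point: "moduli_point d n (cr d R)" if R: "ngon d n R" for R :: "'a polygon"
    unfolding moduli_point_def
  proof (intro ballI)
    fix i j assume j: "j \<in> {1..d}"
    obtain B where "frame_basis d (frame_at R i) B"
      using proj_frame_has_basis[OF ngon_proj_frame[OF R]] by blast
    from ngon_coordinates(2)[OF R this, of j] j show "cr d R i j \<noteq> 0" by simp
  qed
  have const_cr: "moduli_eq d n (cr d (const_polygon R)) (\<lambda>i j. const (cr d R i j))"
    if "ngon d n R" for R :: "'a polygon"
    using cr_const_polygon[OF that] unfolding moduli_eq_def by simp
  have defined_t: "scaling_defined d n const \<rho> generic_t (cr d (const_polygon R))"
    if R: "ngon d n R" and def: "scaling_defined d n id \<rho> 1 (cr d R)" for R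
    unfolding scaling_defined_def
  proof (intro ballI conjI)
    fix i j assume ij: "i \<in> {1..int n}" "j \<in> {1..d}"
    note cong = scaled_cong[OF wf\<rho> const_cr[OF R] ij]
    note lin = linear_scaling_generic[OF assms(5) unit point[OF R] def ij]
    show "poly (denom const \<rho> (cr d (const_polygon R)) i j) generic_t \<noteq> 0"
      unfolding cong(2) by (rule lin(1))
    have "cr d R i j \<noteq> 0" using point[OF R] ij unfolding moduli_point_def by blast
    then have "cr_poly d \<rho> R i j \<noteq> 0" using poly_cr_poly_1[of d \<rho> R i j] by auto
    then show "scaled const \<rho> generic_t (cr d (const_polygon R)) i j \<noteq> 0"
      unfolding cong(3) lin(2) by simp
  qed
  have deformation: "linear_deformation d n \<rho> R"
    if R: "ngon d n R" "closed_polygon d R" and def: "scaling_defined d n id \<rho> 1 (cr d R)" for R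
    by (unfold_locales, fact assms(2), fact R(1), fact R(2))
      (rule linear_scaling_generic(2)[OF assms(5) unit point[OF R(1)] def])
  interpret P: linear_deformation d n \<rho> P by (rule deformation[OF assms(6,7,8)])
  have invariance: "closed_polygon d Q
      \<and> (\<forall>Pt. framed_deformation d n \<rho> P Pt \<longrightarrow>
           (\<exists>Qt. maps_to d n T Pt Qt)
           \<and> (\<forall>Qt. maps_to d n T Pt Qt \<longrightarrow>
                lifted_deformation d n \<rho> Q Qt
                \<and> proj_eq_mat (monodromy Qt) (map_mat to_fract (monodromy_family d n \<rho> P))))
      \<and> ((\<forall>l\<in>{1..<k}. scalar_matrix d (taylor_at_one l (monodromy_family d n \<rho> P))) \<longrightarrow>
           scalar_matrix d (taylor_at_one k (monodromy_family d n \<rho> Q)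
                            - taylor_at_one k (monodromy_family d n \<rho> P)))"
    if pres: "preserves_monodromy d n T" and Q: "ngon d n Q"
      and map: "maps_to d n T (const_polygon P) (const_polygon Q)"
      and defQ: "scaling_defined d n id \<rho> 1 (cr d Q)" for Q
  proof -
    have "proj_eq_mat (monodromy (const_polygon Q)) (monodromy (const_polygon P))"
      using pres map unfolding preserves_monodromy_def by blast
    then have "proj_eq_mat (monodromy Q) (monodromy P)"
      by (simp add: const_polygon_def proj_eq_mat_const_iff)
    then have closedQ: "closed_polygon d Q"
      using assms(7) unfolding closed_polygon_def by (rule proj_eq_mat_trans)
    interpret Q: linear_deformation d n \<rho> Q by (rule deformation[OF Q closedQ defQ])
    have image: "(\<exists>Qt. maps_to d n T Pt Qt)
        \<and> (\<forall>Qt. maps_to d n T Pt Qt \<longrightarrow>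
             lifted_deformation d n \<rho> Q Qt
             \<and> proj_eq_mat (monodromy Qt) (map_mat to_fract (monodromy_family d n \<rho> P)))"
      if framed: "framed_deformation d n \<rho> P Pt" for Pt
    proof (intro conjI allI impI)
      have Pt: "ngon d n Pt" "specializes d Pt P"
        and crPt: "moduli_eq d n (cr d Pt) (scaled const \<rho> generic_t (\<lambda>i j. const (cr d P i j)))"
        using framed unfolding framed_deformation_def lifted_deformation_def by auto
      show "\<exists>Qt. maps_to d n T Pt Qt"
        by (rule transformation_defined[OF assms(2) T map Q Pt])
      fix Qt assume mapt: "maps_to d n T Pt Qt"
      have ngQt: "ngon d n Qt" using mapt unfolding maps_to_def by blast
      have "moduli_eq d n (cr d Pt) (scaled const \<rho> generic_t (cr d (const_polygon P)))"
        using crPt scaled_cong(3)[OF wf\<rho> const_cr[OF assms(6)]] unfolding moduli_eq_def by simp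
      from commutes[OF t0 map mapt defined_t[OF assms(6,8)] this defined_t[OF Q defQ]]
      have "moduli_eq d n (cr d Qt) (scaled const \<rho> generic_t (\<lambda>i j. const (cr d Q i j)))"
        using scaled_cong(3)[OF wf\<rho> const_cr[OF Q]] unfolding moduli_eq_def by simp
      then show "lifted_deformation d n \<rho> Q Qt"
        unfolding lifted_deformation_def
        using ngQt specializes_image[OF assms(2) T map Q Pt(2) mapt] by blast
      have "proj_eq_mat (monodromy Qt) (monodromy Pt)"
        using pres mapt unfolding preserves_monodromy_def by blast
      then show "proj_eq_mat (monodromy Qt) (map_mat to_fract (monodromy_family d n \<rho> P))"
        using P.framed_monodromy[OF framed] by (rule proj_eq_mat_trans)
    qed
    obtain Pt where framed: "framed_deformation d n \<rho> P Pt"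
      using P.framed_deformation_exists by blast
    obtain Qt where Qt: "lifted_deformation d n \<rho> Q Qt"
      "proj_eq_mat (monodromy Qt) (map_mat to_fract (monodromy_family d n \<rho> P))"
      using image[OF framed] by blast
    have "scalar_matrix d (taylor_at_one k (monodromy_family d n \<rho> Q) - taylor_at_one k (monodromy_family d n \<rho> P))"
      if "\<forall>l\<in>{1..<k}. scalar_matrix d (taylor_at_one l (monodromy_family d n \<rho> P))"
      by (rule Q.taylor_invariance[OF Qt(1) P.family_carrier P.family_at_one Qt(2) that])
    then show ?thesis using closedQ image by blast
  qed
  have formula: "taylor_at_one k (monodromy_family d n \<rho> P) *\<^sub>v v = S_sum d n \<rho> P k v
      \<and> deriv_at_one k (monodromy_family d n \<rho> P) *\<^sub>v v = of_nat (fact k) \<cdot>\<^sub>v S_sum d n \<rho> P k v"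
    if v: "v \<in> carrier_vec (d + 1)" for v
  proof
    show taylor: "taylor_at_one k (monodromy_family d n \<rho> P) *\<^sub>v v = S_sum d n \<rho> P k v"
      by (rule P.taylor_family[OF v])
    have "dim_col (taylor_at_one k (monodromy_family d n \<rho> P)) = dim_vec v"
      using P.family_carrier v by (simp add: taylor_at_one_def)
    then show "deriv_at_one k (monodromy_family d n \<rho> P) *\<^sub>v v = of_nat (fact k) \<cdot>\<^sub>v S_sum d n \<rho> P k v"
      unfolding deriv_at_one_eq taylor[symmetric] by (rule smult_mat_mult_vec)
  qed
  show ?thesis
    using P.framed_deformation_exists P.framed_monodromy P.family_at_one formula invariance by blast
qed

end
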